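(* Let $W(y)=\prod_{i=1}^{s}(y-q_i)^{n_i}$, with distinct $q_i\in\mathbb C$ and $N=\sum_{i=1}^s n_i\ge 1$. There are an upper triangular matrix $\mathcal W\in\mathbb C^{N\times N}$ determined by $W$ and its derivatives, a polynomial $\mathcal V(x,y)$ constructed in terms of $W$ and the complete symmetric bivariate polynomials $h_k(x,y)=\sum_{j=0}^k x^jy^{k-j}$, and an ordering of the index pairs $(i,l)$, $1\le i\le s$, $0\le l\le n_i-1$, by which the free functionals $\xi_{i,l}$ are collected into a row vector $(\xi)_x$ with $N$ entries, such that the following holds. Let $u_{x,y}$ be a quasi-definite generalized kernel with $q_i\notin\operatorname{supp}_y(u)$ for all $i$, and let $\check u_{x,y}$ be a general Geronimus perturbation of it, $\check u_{x,y}W(y)=u_{x,y}$, with free functionals $\xi_{i,l}$, also quasi-definite. Then, whenever the indices occurring are nonnegative (that is, $n\ge N$), $$\check P_{1,n}(x)=\Theta_*\begin{pmatrix}\mathcal J[C_{1,n-N}]-\langle P_{1,n-N}(x),(\xi)_x\rangle\mathcal W&P_{1,n-N}(x)\\ \vdots&\vdots\\ \mathcal J[C_{1,n}]-\langle P_{1,n}(x),(\xi)_x\rangle\mathcal W&P_{1,n}(x)\end{pmatrix},$$ $$\check H_n=\Theta_*\begin{pmatrix}\mathcal J[C_{1,n-N}]-\langle P_{1,n-N}(x),(\xi)_x\rangle\mathcal W&H_{n-N}\\ \mathcal J[C_{1,n-N+1}]-\langle P_{1,n-N+1}(x),(\xi)_x\rangle\mathcal W&0\\ \vdots&\vdots\\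 \mathcal J[C_{1,n}]-\langle P_{1,n}(x),(\xi)_x\rangle\mathcal W&0\end{pmatrix},$$ $$\check P_{2,n}(y)=-\Theta_*\begin{pmatrix}\mathcal J[C_{1,n-N}]-\langle P_{1,n-N}(x),(\xi)_x\rangle\mathcal W&H_{n-N}\\ \mathcal J[C_{1,n-N+1}]-\langle P_{1,n-N+1}(x),(\xi)_x\rangle\mathcal W&0\\ \vdots&\vdots\\ \mathcal J[C_{1,n-1}]-\langle P_{1,n-1}(x),(\xi)_x\rangle\mathcal W&0\\ W(y)\big(\mathcal J[K^{\mathrm{mix}}_{n-1}(\cdot,y)]-\langle K_{n-1}(x,y),(\xi)_x\rangle\mathcal W\big)+\mathcal J[\mathcal V(\cdot,y)]&0\end{pmatrix}.$$
   Context: A generalized kernel $u_{x,y}$ is a bivariate distribution in Schwartz's space $\mathcal O_c'$, so that it can be paired with smooth functions which, with their derivatives, have polynomial growth of a fixed order. It defines a bilinear form $\langle P(x),g(y)\rangle_u=\langle u_{x,y},P(x)\otimes g(y)\rangle$, for $P$ a polynomial and $g$ a polynomial or a rational function with poles outside $\operatorname{supp}_y(u)$, the support of $u$ in the variable $y$. The Gram matrix is $G_{k,l}=\langle x^k,y^l\rangle_u$, $k,l\ge 0$; $u$ is quasi-definite if all leading principal minors of $G$ are nonzero. Then uniquely $G=S_1^{-1}HS_2^{-\top}$ with $S_1,S_2$ lower unitriangular and $H=\operatorname{diag}(H_0,H_1,\dots)$. With $\chi(x)=(1,x,x^2,\dots)^\top$, the monic biorthogonal polynomials $P_{1,k},P_{2,k}$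 are the entries of $S_1\chi$ and $S_2\chi$. The second kind functions are $C_{1,k}(z)=\big\langle P_{1,k}(x),\frac1{z-y}\big\rangle_u$ for $z\notin\operatorname{supp}_y(u)$. The Christoffel–Darboux kernel and its mixed version are $K_n(x,y)=\sum_{k=0}^nP_{2,k}(y)H_k^{-1}P_{1,k}(x)$ and $K_n^{\mathrm{mix}}(x,y)=\sum_{k=0}^nP_{2,k}(y)H_k^{-1}C_{1,k}(x)$. A Geronimus perturbation of $u$ by $W$, whose roots lie outside $\operatorname{supp}_y(u)$, is a generalized kernel $\check u$ with $\check u_{x,y}W(y)=u_{x,y}$. It is written $\check u_{x,y}=\frac{u_{x,y}}{W(y)}+\sum_{i=1}^s\sum_{l=0}^{n_i-1}\frac{(-1)^l}{l!}(\xi_{i,l})_x\,\delta^{(l)}(y-q_i)$ with free linear functionals $\xi_{i,l}$ in the variable $x$, that is, $\langle P,g\rangle_{\check u}=\big\langle P(x),\frac{g(y)}{W(y)}\big\rangle_u+\sum_{i,l}\xi_{i,l}(P)\frac{g^{(l)}(q_i)}{l!}$. Objects with a check are the corresponding objects for $\check u$. For a polynomial $P(x)$, $\langle P(x),(\xi)_x\rangle$ is the row vector of the $N$ numbers $\xi_{i,l}(P)$, in the order of the entries of $(\xi)_x$; in $\langle K_{n-1}(x,y),(\xi)_x\rangle$ the functionals act in the variable $x$. The jet of a function $f$ along the roots of $W$ is the row vector $\mathcal J[f]=\big(f(q_1),\frac{f'(q_1)}{1!},\dots,\frac{f^{(n_1-1)}(q_1)}{(n_1-1)!};\dots;f(q_s),\dots,\frac{f^{(n_s-1)}(q_s)}{(n_s-1)!}\big)$;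 for a function of two variables, $\mathcal J[f(\cdot,y)]$ is the jet in the first variable. For a square matrix $M=\begin{pmatrix}A&b\\c&e\end{pmatrix}$ with $e$ the scalar in the last row and last column and $A$ nonsingular, $\Theta_*(M)=e-cA^{-1}b$ (last quasi-determinant). *)

theory Defs
  imports
    "HOL-Analysis.Analysis"
    "HOL-Computational_Algebra.Polynomial"
    "Jordan_Normal_Form.Determinant"
    "Jordan_Normal_Form.Gauss_Jordan_Elimination"
begin

section \<open>Generalized kernels\<close>

text \<open>Test functions are complex-valued functions on the real plane. The list of directions
  of an iterated partial derivative has entries in \<^const>\<open>Basis\<close>, that is, \<open>(1, 0)\<close> or \<open>(0, 1)\<close>.\<close>

primrec iter_partial ::
  "(real \<times> real) list \<Rightarrow> (real \<times> real \<Rightarrow> complex) \<Rightarrow> real \<times> real \<Rightarrow> complex" where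
  "iter_partial [] f = f"
| "iter_partial (v # vs) f = (\<lambda>p. frechet_derivative (iter_partial vs f) (at p) v)"

text \<open>All iterated partial derivatives exist and are differentiable, hence continuous.\<close>

definition smooth :: "(real \<times> real \<Rightarrow> complex) \<Rightarrow> bool" where
  "smooth f \<longleftrightarrow> (\<forall>vs. set vs \<subseteq> Basis \<longrightarrow> iter_partial vs f differentiable_on UNIV)"

text \<open>Smooth functions that grow, together with each of their partial derivatives, at most like
  the \<open>k\<close>-th power of the norm; \<open>Oc\<close> is the union of these spaces over \<open>k\<close>.\<close>

definition Oc_order :: "nat \<Rightarrow> (real \<times> real \<Rightarrow> complex) set" where
  "Oc_order k = {f. smooth f \<and>
     (\<forall>vs. set vs \<subseteq> Basis \<longrightarrow> (\<exists>B. \<forall>p. norm (iter_partial vs f p) \<le> B * (1 + norm p) ^ k))}"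

definition Oc :: "(real \<times> real \<Rightarrow> complex) set" where
  "Oc = (\<Union>k. Oc_order k)"

text \<open>\<open>Oc\<close> carries the locally convex inductive limit topology of the spaces \<open>Oc_order k\<close>, each
  with the weighted sup-seminorms of the partial derivatives. A linear functional on the limit
  is continuous iff its restriction to every \<open>Oc_order k\<close> is, i.e. is bounded by a constant
  times the maximum of finitely many of these seminorms.\<close>

definition generalized_kernel :: "((real \<times> real \<Rightarrow> complex) \<Rightarrow> complex) \<Rightarrow> bool" where
  "generalized_kernel u \<longleftrightarrow>
     (\<forall>f\<in>Oc. \<forall>g\<in>Oc. u (\<lambda>p. f p + g p) = u f + u g) \<and>
     (\<forall>c. \<forall>f\<in>Oc. u (\<lambda>p. c * f p) = c * u f) \<and>
     (\<forall>k. \<exists>d C. \<forall>f\<in>Oc_order k. \<forall>B.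
        (\<forall>vs p. length vs \<le> d \<and> set vs \<subseteq> Basis \<longrightarrow>
           norm (iter_partial vs f p) \<le> B * (1 + norm p) ^ k) \<longrightarrow>
        norm (u f) \<le> C * B)"

definition vanishes_on ::
  "((real \<times> real \<Rightarrow> complex) \<Rightarrow> complex) \<Rightarrow> (real \<times> real) set \<Rightarrow> bool" where
  "vanishes_on u \<Omega> \<longleftrightarrow>
     (\<forall>\<phi>. smooth \<phi> \<and> compact (closure {p. \<phi> p \<noteq> 0}) \<and> closure {p. \<phi> p \<noteq> 0} \<subseteq> \<Omega> \<longrightarrow> u \<phi> = 0)"

text \<open>The support in the second variable: the complement of the largest open \<open>V\<close> such that \<open>u\<close>
  vanishes on \<open>UNIV \<times> V\<close>; equivalently, the closure of the projection of the support of \<open>u\<close>.\<close>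

definition supp_y :: "((real \<times> real \<Rightarrow> complex) \<Rightarrow> complex) \<Rightarrow> real set" where
  "supp_y u = - \<Union>{V. open V \<and> vanishes_on u (UNIV \<times> V)}"

text \<open>Only used for \<open>g\<close> a polynomial or a rational function with poles outside \<open>supp_y u\<close>. Then
  the function \<open>P(x) g(y)\<close> agrees on a neighbourhood of \<open>UNIV \<times> supp_y u\<close> with an element of \<open>Oc\<close>,
  and the value of \<open>u\<close> does not depend on the choice of that element.\<close>

definition kernel_form ::
  "((real \<times> real \<Rightarrow> complex) \<Rightarrow> complex) \<Rightarrow> complex poly \<Rightarrow> (complex \<Rightarrow> complex) \<Rightarrow> complex" where
  "kernel_form u P g = u (SOME \<phi>. \<phi> \<in> Oc \<and>
     (\<exists>U. open U \<and> supp_y u \<subseteq> U \<and>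
       (\<forall>x. \<forall>y\<in>U. \<phi> (x, y) = poly P (complex_of_real x) * g (complex_of_real y))))"

section \<open>Biorthogonal polynomials\<close>

text \<open>In this section \<open>B\<close> is a bilinear form, defined (at least) for a polynomial in its first
  argument and a polynomial function in its second.\<close>

definition gram ::
  "(complex poly \<Rightarrow> (complex \<Rightarrow> complex) \<Rightarrow> complex) \<Rightarrow> nat \<Rightarrow> nat \<Rightarrow> complex" where
  "gram B k l = B (Polynomial.monom 1 k) (\<lambda>y. y ^ l)"

definition quasi_definite ::
  "(complex poly \<Rightarrow> (complex \<Rightarrow> complex) \<Rightarrow> complex) \<Rightarrow> bool" where
  "quasi_definite B \<longleftrightarrow> (\<forall>n. Determinant.det (Matrix.mat n n (\<lambda>(k, l). gram B k l)) \<noteq> 0)"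

text \<open>Semi-infinite matrices are functions of two indices. All sums in products involving a lower
  triangular left factor are finite.\<close>

definition lower_unitriangular :: "(nat \<Rightarrow> nat \<Rightarrow> complex) \<Rightarrow> bool" where
  "lower_unitriangular S \<longleftrightarrow> (\<forall>k. S k k = 1) \<and> (\<forall>k l. k < l \<longrightarrow> S k l = 0)"

definition lower_inverse :: "(nat \<Rightarrow> nat \<Rightarrow> complex) \<Rightarrow> (nat \<Rightarrow> nat \<Rightarrow> complex) \<Rightarrow> bool" where
  "lower_inverse S L \<longleftrightarrow> lower_unitriangular L \<and>
     (\<forall>k l. (\<Sum>j\<le>k. S k j * L j l) = (if k = l then 1 else 0)) \<and>
     (\<forall>k l. (\<Sum>j\<le>k. L k j * S j l) = (if k = l then 1 else 0))"

definition gauss_borel ::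
  "(nat \<Rightarrow> nat \<Rightarrow> complex) \<Rightarrow> (nat \<Rightarrow> nat \<Rightarrow> complex) \<Rightarrow> (nat \<Rightarrow> complex) \<Rightarrow>
    (nat \<Rightarrow> nat \<Rightarrow> complex) \<Rightarrow> bool" where
  "gauss_borel G S1 H S2 \<longleftrightarrow> lower_unitriangular S1 \<and> lower_unitriangular S2 \<and>
     (\<exists>L1 L2. lower_inverse S1 L1 \<and> lower_inverse S2 L2 \<and>
        (\<forall>k l. G k l = (\<Sum>j\<le>k. L1 k j * H j * L2 l j)))"

definition gb_factors ::
  "(complex poly \<Rightarrow> (complex \<Rightarrow> complex) \<Rightarrow> complex) \<Rightarrow>
    (nat \<Rightarrow> nat \<Rightarrow> complex) \<times> (nat \<Rightarrow> complex) \<times> (nat \<Rightarrow> nat \<Rightarrow> complex)" where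
  "gb_factors B = (THE (S1, H, S2). gauss_borel (gram B) S1 H S2)"

definition gb_norm ::
  "(complex poly \<Rightarrow> (complex \<Rightarrow> complex) \<Rightarrow> complex) \<Rightarrow> nat \<Rightarrow> complex" where
  "gb_norm B = fst (snd (gb_factors B))"

definition biorth1 ::
  "(complex poly \<Rightarrow> (complex \<Rightarrow> complex) \<Rightarrow> complex) \<Rightarrow> nat \<Rightarrow> complex poly" where
  "biorth1 B k = (\<Sum>l\<le>k. Polynomial.monom (fst (gb_factors B) k l) l)"

definition biorth2 ::
  "(complex poly \<Rightarrow> (complex \<Rightarrow> complex) \<Rightarrow> complex) \<Rightarrow> nat \<Rightarrow> complex poly" where
  "biorth2 B k = (\<Sum>l\<le>k. Polynomial.monom (snd (snd (gb_factors B)) k l) l)"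

definition second_kind1 ::
  "(complex poly \<Rightarrow> (complex \<Rightarrow> complex) \<Rightarrow> complex) \<Rightarrow> nat \<Rightarrow> complex \<Rightarrow> complex" where
  "second_kind1 B k z = B (biorth1 B k) (\<lambda>y. 1 / (z - y))"

text \<open>The Christoffel--Darboux kernel, as a polynomial in \<open>x\<close> for every value of \<open>y\<close>.\<close>

definition CD_kernel ::
  "(complex poly \<Rightarrow> (complex \<Rightarrow> complex) \<Rightarrow> complex) \<Rightarrow> nat \<Rightarrow> complex \<Rightarrow> complex poly" where
  "CD_kernel B n y = (\<Sum>k\<le>n. Polynomial.smult (poly (biorth2 B k) y * inverse (gb_norm B k)) (biorth1 B k))"

definition CD_mixed ::
  "(complex poly \<Rightarrow> (complex \<Rightarrow> complex) \<Rightarrow> complex) \<Rightarrow> nat \<Rightarrow> complex \<Rightarrow> complex \<Rightarrow> complex" where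
  "CD_mixed B n x y =
     (\<Sum>k\<le>n. poly (biorth2 B k) y * inverse (gb_norm B k) * second_kind1 B k x)"

section \<open>Geronimus perturbations\<close>

text \<open>The roots are \<open>q i\<close> with multiplicity \<open>m i\<close>, for \<open>i < s\<close>.\<close>

definition root_poly :: "nat \<Rightarrow> (nat \<Rightarrow> complex) \<Rightarrow> (nat \<Rightarrow> nat) \<Rightarrow> complex poly" where
  "root_poly s q m = (\<Prod>i<s. [:- q i, 1:] ^ m i)"

definition root_indices :: "nat \<Rightarrow> (nat \<Rightarrow> nat) \<Rightarrow> (nat \<times> nat) set" where
  "root_indices s m = (SIGMA i:{..<s}. {..<m i})"

definition geronimus_form ::
  "((real \<times> real \<Rightarrow> complex) \<Rightarrow> complex) \<Rightarrow> nat \<Rightarrow> (nat \<Rightarrow> complex) \<Rightarrow> (nat \<Rightarrow> nat) \<Rightarrow>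
    (nat \<Rightarrow> nat \<Rightarrow> complex poly \<Rightarrow> complex) \<Rightarrow>
    complex poly \<Rightarrow> (complex \<Rightarrow> complex) \<Rightarrow> complex" where
  "geronimus_form u s q m \<xi> P g =
     kernel_form u P (\<lambda>y. g y / poly (root_poly s q m) y) +
     (\<Sum>i<s. \<Sum>l<m i. \<xi> i l P * ((deriv ^^ l) g (q i) / fact l))"

text \<open>The perturbed kernel multiplied by the polynomial with the given roots is \<open>u\<close>, as a form
  on polynomials.\<close>

lemma closed_supp_y: "closed (supp_y u)"
  unfolding supp_y_def by (auto intro!: closed_Compl)

lemma higher_deriv_poly: "(deriv ^^ l) (poly p) = poly ((pderiv ^^ l) p)"
proof (induction l)
  case (Suc l)
  then show ?case by (auto intro!: ext DERIV_imp_deriv poly_DERIV)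
qed simp

lemma higher_pderiv_root:
  fixes p :: "complex poly"
  shows "[:- a, 1:] ^ k dvd p \<Longrightarrow> l < k \<Longrightarrow> poly ((pderiv ^^ l) p) a = 0"
proof (induction l arbitrary: p k)
  case 0
  then have "[:- a, 1:] dvd p" by (meson dvd_power dvd_trans)
  then show ?case by (simp add: poly_eq_0_iff_dvd)
next
  case (Suc l)
  then obtain k' where k: "k = Suc k'" "l < k'" by (cases k) auto
  from Suc.prems(1) obtain r where p: "p = [:- a, 1:] ^ Suc k' * r"
    unfolding k by (auto elim: dvdE)
  have "[:- a, 1:] ^ k' dvd pderiv p"
  proof -
    have "pderiv p = [:- a, 1:] ^ k' *
        ([:- a, 1:] * pderiv r + r * (Polynomial.smult (of_nat (Suc k')) (pderiv [:- a, 1:])))"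
      unfolding p pderiv_mult pderiv_power_Suc
      by (simp only: power_Suc distrib_left mult_smult_left mult_smult_right mult_ac)
    then show ?thesis by (simp only: dvd_triv_left)
  qed
  from Suc.IH[OF this k(2)] show ?case by (simp add: funpow_swap1)
qed

lemma geronimus_form_times_root_poly:
  assumes "\<And>i. i < s \<Longrightarrow> q i \<notin> complex_of_real ` supp_y u"
  shows "geronimus_form u s q m \<xi> P (poly (root_poly s q m * g)) = kernel_form u P (poly g)"
proof -
  let ?W = "root_poly s q m"
  define R where "R = {y. \<exists>i<s. q i = complex_of_real y}"
  have "R \<subseteq> Re ` q ` {..<s}" unfolding R_def by (force simp: image_iff)
  then have "closed R" by (meson finite_imageI finite_imp_closed finite_lessThan finite_subset)
  then have oR: "open (U - R)" if "open U" for U using that by auto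
  have sR: "supp_y u \<inter> R = {}" using assms unfolding R_def by force
  have W0: "poly ?W (complex_of_real y) \<noteq> 0" if "y \<notin> R" for y
    using that unfolding root_poly_def R_def by (auto simp: poly_prod poly_power)
  have "kernel_form u P (\<lambda>y. poly (?W * g) y / poly ?W y) = kernel_form u P (poly g)"
  proof -
    have *: "(\<exists>U. open U \<and> supp_y u \<subseteq> U \<and> (\<forall>x. \<forall>y\<in>U. \<phi> (x, y) =
          poly P (complex_of_real x) * (poly (?W * g) (complex_of_real y) / poly ?W (complex_of_real y))))
      \<longleftrightarrow> (\<exists>U. open U \<and> supp_y u \<subseteq> U \<and> (\<forall>x. \<forall>y\<in>U. \<phi> (x, y) =
          poly P (complex_of_real x) * poly g (complex_of_real y)))" (is "?L \<longleftrightarrow> ?R")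
      for \<phi> :: "real \<times> real \<Rightarrow> complex"
    proof
      assume ?L
      then obtain U where U: "open U" "supp_y u \<subseteq> U" "\<And>x y. y \<in> U \<Longrightarrow> \<phi> (x, y) =
          poly P (complex_of_real x) * (poly (?W * g) (complex_of_real y) / poly ?W (complex_of_real y))"
        by blast
      show ?R using U oR[OF U(1)] sR W0 by (intro exI[of _ "U - R"]) auto
    next
      assume ?R
      then obtain U where U: "open U" "supp_y u \<subseteq> U" "\<And>x y. y \<in> U \<Longrightarrow> \<phi> (x, y) =
          poly P (complex_of_real x) * poly g (complex_of_real y)"
        by blast
      show ?L using U oR[OF U(1)] sR W0 by (intro exI[of _ "U - R"]) auto
    qed
    show ?thesis unfolding kernel_form_def * ..
  qed
  moreover have "(deriv ^^ l) (poly (?W * g)) (q i) = 0" if "i < s" "l < m i" for i l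
  proof -
    have "[:- q i, 1:] ^ m i dvd ?W * g"
      unfolding root_poly_def using that by (intro dvd_mult2 dvd_prodI) auto
    then show ?thesis using that by (simp only: higher_deriv_poly higher_pderiv_root)
  qed
  ultimately show ?thesis unfolding geronimus_form_def by simp
qed

definition jet ::
  "nat \<Rightarrow> (nat \<Rightarrow> complex) \<Rightarrow> (nat \<Rightarrow> nat) \<Rightarrow> (complex \<Rightarrow> complex) \<Rightarrow> complex Matrix.vec" where
  "jet s q m f =
     vec_of_list (concat (map (\<lambda>i. map (\<lambda>l. (deriv ^^ l) f (q i) / fact l) [0..<m i]) [0..<s]))"

text \<open>The row vector of the values of the free functionals at \<open>P\<close>, multiplied on the right by the
  square matrix \<open>M\<close>; row vectors being of type \<^typ>\<open>complex Matrix.vec\<close>, this is written with the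
  transpose of \<open>M\<close>. The enumeration \<open>e\<close> gives the order of the index pairs.\<close>

definition xi_row ::
  "(nat \<Rightarrow> nat \<times> nat) \<Rightarrow> (nat \<Rightarrow> nat \<Rightarrow> complex poly \<Rightarrow> complex) \<Rightarrow> complex Matrix.mat \<Rightarrow>
    complex poly \<Rightarrow> complex Matrix.vec" where
  "xi_row e \<xi> M P =
     mult_mat_vec (transpose_mat M) (Matrix.vec (dim_row M) (\<lambda>a. \<xi> (fst (e a)) (snd (e a)) P))"

definition complete_sym :: "nat \<Rightarrow> complex \<Rightarrow> complex \<Rightarrow> complex" where
  "complete_sym k x y = (\<Sum>j\<le>k. x ^ j * y ^ (k - j))"

section \<open>Last quasi-determinants\<close>

text \<open>The matrix of size \<open>Suc N\<close> whose \<open>a\<close>-th row is \<open>r a\<close> followed by the scalar \<open>c a\<close>.\<close>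

definition bordered ::
  "nat \<Rightarrow> (nat \<Rightarrow> complex Matrix.vec) \<Rightarrow> (nat \<Rightarrow> complex) \<Rightarrow> complex Matrix.mat" where
  "bordered N r c =
     Matrix.mat (Suc N) (Suc N) (\<lambda>(a, b). if b < N then vec_index (r a) b else c a)"

definition last_quasidet_defined :: "complex Matrix.mat \<Rightarrow> bool" where
  "last_quasidet_defined M \<longleftrightarrow>
     (case split_block M (dim_row M - 1) (dim_col M - 1) of (A, b, c, e) \<Rightarrow> invertible_mat A)"

definition last_quasidet :: "complex Matrix.mat \<Rightarrow> complex" where
  "last_quasidet M =
     (case split_block M (dim_row M - 1) (dim_col M - 1) of (A, b, c, e) \<Rightarrow>
        (e - c * the (mat_inverse A) * b) $$ (0, 0))"

end

theory Submission
  imports Defs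
begin

text \<open>Write \<open>B\<close> for the form of \<open>u\<close>, \<open>B'\<close> for the perturbed form and \<open>f\<^sub>i\<^sub>l = W / (y - q\<^sub>i)\<^sup>l\<^sup>+\<^sup>1\<close>, a polynomial
of degree less than \<open>N\<close>. Everything rests on one observation: for every polynomial \<open>P\<close> the row
\<open>\<J>[B(P, 1/(z - y))] - \<langle>P, \<xi>\<rangle> \<W>\<close> has the entries \<open>- B'(P, f\<^sub>i\<^sub>l)\<close> (lemma \<open>row_entry\<close>). The jet of the
Cauchy transform consists of the numbers \<open>- B(P, 1/(y - q\<^sub>i)\<^sup>l\<^sup>+\<^sup>1) = - B(P, f\<^sub>i\<^sub>l/W)\<close>, and the Taylor coefficients
of \<open>f\<^sub>i\<^sub>l\<close> at \<open>q\<^sub>i\<close> are those of \<open>W\<close>, shifted by \<open>l + 1\<close>; they form \<open>\<W>\<close>. Their index is the sum of the two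
indices \<open>k\<close>, \<open>l\<close> plus one, and the coefficients of index below the multiplicity vanish; so the matrix
becomes upper triangular once the functionals at each root are listed in reverse order.

The formulas are then linear algebra for two biorthogonal families. The \<open>f\<^sub>i\<^sub>l\<close> span the polynomials of
degree less than \<open>N\<close> and \<open>B'(P, W g) = B(P, g)\<close>. Hence the perturbed polynomial of degree \<open>n\<close> is
a combination of the \<open>N + 1\<close> polynomials \<open>P\<^sub>1\<^sub>,\<^sub>n\<^sub>-\<^sub>N, \<dots>, P\<^sub>1\<^sub>,\<^sub>n\<close>, and it is orthogonal to the \<open>f\<^sub>i\<^sub>l\<close>; this is
the linear system solved by the first two quasi-determinants (\<open>perturbed_P1\<close>). The third comes from the
difference of the perturbed Christoffel--Darboux kernel and \<open>W(y)\<close> times the unperturbed one, which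
is a combination of \<open>P\<^sub>1\<^sub>,\<^sub>n\<^sub>-\<^sub>N, \<dots>, P\<^sub>1\<^sub>,\<^sub>n\<^sub>-\<^sub>1\<close> because both kernels reproduce (\<open>perturbed_P2\<close>); the jet of
\<open>\<V>(\<cdot>, y)\<close>, the divided difference of \<open>W\<close>, consists of the values \<open>f\<^sub>i\<^sub>l(y)\<close>. The system is nonsingular, for
a dependency between its rows would be a polynomial of degree less than \<open>n\<close> that \<open>B'\<close> pairs to zero with
all polynomials of degree less than \<open>n\<close> (\<open>rows_independent\<close>).

The analytic part makes \<open>B\<close> a bilinear form that can be differentiated under the bracket. A kernel
vanishes on functions that are zero near its support in \<open>y\<close> (\<open>kernel_vanishes\<close>), so that the value
of \<open>B(P, g)\<close> may be computed with any extension of \<open>P \<otimes> g\<close>. The poles are smoothed away by bump functions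
(\<open>recip_family\<close>), with bounds that are locally uniform in the position of the pole, and the resolvent
identity gives the derivatives of the Cauchy transforms (\<open>higher_deriv_cauchy\<close>).\<close>

section \<open>Families of smooth functions with weighted derivative bounds\<close>

definition pdir :: "real \<times> real \<Rightarrow> (real \<times> real \<Rightarrow> complex) \<Rightarrow> real \<times> real \<Rightarrow> complex" where
  "pdir v f = (\<lambda>p. frechet_derivative f (at p) v)"

lemma pdir_eqI:
  assumes "\<And>p. (f has_derivative f' p) (at p)"
  shows "pdir v f = (\<lambda>p. f' p v)"
  unfolding pdir_def using frechet_derivative_at[OF assms] by metis

text \<open>Peeling off the innermost derivative leaves an iterated derivative of another function; inductions on
the number of derivatives therefore generalize over the function.\<close>

lemma iter_partial_append: "iter_partial (vs @ [v]) f = iter_partial vs (pdir v f)"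
  by (induction vs) (auto simp: pdir_def)

text \<open>All estimates concern families of functions with constants that are uniform over the family: the two
limits taken below let the radius of a cutoff tend to infinity and a pole \<open>z\<close> tend to a point \<open>z\<^sub>0\<close>.\<close>

definition tame0 ::
  "'i set \<Rightarrow> ('i \<Rightarrow> real \<times> real \<Rightarrow> real) \<Rightarrow> ('i \<Rightarrow> real \<times> real \<Rightarrow> complex) \<Rightarrow> bool" where
  "tame0 I w F \<longleftrightarrow> (\<forall>i\<in>I. F i differentiable_on UNIV) \<and>
     (\<exists>C. \<forall>i\<in>I. \<forall>p. norm (F i p) \<le> C * w i p)"

text \<open>The order of differentiation is a parameter because the bounds for reciprocals at order \<open>n + 1\<close>
are derived from those at order \<open>n\<close>.\<close>

primrec tame ::
  "nat \<Rightarrow> 'i set \<Rightarrow> ('i \<Rightarrow> real \<times> real \<Rightarrow> real) \<Rightarrow> ('i \<Rightarrow> real \<times> real \<Rightarrow> complex) \<Rightarrow> bool" where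
  "tame 0 I w F = tame0 I w F"
| "tame (Suc n) I w F = (tame0 I w F \<and> (\<forall>v\<in>Basis. tame n I w (\<lambda>i. pdir v (F i))))"

lemma tame_iff:
  "tame n I w F \<longleftrightarrow>
     (\<forall>vs. length vs \<le> n \<and> set vs \<subseteq> Basis \<longrightarrow> tame0 I w (\<lambda>i. iter_partial vs (F i)))"
proof (induction n arbitrary: F)
  case 0
  then show ?case by simp
next
  case (Suc n)
  show ?case
  proof
    assume L: "tame (Suc n) I w F"
    show "\<forall>vs. length vs \<le> Suc n \<and> set vs \<subseteq> Basis \<longrightarrow> tame0 I w (\<lambda>i. iter_partial vs (F i))"
    proof (intro allI impI)
      fix vs :: "(real \<times> real) list"
      assume vs: "length vs \<le> Suc n \<and> set vs \<subseteq> Basis"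
      show "tame0 I w (\<lambda>i. iter_partial vs (F i))"
      proof (cases vs rule: rev_cases)
        case Nil
        then show ?thesis using L by simp
      next
        case (snoc us v)
        then show ?thesis using L vs Suc[of "\<lambda>i. pdir v (F i)"] by (simp add: iter_partial_append)
      qed
    qed
  next
    assume R: "\<forall>vs. length vs \<le> Suc n \<and> set vs \<subseteq> Basis \<longrightarrow> tame0 I w (\<lambda>i. iter_partial vs (F i))"
    have "tame0 I w F" using R[rule_format, of "[]"] by simp
    moreover have "tame n I w (\<lambda>i. pdir v (F i))" if "v \<in> Basis" for v
      unfolding Suc using R[rule_format, of "_ @ [v]"] that by (simp add: iter_partial_append)
    ultimately show "tame (Suc n) I w F" by simp
  qed
qed

lemma tame_imp_tame0: "tame n I w F \<Longrightarrow> tame0 I w F"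
  by (cases n) auto

lemma tame_Suc_imp: "tame (Suc n) I w F \<Longrightarrow> tame n I w F"
  unfolding tame_iff by auto

lemma tame_cong:
  assumes "\<And>i. i \<in> I \<Longrightarrow> F i = G i"
  shows "tame n I w F = tame n I w G"
  unfolding tame_iff tame0_def using assms by simp

lemma tame_reindex:
  assumes "tame n J w F" "f ` I \<subseteq> J"
  shows "tame n I (\<lambda>i. w (f i)) (\<lambda>i. F (f i))"
  using assms unfolding tame_iff tame0_def by (meson image_subset_iff)

lemma tame0_has_derivative:
  assumes "tame0 I w F" "i \<in> I"
  shows "(F i has_derivative frechet_derivative (F i) (at p)) (at p)"
  using assms unfolding tame0_def frechet_derivative_works[symmetric] differentiable_on_def
  by blast

lemma tame0I:
  assumes "\<And>i p. i \<in> I \<Longrightarrow> (F i has_derivative F' i p) (at p)"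
    and "\<And>i p. i \<in> I \<Longrightarrow> norm (F i p) \<le> C * w i p"
  shows "tame0 I w F"
  unfolding tame0_def differentiable_on_def using assms
  by (metis differentiableI)

lemma tame_SucI:
  assumes "\<And>i p. i \<in> I \<Longrightarrow> (F i has_derivative F' i p) (at p)"
    and "\<And>i p. i \<in> I \<Longrightarrow> norm (F i p) \<le> C * w i p"
    and "\<And>v. v \<in> Basis \<Longrightarrow> tame n I w (\<lambda>i p. F' i p v)"
  shows "tame (Suc n) I w F"
proof -
  have "pdir v (F i) = (\<lambda>p. F' i p v)" if "i \<in> I" for i v
    using pdir_eqI assms(1)[OF that] by blast
  then have "tame n I w (\<lambda>i. pdir v (F i))" if "v \<in> Basis" for v
    using assms(3)[OF that] tame_cong[of I "\<lambda>i. pdir v (F i)" "\<lambda>i p. F' i p v"] by simp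
  then show ?thesis using tame0I[OF assms(1,2)] by simp
qed

lemma tame0_bound:
  assumes "tame0 I w F"
  obtains C where "\<And>i p. i \<in> I \<Longrightarrow> norm (F i p) \<le> C * w i p"
  using assms unfolding tame0_def by blast

lemma tame_add:
  "tame n I w F \<Longrightarrow> tame n I w G \<Longrightarrow> tame n I w (\<lambda>i p. F i p + G i p)"
proof (induction n arbitrary: F G)
  case 0
  then have FG: "tame0 I w F" "tame0 I w G" by auto
  obtain C where C: "\<And>i p. i \<in> I \<Longrightarrow> norm (F i p) \<le> C * w i p" using tame0_bound[OF FG(1)] by blast
  obtain D where D: "\<And>i p. i \<in> I \<Longrightarrow> norm (G i p) \<le> D * w i p" using tame0_bound[OF FG(2)] by blast
  show ?case unfolding tame.simps
  proof (rule tame0I)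
    show "norm (F i p + G i p) \<le> (C + D) * w i p" if "i \<in> I" for i p
      using norm_triangle_mono[OF C[OF that] D[OF that]] by (simp add: distrib_right)
  qed (rule has_derivative_add tame0_has_derivative[OF FG(1)] tame0_has_derivative[OF FG(2)] | assumption)+
next
  case (Suc n)
  then have FG: "tame0 I w F" "tame0 I w G" by auto
  obtain C where C: "\<And>i p. i \<in> I \<Longrightarrow> norm (F i p) \<le> C * w i p" using tame0_bound[OF FG(1)] by blast
  obtain D where D: "\<And>i p. i \<in> I \<Longrightarrow> norm (G i p) \<le> D * w i p" using tame0_bound[OF FG(2)] by blast
  show ?case
  proof (rule tame_SucI)
    show "norm (F i p + G i p) \<le> (C + D) * w i p" if "i \<in> I" for i p
      using norm_triangle_mono[OF C[OF that] D[OF that]] by (simp add: distrib_right)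
    show "((\<lambda>p. F i p + G i p) has_derivative
      (\<lambda>v. frechet_derivative (F i) (at p) v + frechet_derivative (G i) (at p) v)) (at p)"
      if "i \<in> I" for i p
      by (intro has_derivative_add tame0_has_derivative[OF FG(1)] tame0_has_derivative[OF FG(2)] that)
    show "tame n I w (\<lambda>i p. frechet_derivative (F i) (at p) v + frechet_derivative (G i) (at p) v)"
      if "v \<in> Basis" for v
      using Suc.IH[of "\<lambda>i. pdir v (F i)" "\<lambda>i. pdir v (G i)"] Suc.prems that
      by (simp add: pdir_def)
  qed
qed

text \<open>The Leibniz rule in inductive form: each derivative of the product is a sum of two products that are
covered by the induction hypothesis, so no binomial coefficients appear.\<close>

lemma tame_mult:
  "tame n I w F \<Longrightarrow> tame n I w' G \<Longrightarrow> tame n I (\<lambda>i p. w i p * w' i p) (\<lambda>i p. F i p * G i p)"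
proof (induction n arbitrary: F G)
  case 0
  then have FG: "tame0 I w F" "tame0 I w' G" by auto
  obtain C where C: "\<And>i p. i \<in> I \<Longrightarrow> norm (F i p) \<le> C * w i p" using tame0_bound[OF FG(1)] by blast
  obtain D where D: "\<And>i p. i \<in> I \<Longrightarrow> norm (G i p) \<le> D * w' i p" using tame0_bound[OF FG(2)] by blast
  show ?case unfolding tame.simps
  proof (rule tame0I)
    show "norm (F i p * G i p) \<le> (C * D) * (w i p * w' i p)" if "i \<in> I" for i p
      using mult_mono[OF C[OF that, of p] D[OF that, of p]] order_trans[OF norm_ge_zero C[OF that, of p]]
      by (simp add: norm_mult mult_ac)
  qed (rule has_derivative_mult tame0_has_derivative[OF FG(1)] tame0_has_derivative[OF FG(2)] | assumption)+
next
  case (Suc n)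
  then have FG: "tame0 I w F" "tame0 I w' G" by auto
  obtain C where C: "\<And>i p. i \<in> I \<Longrightarrow> norm (F i p) \<le> C * w i p" using tame0_bound[OF FG(1)] by blast
  obtain D where D: "\<And>i p. i \<in> I \<Longrightarrow> norm (G i p) \<le> D * w' i p" using tame0_bound[OF FG(2)] by blast
  show ?case
  proof (rule tame_SucI)
    show "norm (F i p * G i p) \<le> (C * D) * (w i p * w' i p)" if "i \<in> I" for i p
      using mult_mono[OF C[OF that, of p] D[OF that, of p]] order_trans[OF norm_ge_zero C[OF that, of p]]
      by (simp add: norm_mult mult_ac)
    show "((\<lambda>p. F i p * G i p) has_derivative
      (\<lambda>v. F i p * frechet_derivative (G i) (at p) v + frechet_derivative (F i) (at p) v * G i p)) (at p)"
      if "i \<in> I" for i p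
      by (intro has_derivative_mult tame0_has_derivative[OF FG(1)] tame0_has_derivative[OF FG(2)] that)
    show "tame n I (\<lambda>i p. w i p * w' i p)
        (\<lambda>i p. F i p * frechet_derivative (G i) (at p) v + frechet_derivative (F i) (at p) v * G i p)"
      if "v \<in> Basis" for v
      using Suc.IH[of F "\<lambda>i. pdir v (G i)"] Suc.IH[of "\<lambda>i. pdir v (F i)" G] Suc.prems that
        tame_Suc_imp[OF Suc.prems(1)] tame_Suc_imp[OF Suc.prems(2)]
      by (intro tame_add) (simp_all add: pdir_def)
  qed
qed

lemma tame_zero: "tame n I w (\<lambda>i p. 0)"
  by (induction n) (auto intro!: tame_SucI[where C = 0 and F' = "\<lambda>i p v. 0"]
      tame0I[where C = 0 and F' = "\<lambda>i p v. 0"] simp del: tame.simps(2))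

lemma tame_const:
  assumes "\<And>i p. i \<in> I \<Longrightarrow> norm (c i) \<le> C * w i p"
  shows "tame n I w (\<lambda>i p. c i)"
  using assms
  by (cases n) (auto intro!: tame_SucI[where C = C and F' = "\<lambda>i p v. 0"]
      tame0I[where C = C and F' = "\<lambda>i p v. 0"] tame_zero simp del: tame.simps(2))

lemma tame_weaken:
  assumes "tame n I w F" "\<And>i p. i \<in> I \<Longrightarrow> 0 \<le> w i p" "\<And>i p. i \<in> I \<Longrightarrow> w i p \<le> K * w' i p"
  shows "tame n I w' F"
  unfolding tame_iff
proof (intro allI impI)
  fix vs :: "(real \<times> real) list" assume "length vs \<le> n \<and> set vs \<subseteq> Basis"
  then have *: "tame0 I w (\<lambda>i. iter_partial vs (F i))" using assms(1) unfolding tame_iff by blast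
  obtain C where C: "\<And>i p. i \<in> I \<Longrightarrow> norm (iter_partial vs (F i) p) \<le> C * w i p"
    using tame0_bound[OF *] by blast
  have "norm (iter_partial vs (F i) p) \<le> (\<bar>C\<bar> * K) * w' i p" if "i \<in> I" for i p
  proof -
    have "C * w i p \<le> \<bar>C\<bar> * w i p" using assms(2)[OF that] by (simp add: mult_right_mono)
    also have "\<dots> \<le> \<bar>C\<bar> * (K * w' i p)" using assms(3)[OF that] by (simp add: mult_left_mono)
    finally show ?thesis using C[OF that, of p] by (simp add: mult.assoc)
  qed
  then show "tame0 I w' (\<lambda>i. iter_partial vs (F i))" using * unfolding tame0_def by blast
qed

abbreviation unit_weight :: "'i \<Rightarrow> real \<times> real \<Rightarrow> real" where
  "unit_weight \<equiv> \<lambda>_ _. 1"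

lemma tame_mult_unit:
  "tame n I w F \<Longrightarrow> tame n I unit_weight G \<Longrightarrow> tame n I w (\<lambda>i p. F i p * G i p)"
  using tame_mult[of n I w F unit_weight G] by simp

lemma tame_cmult: "tame n I w F \<Longrightarrow> tame n I w (\<lambda>i p. c * F i p)"
  using tame_mult_unit[of n I w F "\<lambda>_ _. c"] tame_const[of I "\<lambda>_. c" "norm c" unit_weight n]
  by (simp add: mult.commute)

lemma tame_one: "tame n I unit_weight (\<lambda>i p. 1)"
  by (rule tame_const[where C = 1]) simp

lemma tame_power: "tame n I unit_weight F \<Longrightarrow> tame n I unit_weight (\<lambda>i p. F i p ^ k)"
  by (induction k) (auto intro: tame_mult_unit tame_one)

text \<open>The derivative \<open>- G'/G\<^sup>2\<close> contains no derivative of the reciprocal, hence is bounded to order \<open>n\<close> as soon as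
the reciprocal is. The function \<open>G\<close> itself may be unbounded; only its derivatives have to be bounded.\<close>

lemma tame_inverse:
  assumes der: "\<And>i p. i \<in> I \<Longrightarrow> (G i has_derivative G' i p) (at p)"
    and tm: "\<And>n v. v \<in> Basis \<Longrightarrow> tame n I unit_weight (\<lambda>i p. G' i p v)"
    and d: "0 < d" "\<And>i p. i \<in> I \<Longrightarrow> d \<le> norm (G i p)"
  shows "tame n I unit_weight (\<lambda>i p. inverse (G i p))"
proof (induction n)
  have nz: "G i p \<noteq> 0" if "i \<in> I" for i p using d(1) d(2)[OF that, of p] by auto
  have bd: "norm (inverse (G i p)) \<le> inverse d * 1" if "i \<in> I" for i p
    using d(1) d(2)[OF that, of p] by (simp add: norm_inverse le_imp_inverse_le)
  have idr: "((\<lambda>p. inverse (G i p)) has_derivative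
      (\<lambda>v. - (inverse (G i p) * G' i p v * inverse (G i p)))) (at p)" if "i \<in> I" for i p
    by (rule Deriv.has_derivative_inverse[OF nz[OF that] der[OF that]])
  {
    case 0
    then show ?case unfolding tame.simps by (intro tame0I[OF idr bd])
  next
    case (Suc n)
    show ?case
    proof (rule tame_SucI[OF idr bd])
      show "tame n I unit_weight (\<lambda>i p. - (inverse (G i p) * G' i p v * inverse (G i p)))"
        if "v \<in> Basis" for v
        using tame_cmult[OF tame_mult_unit[OF tame_mult_unit[OF Suc tm[OF that]] Suc], of "- 1"]
        by simp
    qed
  }
qed

text \<open>The functions \<open>h j\<close> are the successive derivatives of \<open>h 0\<close>.\<close>

lemma tame_affine_comp:
  fixes h :: "nat \<Rightarrow> real \<Rightarrow> real"
  assumes h: "\<And>j t. (h j has_real_derivative h (Suc j) t) (at t)"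
    and bd: "\<And>j t. \<bar>h j t\<bar> \<le> C j"
  shows "tame n I unit_weight (\<lambda>i p. complex_of_real (h j (c + (a * fst p + b * snd p))))"
proof (induction n arbitrary: j)
  have der: "((\<lambda>p. complex_of_real (h j (c + (a * fst p + b * snd p)))) has_derivative
      (\<lambda>v. complex_of_real (a * fst v + b * snd v) *
        complex_of_real (h (Suc j) (c + (a * fst p + b * snd p))))) (at p)" for j p
  proof -
    have "((\<lambda>p. c + (a * fst p + b * snd p)) has_derivative (\<lambda>v. a * fst v + b * snd v)) (at p)"
      by (auto intro!: derivative_eq_intros)
    from has_derivative_compose[OF this h[unfolded has_field_derivative_def]]
    have "((\<lambda>p. h j (c + (a * fst p + b * snd p))) has_derivative
        (\<lambda>v. (a * fst v + b * snd v) * h (Suc j) (c + (a * fst p + b * snd p)))) (at p)"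
      by (simp add: mult.commute)
    from has_derivative_of_real[OF this] show ?thesis by simp
  qed
  {
    case 0
    show ?case unfolding tame.simps
      by (rule tame0I[where C = "C j", OF der]) (simp add: bd)
  next
    case (Suc n)
    show ?case
      by (rule tame_SucI[where C = "C j", OF der]) (simp_all add: bd tame_cmult[OF Suc] del: of_real_add of_real_mult)
  }
qed

lemma has_derivative_rescaled:
  fixes \<theta> :: "real \<times> real \<Rightarrow> complex"
  assumes "tame0 UNIV unit_weight (\<lambda>_ :: unit. \<theta>)"
  shows "((\<lambda>p. \<theta> (p /\<^sub>R R)) has_derivative (\<lambda>v. pdir v \<theta> (p /\<^sub>R R) / complex_of_real R)) (at p)"
proof -
  have *: "(\<theta> has_derivative frechet_derivative \<theta> (at (p /\<^sub>R R))) (at (p /\<^sub>R R))"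
    using tame0_has_derivative[OF assms, of "()"] by simp
  have "((\<lambda>p. p /\<^sub>R R) has_derivative (\<lambda>v. v /\<^sub>R R)) (at p)"
    by (auto intro!: derivative_eq_intros)
  note has_derivative_compose[OF this *]
  also have "(\<lambda>v. frechet_derivative \<theta> (at (p /\<^sub>R R)) (v /\<^sub>R R)) = (\<lambda>v. pdir v \<theta> (p /\<^sub>R R) / complex_of_real R)"
    using linear_cmul[OF has_derivative_linear[OF *], of "inverse R"]
    by (simp add: fun_eq_iff pdir_def scaleR_conv_of_real divide_inverse mult.commute)
  finally show ?thesis .
qed

text \<open>Each derivative contributes a factor \<open>1/R \<le> 1\<close>.\<close>

lemma tame_scaling:
  assumes "tame n UNIV unit_weight (\<lambda>_ :: unit. \<theta>)"
  shows "tame n {1::real..} unit_weight (\<lambda>R p. \<theta> (p /\<^sub>R R))"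
  using assms
proof (induction n arbitrary: \<theta>)
  {
    case 0
    then have t: "tame0 UNIV unit_weight (\<lambda>_ :: unit. \<theta>)" by simp
    obtain C where C: "\<And>i p. i \<in> (UNIV :: unit set) \<Longrightarrow> norm (\<theta> p) \<le> C * 1" using tame0_bound[OF t] by blast
    show ?case unfolding tame.simps
      by (rule tame0I[where C = C, OF has_derivative_rescaled[OF t]]) (use C in auto)
  next
    case (Suc n)
    then have t: "tame0 UNIV unit_weight (\<lambda>_ :: unit. \<theta>)" by simp
    obtain C where C: "\<And>i p. i \<in> (UNIV :: unit set) \<Longrightarrow> norm (\<theta> p) \<le> C * 1" using tame0_bound[OF t] by blast
    show ?case
    proof (rule tame_SucI[where C = C, OF has_derivative_rescaled[OF t]])
      show "norm (\<theta> (p /\<^sub>R R)) \<le> C * 1" for R p using C by auto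
      show "tame n {1::real..} unit_weight (\<lambda>R p. pdir v \<theta> (p /\<^sub>R R) / complex_of_real R)"
        if "v \<in> Basis" for v
      proof -
        have "tame n {1::real..} unit_weight (\<lambda>R p. pdir v \<theta> (p /\<^sub>R R))"
          using Suc that by (intro Suc.IH) simp
        moreover have "tame n {1::real..} unit_weight (\<lambda>R p. inverse (complex_of_real R))"
          by (rule tame_const[where C = 1]) (simp add: norm_inverse inverse_le_1_iff)
        ultimately show ?thesis unfolding divide_inverse by (rule tame_mult_unit)
      qed
    qed
  }
qed

section \<open>Plateau functions\<close>

text \<open>The derivatives of \<open>exp (-1/t)\<close> are of the form \<open>p(1/t) exp (-1/t)\<close> with polynomials \<open>p\<close>, and so this class,
extended by zero to the left, is closed under differentiation.\<close>

definition flat :: "real poly \<Rightarrow> real \<Rightarrow> real" where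
  "flat p t = (if t > 0 then poly p (1 / t) * exp (- (1 / t)) else 0)"

lemma power_le_exp: "0 \<le> s \<Longrightarrow> s ^ n \<le> real n ^ n * exp s" for s :: real
proof (cases "n = 0")
  case False
  assume s: "0 \<le> s"
  have "(s / real n) ^ n \<le> (1 + s / real n) ^ n" using s by (intro power_mono) auto
  also have "\<dots> \<le> exp s" using False s by (intro exp_ge_one_plus_x_over_n_power_n) (auto intro: order_trans[of _ 0])
  finally show ?thesis using False by (simp add: power_divide field_simps)
qed simp

text \<open>With \<open>s = 1/t\<close> the claim is that \<open>p(s) exp (-s)\<close> is bounded for positive \<open>s\<close>.\<close>

lemma flat_bounded: "\<exists>C. \<forall>t. \<bar>flat p t\<bar> \<le> C"
proof -
  define C where "C = (\<Sum>i\<le>degree p. \<bar>coeff p i\<bar> * real i ^ i)"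
  have "\<bar>flat p t\<bar> \<le> C" for t
  proof (cases "t > 0")
    case True
    define s where "s = 1 / t"
    have s: "0 \<le> s" using True by (simp add: s_def)
    have "\<bar>poly p s\<bar> \<le> (\<Sum>i\<le>degree p. \<bar>coeff p i * s ^ i\<bar>)"
      unfolding poly_altdef by (rule sum_abs)
    also have "\<dots> \<le> (\<Sum>i\<le>degree p. \<bar>coeff p i\<bar> * (real i ^ i * exp s))"
      using s power_le_exp[OF s] by (intro sum_mono) (simp add: abs_mult mult_left_mono)
    also have "\<dots> = C * exp s" unfolding C_def by (simp add: sum_distrib_right mult.assoc)
    finally show ?thesis using True
      by (simp add: flat_def s_def[symmetric] abs_mult exp_minus field_simps)
  next
    case False
    then show ?thesis by (simp add: flat_def C_def sum_nonneg)
  qed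
  then show ?thesis by blast
qed

definition flat_deriv_poly :: "real poly \<Rightarrow> real poly" where
  "flat_deriv_poly p = [:0, 0, 1:] * (p - pderiv p)"

text \<open>Only the origin needs an argument: since \<open>flat\<close> is bounded for the polynomial \<open>s\<^sup>2 p(s)\<close> as well, \<open>flat p t\<close> is
\<open>O(t\<^sup>2)\<close>.\<close>

lemma flat_deriv: "(flat p has_real_derivative flat (flat_deriv_poly p) t) (at t)"
proof -
  consider "t > 0" | "t < 0" | "t = 0" by linarith
  then show ?thesis
  proof cases
    case 1
    have "((\<lambda>t. poly p (1 / t) * exp (- (1 / t))) has_real_derivative flat (flat_deriv_poly p) t) (at t)"
    proof -
      have i: "((\<lambda>t. 1 / t) has_real_derivative - (1 / t\<^sup>2)) (at t)"
        using 1 by (auto intro!: derivative_eq_intros simp: power2_eq_square)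
      have p: "((\<lambda>t. poly p (1 / t)) has_real_derivative poly (pderiv p) (1 / t) * - (1 / t\<^sup>2)) (at t)"
        by (rule DERIV_chain2[OF poly_DERIV i])
      have e: "((\<lambda>t. exp (- (1 / t))) has_real_derivative exp (- (1 / t)) * (1 / t\<^sup>2)) (at t)"
        using DERIV_chain2[OF DERIV_exp DERIV_minus[OF i]] by simp
      show ?thesis
        by (rule DERIV_cong[OF DERIV_mult[OF p e]])
          (use 1 in \<open>simp add: flat_def flat_deriv_poly_def algebra_simps power2_eq_square\<close>)
    qed
    moreover have "\<forall>\<^sub>F x in nhds t. poly p (1 / x) * exp (- (1 / x)) = flat p x"
      using eventually_nhds_in_open[of "{0<..}" t] 1 by (auto elim!: eventually_mono simp: flat_def)
    ultimately show ?thesis by (rule DERIV_cong_ev[OF refl _ refl, THEN iffD1, rotated])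
  next
    case 2
    have "((\<lambda>t. 0) has_real_derivative flat (flat_deriv_poly p) t) (at t)" using 2 by (simp add: flat_def)
    moreover have "\<forall>\<^sub>F x in nhds t. 0 = flat p x"
      using eventually_nhds_in_open[of "{..<0}" t] 2 by (auto elim!: eventually_mono simp: flat_def)
    ultimately show ?thesis by (rule DERIV_cong_ev[OF refl _ refl, THEN iffD1, rotated])
  next
    case 3
    obtain C where C: "\<And>t. \<bar>flat ([:0, 0, 1:] * p) t\<bar> \<le> C" using flat_bounded by blast
    have *: "\<bar>flat p h\<bar> \<le> C * h\<^sup>2" for h
    proof (cases "h > 0")
      case True
      have "flat ([:0, 0, 1:] * p) h = flat p h / h\<^sup>2" using True by (simp add: flat_def power2_eq_square)
      then have "\<bar>flat p h\<bar> / h\<^sup>2 \<le> C" using C[of h] by (simp only: abs_divide abs_power2 power2_abs)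
      then show ?thesis using True by (simp add: divide_le_eq)
    next
      case False
      have "0 \<le> C" using C[of 0] by (simp add: flat_def)
      then show ?thesis using False by (simp add: flat_def)
    qed
    have "(\<lambda>h. (flat p (0 + h) - flat p 0) / h) \<midarrow>0\<rightarrow> 0"
    proof (rule Lim_null_comparison)
      show "\<forall>\<^sub>F h in at 0. norm ((flat p (0 + h) - flat p 0) / h) \<le> C * \<bar>h\<bar>"
      proof (rule eventually_at_topological[THEN iffD2], intro exI[of _ UNIV] conjI ballI impI)
        fix h :: real assume "h \<noteq> 0"
        then show "norm ((flat p (0 + h) - flat p 0) / h) \<le> C * \<bar>h\<bar>"
          using *[of h] by (simp add: flat_def abs_divide divide_le_eq power2_eq_square mult.assoc)
      qed auto
      show "((\<lambda>h. C * \<bar>h\<bar>) \<longlongrightarrow> 0) (at 0)" by (auto intro!: tendsto_eq_intros)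
    qed
    then show ?thesis using 3 by (simp add: DERIV_def flat_def)
  qed
qed

lemma tame_flat:
  "tame n I unit_weight (\<lambda>i p. complex_of_real (flat 1 (c + (a * fst p + b * snd p))))"
proof -
  obtain C where C: "\<And>p t. \<bar>flat p t\<bar> \<le> C p" using flat_bounded by metis
  show ?thesis
    using tame_affine_comp[of "\<lambda>j. flat ((flat_deriv_poly ^^ j) 1)" "\<lambda>j. C ((flat_deriv_poly ^^ j) 1)" n I 0 c a b]
      flat_deriv C by simp
qed

text \<open>A smooth function that is 0 on the left of 0 and 1 on the right of 1.\<close>

definition smooth_step :: "real \<Rightarrow> real" where
  "smooth_step t = flat 1 t * inverse (flat 1 t + flat 1 (1 - t))"

definition plateau :: "real \<Rightarrow> real" where
  "plateau t = smooth_step (2 + t) * smooth_step (2 - t)"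

lemma flat_nonneg: "0 \<le> flat 1 t"
  by (simp add: flat_def)

lemma flat_denominator: "exp (- 2) \<le> flat 1 t + flat 1 (1 - t)"
proof (cases "t \<ge> 1 / 2")
  case True
  then have "exp (- 2) \<le> flat 1 t" by (simp add: flat_def field_simps)
  then show ?thesis using flat_nonneg[of "1 - t"] by linarith
next
  case False
  then have "exp (- 2) \<le> flat 1 (1 - t)" by (simp add: flat_def field_simps)
  then show ?thesis using flat_nonneg[of t] by linarith
qed

lemma smooth_step_bounds: "0 \<le> smooth_step t" "smooth_step t \<le> 1"
proof -
  have "0 < flat 1 t + flat 1 (1 - t)" using flat_denominator[of t] exp_gt_zero[of "- 2 :: real"] by linarith
  then show "0 \<le> smooth_step t" "smooth_step t \<le> 1"
    unfolding smooth_step_def using flat_nonneg[of t] flat_nonneg[of "1 - t"] by (auto simp: field_simps)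
qed

lemma plateau_bounds: "0 \<le> plateau t" "plateau t \<le> 1"
  unfolding plateau_def using smooth_step_bounds[of "2 + t"] smooth_step_bounds[of "2 - t"] by (auto intro: mult_le_one)

lemma plateau_eq_1: "\<bar>t\<bar> \<le> 1 \<Longrightarrow> plateau t = 1"
  by (auto simp: plateau_def smooth_step_def flat_def)

lemma plateau_eq_0: "2 \<le> \<bar>t\<bar> \<Longrightarrow> plateau t = 0"
  by (auto simp: plateau_def smooth_step_def flat_def abs_if split: if_splits)

lemma tame_smooth_step:
  "tame n I unit_weight (\<lambda>i p. complex_of_real (smooth_step (c + (a * fst p + b * snd p))))"
proof -
  have 1: "tame n I unit_weight (\<lambda>i p. complex_of_real (flat 1 (c + (a * fst p + b * snd p))))" for n
    by (rule tame_flat)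
  have 2: "tame n I unit_weight (\<lambda>i p. complex_of_real (flat 1 (1 - (c + (a * fst p + b * snd p)))))" for n
    using tame_flat[of n I "1 - c" "- a" "- b"] by (simp add: algebra_simps)
  define G where "G p = complex_of_real (flat 1 (c + (a * fst p + b * snd p))) +
      complex_of_real (flat 1 (1 - (c + (a * fst p + b * snd p))))" for p
  have G: "tame n I unit_weight (\<lambda>_. G)" for n
    unfolding G_def by (rule tame_add[OF 1 2])
  have "tame n I unit_weight (\<lambda>i p. inverse (G p))"
  proof (rule tame_inverse[of I "\<lambda>_. G" "\<lambda>i p. frechet_derivative G (at p)" "exp (- 2)"])
    show "(G has_derivative frechet_derivative G (at p)) (at p)" if "i \<in> I" for i p
      using tame0_has_derivative[OF tame_imp_tame0[OF G] that] .
    show "tame n I unit_weight (\<lambda>i p. frechet_derivative G (at p) v)" if "v \<in> Basis" for n v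
      using G[of "Suc n"] that by (simp add: pdir_def)
    show "exp (- 2) \<le> norm (G p)" for p
      unfolding G_def of_real_add[symmetric] norm_of_real
      using flat_denominator by (rule order_trans[OF _ abs_ge_self])
  qed simp
  from tame_mult_unit[OF 1 this] show ?thesis by (simp add: smooth_step_def G_def)
qed

lemma tame_plateau:
  "tame n I unit_weight (\<lambda>i p. complex_of_real (plateau (c + (a * fst p + b * snd p))))"
  using tame_mult_unit[OF tame_smooth_step[of n I "2 + c" a b] tame_smooth_step[of n I "2 - c" "- a" "- b"]]
  by (simp add: plateau_def algebra_simps)

section \<open>The space of smooth functions of polynomial growth\<close>

abbreviation growth :: "nat \<Rightarrow> 'i \<Rightarrow> real \<times> real \<Rightarrow> real" where
  "growth k \<equiv> \<lambda>_ p. (1 + norm p) ^ k"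

lemma Oc_order_iff: "f \<in> Oc_order k \<longleftrightarrow> (\<forall>n. tame n (UNIV :: unit set) (growth k) (\<lambda>_. f))"
  unfolding Oc_order_def smooth_def tame_iff tame0_def by auto

lemma tame_imp_Oc_order:
  assumes "\<And>n. tame n I (growth k) F" "i \<in> I"
  shows "F i \<in> Oc_order k"
  unfolding Oc_order_iff using tame_reindex[OF assms(1), of "\<lambda>_. i" UNIV] assms(2) by auto

lemma Oc_order_imp_tame: "f \<in> Oc_order k \<Longrightarrow> tame n I (growth k) (\<lambda>_. f)"
  unfolding Oc_order_iff using tame_reindex[of n UNIV "growth k" "\<lambda>_ :: unit. f" "\<lambda>_. ()" I] by simp

lemma Oc_order_mono:
  assumes "f \<in> Oc_order k" "k \<le> l"
  shows "f \<in> Oc_order l"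
  unfolding Oc_order_iff
proof
  fix n
  show "tame n (UNIV :: unit set) (growth l) (\<lambda>_. f)"
    by (rule tame_weaken[OF Oc_order_imp_tame[OF assms(1)], where K = 1])
      (use assms(2) in \<open>auto intro: power_increasing\<close>)
qed

lemma Oc_orderI: "f \<in> Oc_order k \<Longrightarrow> f \<in> Oc"
  unfolding Oc_def by blast

lemma Oc_E:
  assumes "f \<in> Oc"
  obtains k where "f \<in> Oc_order k"
  using assms unfolding Oc_def by blast

lemma Oc_order_unit: "(\<And>n. tame n (UNIV :: unit set) unit_weight (\<lambda>_. f)) \<Longrightarrow> f \<in> Oc_order 0"
  unfolding Oc_order_iff by simp

lemma Oc_order_mult: "f \<in> Oc_order k \<Longrightarrow> g \<in> Oc_order l \<Longrightarrow> (\<lambda>p. f p * g p) \<in> Oc_order (k + l)"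
  unfolding Oc_order_iff power_add by (intro allI tame_mult) auto

lemma Oc_mult: "f \<in> Oc \<Longrightarrow> g \<in> Oc \<Longrightarrow> (\<lambda>p. f p * g p) \<in> Oc"
  using Oc_order_mult unfolding Oc_def by blast

lemma Oc_add:
  assumes "f \<in> Oc" "g \<in> Oc"
  shows "(\<lambda>p. f p + g p) \<in> Oc"
proof -
  obtain k l where "f \<in> Oc_order k" "g \<in> Oc_order l" using assms by (meson Oc_E)
  then have "f \<in> Oc_order (max k l)" "g \<in> Oc_order (max k l)" by (auto intro: Oc_order_mono)
  then have "(\<lambda>p. f p + g p) \<in> Oc_order (max k l)"
    unfolding Oc_order_iff by (intro allI tame_add) auto
  then show ?thesis by (rule Oc_orderI)
qed

lemma Oc_const: "(\<lambda>p. c) \<in> Oc"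
  by (rule Oc_orderI[OF Oc_order_unit]) (rule tame_const[where C = "norm c"], simp)

lemma Oc_cmult: "f \<in> Oc \<Longrightarrow> (\<lambda>p. c * f p) \<in> Oc"
  by (rule Oc_mult[OF Oc_const])

lemma Oc_diff: "f \<in> Oc \<Longrightarrow> g \<in> Oc \<Longrightarrow> (\<lambda>p. f p - g p) \<in> Oc"
  using Oc_add[of f "\<lambda>p. - 1 * g p"] Oc_cmult[of g "- 1"] by simp

lemma Oc_order_linear: "(\<lambda>p. complex_of_real (a * fst p + b * snd p)) \<in> Oc_order 1"
  unfolding Oc_order_iff
proof
  fix n
  let ?F = "\<lambda>_ :: unit. \<lambda>p :: real \<times> real. complex_of_real (a * fst p + b * snd p)"
  have der: "(?F i has_derivative (\<lambda>v. complex_of_real (a * fst v + b * snd v))) (at p)" for i p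
    by (auto intro!: derivative_eq_intros)
  have bd: "norm (?F i p) \<le> (\<bar>a\<bar> + \<bar>b\<bar>) * growth 1 i p" for i p
  proof -
    have "\<bar>a * fst p + b * snd p\<bar> \<le> \<bar>a\<bar> * \<bar>fst p\<bar> + \<bar>b\<bar> * \<bar>snd p\<bar>"
      by (metis abs_mult abs_triangle_ineq)
    also have "\<dots> \<le> \<bar>a\<bar> * norm p + \<bar>b\<bar> * norm p"
      using norm_fst_le[of "fst p" "snd p"] norm_snd_le[of "snd p" "fst p"]
      by (intro add_mono mult_left_mono) auto
    also have "\<dots> \<le> (\<bar>a\<bar> + \<bar>b\<bar>) * growth 1 i p" by (simp add: algebra_simps)
    finally show ?thesis by (simp del: of_real_add of_real_mult)
  qed
  have cst: "tame n UNIV (growth 1) (\<lambda>(i :: unit) p. complex_of_real c)" for n c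
    by (rule tame_const[where C = "\<bar>c\<bar>"]) (simp add: mult_le_cancel_left1)
  show "tame n UNIV (growth 1) ?F"
  proof (cases n)
    case 0
    then show ?thesis using tame0I[OF der bd] by simp
  next
    case (Suc m)
    show ?thesis unfolding Suc by (rule tame_SucI[OF der bd cst])
  qed
qed

lemma Oc_poly_linear: "(\<lambda>p. poly P (complex_of_real (a * fst p + b * snd p))) \<in> Oc"
proof (induction P)
  case 0
  then show ?case using Oc_const[of 0] by simp
next
  case (pCons c P)
  then show ?case
    using Oc_add[OF Oc_const Oc_mult[OF Oc_orderI[OF Oc_order_linear] pCons.IH]] by simp
qed

lemma Oc_poly_fst: "(\<lambda>p. poly P (complex_of_real (fst p))) \<in> Oc"
  using Oc_poly_linear[of P 1 0] by simp

lemma Oc_poly_snd: "(\<lambda>p. poly P (complex_of_real (snd p))) \<in> Oc"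
  using Oc_poly_linear[of P 0 1] by simp

section \<open>A kernel vanishes on functions that vanish near its support\<close>

context
  fixes u :: "(real \<times> real \<Rightarrow> complex) \<Rightarrow> complex"
  assumes gk: "generalized_kernel u"
begin

lemma kernel_add: "f \<in> Oc \<Longrightarrow> g \<in> Oc \<Longrightarrow> u (\<lambda>p. f p + g p) = u f + u g"
  using gk unfolding generalized_kernel_def by blast

lemma kernel_cmult: "f \<in> Oc \<Longrightarrow> u (\<lambda>p. c * f p) = c * u f"
  using gk unfolding generalized_kernel_def by blast

lemma kernel_zero: "u (\<lambda>p. 0) = 0"
  using kernel_cmult[OF Oc_const, of 0] by simp

lemma kernel_diff: "f \<in> Oc \<Longrightarrow> g \<in> Oc \<Longrightarrow> u (\<lambda>p. f p - g p) = u f - u g"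
  using kernel_add[of f "\<lambda>p. - 1 * g p"] kernel_cmult[of g "- 1"] Oc_cmult[of g "- 1"] by simp

text \<open>Continuity on \<open>Oc_order k\<close> in quantitative form: smallness of a family in the weighted seminorms
passes to the values of the functional.\<close>

lemma kernel_family_bound:
  assumes F: "\<And>n. tame n I (\<lambda>i p. c i * (1 + norm p) ^ k) F"
    and c: "\<And>i. i \<in> I \<Longrightarrow> 0 \<le> c i"
  shows "\<exists>C. \<forall>i\<in>I. norm (u (F i)) \<le> C * c i"
proof -
  obtain d C where C: "\<And>f B. f \<in> Oc_order k \<Longrightarrow>
      (\<And>vs p. length vs \<le> d \<Longrightarrow> set vs \<subseteq> Basis \<Longrightarrow> norm (iter_partial vs f p) \<le> B * (1 + norm p) ^ k) \<Longrightarrow>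
      norm (u f) \<le> C * B"
    using gk unfolding generalized_kernel_def by metis
  define A where "A = {vs :: (real \<times> real) list. set vs \<subseteq> Basis \<and> length vs \<le> d}"
  have A: "finite A" unfolding A_def by (rule finite_lists_length_le) simp
  have "\<exists>D. \<forall>i\<in>I. \<forall>p. norm (iter_partial vs (F i) p) \<le> D * (c i * (1 + norm p) ^ k)" if "vs \<in> A" for vs
    using F[of d] that unfolding A_def tame_iff tame0_def by blast
  then obtain D where D: "\<And>vs i p. vs \<in> A \<Longrightarrow> i \<in> I \<Longrightarrow>
      norm (iter_partial vs (F i) p) \<le> D vs * (c i * (1 + norm p) ^ k)"
    by metis
  define E where "E = (\<Sum>vs\<in>A. \<bar>D vs\<bar>)"
  have "norm (u (F i)) \<le> C * (E * c i)" if i: "i \<in> I" for i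
  proof (rule C)
    have "tame n UNIV (\<lambda>(_ :: unit) p. c i * (1 + norm p) ^ k) (\<lambda>_. F i)" for n
      using tame_reindex[OF F, of "\<lambda>_. i" UNIV] i by auto
    then have "tame n UNIV (growth k) (\<lambda>_ :: unit. F i)" for n
      by (rule tame_weaken[where K = "c i"]) (use c[OF i] in auto)
    then show "F i \<in> Oc_order k" unfolding Oc_order_iff by blast
    show "norm (iter_partial vs (F i) p) \<le> E * c i * (1 + norm p) ^ k"
      if "length vs \<le> d" "set vs \<subseteq> Basis" for vs p
    proof -
      have vs: "vs \<in> A" using that unfolding A_def by blast
      have "D vs \<le> E" unfolding E_def
        using member_le_sum[OF vs, of "\<lambda>vs. \<bar>D vs\<bar>"] A by force
      then have "D vs * (c i * (1 + norm p) ^ k) \<le> E * (c i * (1 + norm p) ^ k)"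
        using c[OF i] by (intro mult_right_mono) auto
      then show ?thesis using D[OF vs i, of p] by (simp add: mult.assoc)
    qed
  qed
  then show ?thesis by (metis mult.assoc)
qed

lemma Oc_plateau: "(\<lambda>p. complex_of_real (plateau ((snd p - y) / r))) \<in> Oc"
proof -
  have "(\<lambda>p :: real \<times> real. plateau ((snd p - y) / r)) = (\<lambda>p. plateau (- y / r + (0 * fst p + (1 / r) * snd p)))"
    by (simp add: diff_divide_distrib)
  then show ?thesis
    using Oc_orderI[OF Oc_order_unit[OF tame_plateau[of _ UNIV "- y / r" 0 "1 / r"]]] by metis
qed

text \<open>A function supported where the kernel vanishes locally can be split off. Multiplying by \<open>1 - \<eta>\<close> for one
plateau function \<open>\<eta>\<close> at a time does the work of a partition of unity without dividing by a sum of bumps.\<close>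

lemma kernel_localize:
  assumes "\<phi> \<in> Oc" "bounded {p. \<phi> p \<noteq> 0}"
    and "\<And>y r. (y, r) \<in> set L \<Longrightarrow> 0 < r \<and> (\<exists>V. {y - 2 * r..y + 2 * r} \<subseteq> V \<and> vanishes_on u (UNIV \<times> V))"
  shows "u \<phi> = u (\<lambda>p. \<phi> p * (\<Prod>(y, r)\<leftarrow>L. 1 - complex_of_real (plateau ((snd p - y) / r))))"
  using assms
proof (induction L arbitrary: \<phi>)
  case Nil
  then show ?case by simp
next
  case (Cons yr L)
  obtain y r where yr: "yr = (y, r)" by (cases yr)
  define \<eta> where "\<eta> p = complex_of_real (plateau ((snd p - y) / r))" for p :: "real \<times> real"
  obtain V where r: "0 < r" and V: "{y - 2 * r..y + 2 * r} \<subseteq> V" "vanishes_on u (UNIV \<times> V)"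
    using Cons.prems(3)[of y r] yr by auto
  have \<eta>: "\<eta> \<in> Oc" unfolding \<eta>_def by (rule Oc_plateau)
  have 1: "(\<lambda>p. \<phi> p * \<eta> p) \<in> Oc" "(\<lambda>p. \<phi> p * (1 - \<eta> p)) \<in> Oc"
    by (rule Oc_mult[OF Cons.prems(1) \<eta>], rule Oc_mult[OF Cons.prems(1) Oc_diff[OF Oc_const \<eta>]])
  have "u \<phi> = u (\<lambda>p. \<phi> p * \<eta> p + \<phi> p * (1 - \<eta> p))" by (simp add: algebra_simps)
  also have "\<dots> = u (\<lambda>p. \<phi> p * \<eta> p) + u (\<lambda>p. \<phi> p * (1 - \<eta> p))" by (rule kernel_add[OF 1])
  also have "u (\<lambda>p. \<phi> p * \<eta> p) = 0"
  proof -
    have b: "{p. \<phi> p * \<eta> p \<noteq> 0} \<subseteq> {p. \<phi> p \<noteq> 0}" by auto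
    have "{p. \<phi> p * \<eta> p \<noteq> 0} \<subseteq> UNIV \<times> {y - 2 * r..y + 2 * r}"
    proof
      fix p assume "p \<in> {p. \<phi> p * \<eta> p \<noteq> 0}"
      then have "plateau ((snd p - y) / r) \<noteq> 0" by (auto simp: \<eta>_def)
      then have "\<bar>(snd p - y) / r\<bar> < 2" using plateau_eq_0 by force
      then show "p \<in> UNIV \<times> {y - 2 * r..y + 2 * r}"
        using r by (cases p) (auto simp: abs_if field_simps split: if_splits)
    qed
    then have "closure {p. \<phi> p * \<eta> p \<noteq> 0} \<subseteq> UNIV \<times> {y - 2 * r..y + 2 * r}"
      by (rule closure_minimal) (intro closed_Times closed_UNIV closed_atLeastAtMost)
    then have "closure {p. \<phi> p * \<eta> p \<noteq> 0} \<subseteq> UNIV \<times> V" using V(1) by blast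
    moreover have "compact (closure {p. \<phi> p * \<eta> p \<noteq> 0})"
      using bounded_subset[OF Cons.prems(2) b] by (simp add: compact_closure)
    moreover have "smooth (\<lambda>p. \<phi> p * \<eta> p)" using 1(1) unfolding Oc_def Oc_order_def by blast
    ultimately show ?thesis using V(2) unfolding vanishes_on_def by blast
  qed
  also have "u (\<lambda>p. \<phi> p * (1 - \<eta> p)) =
      u (\<lambda>p. \<phi> p * (1 - \<eta> p) * (\<Prod>(y, r)\<leftarrow>L. 1 - complex_of_real (plateau ((snd p - y) / r))))"
    by (rule Cons.IH[OF 1(2) bounded_subset[OF Cons.prems(2)]]) (use Cons.prems(3) in auto)
  finally show ?case by (simp add: yr \<eta>_def mult.assoc)
qed

text \<open>The \<open>y\<close>-coordinates of the support of \<open>\<phi>\<close> form a compact set off the support of \<open>u\<close>, which finitely many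
plateau functions cover; the product of the factors \<open>1 - \<eta>\<close> then kills \<open>\<phi>\<close>.\<close>

lemma kernel_vanishes_compact:
  assumes "\<phi> \<in> Oc" "bounded {p. \<phi> p \<noteq> 0}"
    and U: "open U" "supp_y u \<subseteq> U" "\<And>x y. y \<in> U \<Longrightarrow> \<phi> (x, y) = 0"
  shows "u \<phi> = 0"
proof -
  define K where "K = closure (snd ` {p. \<phi> p \<noteq> 0})"
  have K: "compact K" unfolding K_def compact_closure by (rule bounded_snd[OF assms(2)])
  have "snd ` {p. \<phi> p \<noteq> 0} \<subseteq> - U" using U(3) by auto
  then have "K \<subseteq> - U" unfolding K_def using U(1) by (intro closure_minimal) (auto intro: closed_Compl)
  then have KU: "y \<notin> supp_y u" if "y \<in> K" for y using that U(2) by blast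
  have "\<exists>r. 0 < r \<and> (\<exists>V. {y - 2 * r..y + 2 * r} \<subseteq> V \<and> vanishes_on u (UNIV \<times> V))" if y: "y \<in> K" for y
  proof -
    obtain V where V: "open V" "vanishes_on u (UNIV \<times> V)" "y \<in> V"
      using KU[OF y] unfolding supp_y_def by blast
    obtain e where e: "e > 0" "cball y e \<subseteq> V" using open_contains_cball V(1,3) by blast
    \<comment> \<open>A plateau of half-width \<open>r\<close> has support of half-width \<open>2 * r\<close>; hence the choice \<open>r = e / 2\<close>.\<close>
    have "{y - 2 * (e / 2)..y + 2 * (e / 2)} \<subseteq> V" using e(2) by (auto simp: cball_eq_atLeastAtMost)
    then show ?thesis using e(1) V(2) by (intro exI[of _ "e / 2"]) auto
  qed
  then obtain r where r: "\<And>y. y \<in> K \<Longrightarrow>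
      0 < r y \<and> (\<exists>V. {y - 2 * r y..y + 2 * r y} \<subseteq> V \<and> vanishes_on u (UNIV \<times> V))"
    by metis
  have "K \<subseteq> (\<Union>y\<in>K. ball y (r y))" using r by force
  then obtain T where T: "T \<subseteq> K" "finite T" "K \<subseteq> (\<Union>y\<in>T. ball y (r y))"
    using compactE_image[OF K, of K "\<lambda>y. ball y (r y)"] by blast
  obtain ys where ys: "set ys = T" using finite_list[OF T(2)] by blast
  let ?L = "map (\<lambda>y. (y, r y)) ys"
  have "u \<phi> = u (\<lambda>p. \<phi> p * (\<Prod>(y, r)\<leftarrow>?L. 1 - complex_of_real (plateau ((snd p - y) / r))))"
    by (rule kernel_localize[OF assms(1,2)]) (use r T(1) ys in auto)
  also have "(\<lambda>p. \<phi> p * (\<Prod>(y, r)\<leftarrow>?L. 1 - complex_of_real (plateau ((snd p - y) / r)))) = (\<lambda>p. 0)"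
  proof
    fix p
    show "\<phi> p * (\<Prod>(y, r)\<leftarrow>?L. 1 - complex_of_real (plateau ((snd p - y) / r))) = 0"
    proof (cases "\<phi> p = 0")
      case False
      then have "snd p \<in> snd ` {p. \<phi> p \<noteq> 0}" by auto
      then have "snd p \<in> K" unfolding K_def by (rule subsetD[OF closure_subset])
      then obtain y where y: "y \<in> T" "\<bar>snd p - y\<bar> < r y"
        using T(3) by (auto simp: dist_real_def abs_minus_commute)
      then have "plateau ((snd p - y) / r y) = 1" by (intro plateau_eq_1) (auto simp: abs_divide)
      then have "\<exists>z\<in>set ?L. (\<lambda>(y, r). 1 - complex_of_real (plateau ((snd p - y) / r))) z = 0"
        using y ys by auto
      then have "0 \<in> set (map (\<lambda>(y, r). 1 - complex_of_real (plateau ((snd p - y) / r))) ?L)"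
        unfolding set_map image_iff by force
      then show ?thesis by (simp add: prod_list_zero_iff)
    qed simp
  qed
  finally show ?thesis by (simp add: kernel_zero)
qed

definition cutoff :: "real \<times> real \<Rightarrow> complex" where
  "cutoff p = complex_of_real (plateau (fst p)) * complex_of_real (plateau (snd p))"

lemma tame_cutoff: "tame n UNIV unit_weight (\<lambda>_ :: unit. cutoff)"
  using tame_mult_unit[OF tame_plateau[of n UNIV 0 1 0] tame_plateau[of n UNIV 0 0 1]]
  by (simp add: cutoff_def[abs_def])

text \<open>The function \<open>1 - cutoff (p/R)\<close> lives on \<open>norm p \<ge> R\<close>, where \<open>1 \<le> (1 + norm p)/R\<close>; its derivatives carry a factor
\<open>1/R\<close>. One additional power of growth thus buys a constant that tends to zero.\<close>

lemma tame_one_minus_cutoff: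
  "tame n {1::real..} (\<lambda>R p. inverse R * (1 + norm p)) (\<lambda>R p. 1 - cutoff (p /\<^sub>R R))"
proof -
  let ?w = "\<lambda>R p :: real \<times> real. inverse R * (1 + norm p)"
  have t: "tame0 UNIV unit_weight (\<lambda>_ :: unit. cutoff)" using tame_cutoff[of 0] by simp
  have der: "((\<lambda>p. 1 - cutoff (p /\<^sub>R R)) has_derivative (\<lambda>v. - (pdir v cutoff (p /\<^sub>R R) * inverse (complex_of_real R)))) (at p)"
    for R p
    by (auto intro!: derivative_eq_intros has_derivative_rescaled[OF t] simp: divide_inverse)
  have bd: "norm (1 - cutoff (p /\<^sub>R R)) \<le> 1 * ?w R p" if "R \<in> {1..}" for R p
  proof (cases "R \<le> norm p")
    case True
    have "cutoff (p /\<^sub>R R) = complex_of_real (plateau (fst p / R) * plateau (snd p / R))"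
      by (simp add: cutoff_def divide_inverse mult.commute)
    then have "norm (1 - cutoff (p /\<^sub>R R)) = \<bar>1 - plateau (fst p / R) * plateau (snd p / R)\<bar>"
      by (metis norm_of_real of_real_1 of_real_diff)
    also have "\<dots> \<le> 1"
      using plateau_bounds[of "fst p / R"] plateau_bounds[of "snd p / R"]
        mult_le_one[of "plateau (fst p / R)" "plateau (snd p / R)"]
      by (auto simp: abs_le_iff)
    also have "1 \<le> ?w R p" using True that by (simp add: field_simps)
    finally show ?thesis by simp
  next
    case False
    have "\<bar>fst p\<bar> \<le> R" "\<bar>snd p\<bar> \<le> R"
      using False norm_fst_le[of "fst p" "snd p"] norm_snd_le[of "snd p" "fst p"] by auto
    then have "plateau (fst p / R) = 1" "plateau (snd p / R) = 1"
      using that by (auto intro!: plateau_eq_1 simp: abs_divide)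
    then have "1 - cutoff (p /\<^sub>R R) = 0" by (simp add: cutoff_def divide_inverse mult.commute)
    then show ?thesis using that by simp
  qed
  show ?thesis
  proof (cases n)
    case 0
    show ?thesis unfolding 0 tame.simps by (rule tame0I[OF der bd])
  next
    case (Suc m)
    show ?thesis unfolding Suc
    proof (rule tame_SucI[OF der bd])
      fix v :: "real \<times> real" assume v: "v \<in> Basis"
      have 1: "tame m {1::real..} unit_weight (\<lambda>R p. pdir v cutoff (p /\<^sub>R R))"
        using tame_cutoff[of "Suc m"] v by (intro tame_scaling) simp
      have 2: "tame m {1::real..} (\<lambda>R p. inverse R) (\<lambda>R p. - inverse (complex_of_real R))"
        by (rule tame_const[where C = 1]) (simp add: norm_inverse)
      have "tame m {1::real..} (\<lambda>R p. inverse R) (\<lambda>R p. - (pdir v cutoff (p /\<^sub>R R) * inverse (complex_of_real R)))"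
        using tame_mult_unit[OF 2 1] by (simp add: mult.commute)
      then show "tame m {1::real..} ?w (\<lambda>R p. - (pdir v cutoff (p /\<^sub>R R) * inverse (complex_of_real R)))"
        by (rule tame_weaken[where K = 1]) (auto simp: mult_le_cancel_left1)
    qed
  qed
qed

lemma Oc_cutoff: "R \<ge> 1 \<Longrightarrow> (\<lambda>p. cutoff (p /\<^sub>R R)) \<in> Oc"
proof -
  assume R: "R \<ge> 1"
  have "tame n {1::real..} (growth 0) (\<lambda>R p. cutoff (p /\<^sub>R R))" for n
    using tame_scaling[OF tame_cutoff] by simp
  from tame_imp_Oc_order[OF this, of R] R show ?thesis by (auto intro: Oc_orderI)
qed

text \<open>The cutoffs of \<open>f\<close> are covered by the compact case, and they converge to \<open>f\<close> in the topology of
\<open>Oc_order (Suc k)\<close> when \<open>f\<close> belongs to \<open>Oc_order k\<close>.\<close>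

lemma kernel_vanishes:
  assumes f: "f \<in> Oc" and U: "open U" "supp_y u \<subseteq> U" "\<And>x y. y \<in> U \<Longrightarrow> f (x, y) = 0"
  shows "u f = 0"
proof -
  obtain k where k: "f \<in> Oc_order k" using Oc_E[OF f] .
  have cut: "u (\<lambda>p. f p * cutoff (p /\<^sub>R R)) = 0" if R: "R \<ge> 1" for R
  proof (rule kernel_vanishes_compact[OF _ _ U(1,2)])
    show "(\<lambda>p. f p * cutoff (p /\<^sub>R R)) \<in> Oc" by (rule Oc_mult[OF f Oc_cutoff[OF R]])
    have "{p. f p * cutoff (p /\<^sub>R R) \<noteq> 0} \<subseteq> {- 2 * R..2 * R} \<times> {- 2 * R..2 * R}"
    proof
      fix p assume "p \<in> {p. f p * cutoff (p /\<^sub>R R) \<noteq> 0}"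
      then have "plateau (fst p / R) \<noteq> 0" "plateau (snd p / R) \<noteq> 0"
        by (auto simp: cutoff_def divide_inverse mult.commute)
      then have "\<bar>fst p / R\<bar> < 2" "\<bar>snd p / R\<bar> < 2" using plateau_eq_0 by (force, force)
      then show "p \<in> {- 2 * R..2 * R} \<times> {- 2 * R..2 * R}"
        using R by (cases p) (auto simp: abs_if field_simps split: if_splits)
    qed
    then show "bounded {p. f p * cutoff (p /\<^sub>R R) \<noteq> 0}"
      by (rule bounded_subset[rotated]) (intro bounded_Times bounded_closed_interval)
  qed (use U(3) in auto)
  have tame: "tame n {1::real..} (\<lambda>R p. inverse R * (1 + norm p) ^ Suc k) (\<lambda>R p. f p * (1 - cutoff (p /\<^sub>R R)))" for n
    using tame_mult[OF Oc_order_imp_tame[OF k, of n "{1::real..}"] tame_one_minus_cutoff[of n]]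
    by (simp add: mult_ac)
  obtain C where C: "\<And>R. R \<ge> 1 \<Longrightarrow> norm (u (\<lambda>p. f p * (1 - cutoff (p /\<^sub>R R)))) \<le> C * inverse R"
    using kernel_family_bound[OF tame] by auto
  have "norm (u f) \<le> C * inverse R" if R: "R \<ge> 1" for R
  proof -
    have "u (\<lambda>p. f p * (1 - cutoff (p /\<^sub>R R))) = u (\<lambda>p. f p - f p * cutoff (p /\<^sub>R R))"
      by (simp add: algebra_simps)
    also have "\<dots> = u f" using kernel_diff[OF f Oc_mult[OF f Oc_cutoff[OF R]]] cut[OF R] by simp
    finally show ?thesis using C[OF R] by simp
  qed
  then have "\<forall>\<^sub>F R in at_top. norm (u f) \<le> C * inverse R"
    unfolding eventually_at_top_linorder by (intro exI[of _ 1]) simp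
  moreover have "((\<lambda>R. C * inverse R) \<longlongrightarrow> C * 0) at_top"
    by (intro tendsto_intros tendsto_inverse_0_at_top filterlim_ident)
  ultimately have "norm (u f) \<le> C * 0"
    by (intro tendsto_lowerbound) auto
  then show ?thesis by simp
qed

section \<open>The bilinear form of a kernel\<close>

text \<open>The second arguments for which the bilinear form of \<open>u\<close> behaves well. The extension \<open>b\<close> may depend on
\<open>x\<close> away from the support, which makes the class visibly closed under sums and products.\<close>

definition admissible :: "(complex \<Rightarrow> complex) \<Rightarrow> bool" where
  "admissible g \<longleftrightarrow> (\<exists>b\<in>Oc. \<exists>U. open U \<and> supp_y u \<subseteq> U \<and> (\<forall>x. \<forall>y\<in>U. b (x, y) = g (complex_of_real y)))"

text \<open>Two extensions of \<open>P \<otimes> g\<close> differ by a function that vanishes near the support.\<close>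

lemma kernel_form_eq:
  assumes "\<phi> \<in> Oc" "open U" "supp_y u \<subseteq> U"
    and "\<And>x y. y \<in> U \<Longrightarrow> \<phi> (x, y) = poly P (complex_of_real x) * g (complex_of_real y)"
  shows "kernel_form u P g = u \<phi>"
proof -
  define Q where "Q \<psi> \<longleftrightarrow> \<psi> \<in> Oc \<and> (\<exists>U. open U \<and> supp_y u \<subseteq> U \<and>
       (\<forall>x. \<forall>y\<in>U. \<psi> (x, y) = poly P (complex_of_real x) * g (complex_of_real y)))" for \<psi>
  define \<psi> where "\<psi> = (SOME \<psi>. Q \<psi>)"
  have "Q \<phi>" unfolding Q_def using assms by blast
  then have "Q \<psi>" unfolding \<psi>_def by (rule someI[of Q])
  then obtain V where V: "\<psi> \<in> Oc" "open V" "supp_y u \<subseteq> V"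
    "\<And>x y. y \<in> V \<Longrightarrow> \<psi> (x, y) = poly P (complex_of_real x) * g (complex_of_real y)"
    unfolding Q_def by blast
  have "u (\<lambda>p. \<psi> p - \<phi> p) = 0"
    by (rule kernel_vanishes[of _ "U \<inter> V"]) (use assms V in \<open>auto intro: Oc_diff\<close>)
  then have "u \<psi> = u \<phi>" using kernel_diff[OF V(1) assms(1)] by simp
  then show ?thesis unfolding kernel_form_def \<psi>_def Q_def .
qed

lemma admissibleE:
  assumes "admissible g"
  obtains b U where "b \<in> Oc" "open U" "supp_y u \<subseteq> U" "\<And>x y. y \<in> U \<Longrightarrow> b (x, y) = g (complex_of_real y)"
  using assms unfolding admissible_def by metis

lemma kernel_form_admissible:
  assumes "b \<in> Oc" "open U" "supp_y u \<subseteq> U" "\<And>x y. y \<in> U \<Longrightarrow> b (x, y) = g (complex_of_real y)"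
  shows "kernel_form u P g = u (\<lambda>p. poly P (complex_of_real (fst p)) * b p)"
  by (rule kernel_form_eq[OF Oc_mult[OF Oc_poly_fst assms(1)] assms(2,3)]) (simp add: assms(4))

lemma admissible_poly: "admissible (poly p)"
  unfolding admissible_def by (rule bexI[OF _ Oc_poly_snd[of p]]) auto

lemma admissible_const: "admissible (\<lambda>y. c)"
  unfolding admissible_def using Oc_const[of c] by (intro bexI[of _ "\<lambda>p. c"]) auto

lemma admissible_cong:
  assumes "admissible g" "open U" "supp_y u \<subseteq> U" "\<And>y. y \<in> U \<Longrightarrow> g (complex_of_real y) = h (complex_of_real y)"
  shows "admissible h" "kernel_form u P g = kernel_form u P h"
proof -
  from assms(1) obtain b V where b: "b \<in> Oc" "open V" "supp_y u \<subseteq> V"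
    "\<And>x y. y \<in> V \<Longrightarrow> b (x, y) = g (complex_of_real y)" using admissibleE by blast
  have UV: "open (U \<inter> V)" "supp_y u \<subseteq> U \<inter> V" using assms b by auto
  have h: "b (x, y) = h (complex_of_real y)" if "y \<in> U \<inter> V" for x y using that b(4) assms(4) by auto
  show "admissible h" unfolding admissible_def using b(1) UV h by blast
  show "kernel_form u P g = kernel_form u P h"
    using kernel_form_admissible[OF b] kernel_form_admissible[OF b(1) UV h] by simp
qed

lemma admissible_closure:
  assumes "admissible g" "admissible h"
  shows "admissible (\<lambda>y. g y + h y)"
    and "kernel_form u P (\<lambda>y. g y + h y) = kernel_form u P g + kernel_form u P h"
    and "admissible (\<lambda>y. g y * h y)"
proof -
  obtain b U where b: "b \<in> Oc" "open U" "supp_y u \<subseteq> U"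
    "\<And>x y. y \<in> U \<Longrightarrow> b (x, y) = g (complex_of_real y)" using admissibleE[OF assms(1)] by blast
  obtain c V where c: "c \<in> Oc" "open V" "supp_y u \<subseteq> V"
    "\<And>x y. y \<in> V \<Longrightarrow> c (x, y) = h (complex_of_real y)" using admissibleE[OF assms(2)] by blast
  have UV: "open (U \<inter> V)" "supp_y u \<subseteq> U \<inter> V" using b c by auto
  have h: "b (x, y) + c (x, y) = g (complex_of_real y) + h (complex_of_real y)"
     "b (x, y) * c (x, y) = g (complex_of_real y) * h (complex_of_real y)"
    if "y \<in> U \<inter> V" for x y using that b(4) c(4) by auto
  show "admissible (\<lambda>y. g y + h y)" unfolding admissible_def
    using UV h(1) by (intro bexI[OF _ Oc_add[OF b(1) c(1)]] exI[of _ "U \<inter> V"]) auto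
  show "admissible (\<lambda>y. g y * h y)" unfolding admissible_def
    using UV h(2) by (intro bexI[OF _ Oc_mult[OF b(1) c(1)]] exI[of _ "U \<inter> V"]) auto
  have "kernel_form u P (\<lambda>y. g y + h y) = u (\<lambda>p. poly P (complex_of_real (fst p)) * (b p + c p))"
    by (rule kernel_form_admissible[OF Oc_add[OF b(1) c(1)] UV]) (use h in auto)
  also have "\<dots> = u (\<lambda>p. poly P (complex_of_real (fst p)) * b p + poly P (complex_of_real (fst p)) * c p)"
    by (simp add: distrib_left)
  also have "\<dots> = u (\<lambda>p. poly P (complex_of_real (fst p)) * b p) + u (\<lambda>p. poly P (complex_of_real (fst p)) * c p)"
    by (intro kernel_add Oc_mult Oc_poly_fst b(1) c(1))
  also have "\<dots> = kernel_form u P g + kernel_form u P h"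
    using kernel_form_admissible[OF b] kernel_form_admissible[OF c] by simp
  finally show "kernel_form u P (\<lambda>y. g y + h y) = kernel_form u P g + kernel_form u P h" .
qed

lemmas admissible_add = admissible_closure(1)
lemmas kernel_form_add_right = admissible_closure(2)
lemmas admissible_mult = admissible_closure(3)

lemma admissible_cmult: "admissible g \<Longrightarrow> admissible (\<lambda>y. c * g y)"
  by (rule admissible_mult[OF admissible_const])

lemma admissible_power: "admissible g \<Longrightarrow> admissible (\<lambda>y. g y ^ n)"
  by (induction n) (auto intro: admissible_const admissible_mult)

lemma admissible_sum:
  "finite A \<Longrightarrow> (\<And>i. i \<in> A \<Longrightarrow> admissible (g i)) \<Longrightarrow> admissible (\<lambda>y. \<Sum>i\<in>A. g i y)"
  by (induction A rule: finite_induct) (auto intro: admissible_const admissible_add)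

lemma admissible_prod:
  "finite A \<Longrightarrow> (\<And>i. i \<in> A \<Longrightarrow> admissible (g i)) \<Longrightarrow> admissible (\<lambda>y. \<Prod>i\<in>A. g i y)"
  by (induction A rule: finite_induct) (auto intro: admissible_const admissible_mult)

lemma kernel_form_cmult_right:
  assumes "admissible g"
  shows "kernel_form u P (\<lambda>y. c * g y) = c * kernel_form u P g"
proof -
  obtain b U where b: "b \<in> Oc" "open U" "supp_y u \<subseteq> U"
    "\<And>x y. y \<in> U \<Longrightarrow> b (x, y) = g (complex_of_real y)" using admissibleE[OF assms] by blast
  have "kernel_form u P (\<lambda>y. c * g y) = u (\<lambda>p. c * (poly P (complex_of_real (fst p)) * b p))"
    by (rule kernel_form_eq[OF Oc_cmult[OF Oc_mult[OF Oc_poly_fst b(1)]] b(2,3)]) (simp add: b(4))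
  also have "\<dots> = c * u (\<lambda>p. poly P (complex_of_real (fst p)) * b p)"
    by (intro kernel_cmult Oc_mult Oc_poly_fst b(1))
  finally show ?thesis using kernel_form_admissible[OF b] by simp
qed

lemma kernel_form_diff_right:
  assumes "admissible g" "admissible h"
  shows "kernel_form u P (\<lambda>y. g y - h y) = kernel_form u P g - kernel_form u P h"
  using kernel_form_add_right[OF assms(1) admissible_cmult[OF assms(2), of "- 1"]]
    kernel_form_cmult_right[OF assms(2), of P "- 1"] by simp

lemma kernel_form_zero_right: "kernel_form u P (\<lambda>y. 0) = 0"
  using kernel_form_cmult_right[OF admissible_const, of P 0] by simp

lemma kernel_form_sum_right:
  "finite A \<Longrightarrow> (\<And>i. i \<in> A \<Longrightarrow> admissible (g i)) \<Longrightarrow>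
    kernel_form u P (\<lambda>y. \<Sum>i\<in>A. g i y) = (\<Sum>i\<in>A. kernel_form u P (g i))"
  by (induction A rule: finite_induct)
    (auto simp: kernel_form_zero_right kernel_form_add_right admissible_sum)

lemma kernel_form_add_left:
  assumes "admissible g"
  shows "kernel_form u (P + Q) g = kernel_form u P g + kernel_form u Q g"
proof -
  obtain b U where b: "b \<in> Oc" "open U" "supp_y u \<subseteq> U"
    "\<And>x y. y \<in> U \<Longrightarrow> b (x, y) = g (complex_of_real y)" using admissibleE[OF assms] by blast
  have "u (\<lambda>p. poly (P + Q) (complex_of_real (fst p)) * b p) =
      u (\<lambda>p. poly P (complex_of_real (fst p)) * b p + poly Q (complex_of_real (fst p)) * b p)"
    by (simp add: distrib_right)
  also have "\<dots> = u (\<lambda>p. poly P (complex_of_real (fst p)) * b p) + u (\<lambda>p. poly Q (complex_of_real (fst p)) * b p)"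
    by (intro kernel_add Oc_mult Oc_poly_fst b(1))
  finally show ?thesis by (simp only: kernel_form_admissible[where g = g, OF b])
qed

lemma kernel_form_smult_left:
  assumes "admissible g"
  shows "kernel_form u (Polynomial.smult c P) g = c * kernel_form u P g"
proof -
  obtain b U where b: "b \<in> Oc" "open U" "supp_y u \<subseteq> U"
    "\<And>x y. y \<in> U \<Longrightarrow> b (x, y) = g (complex_of_real y)" using admissibleE[OF assms] by blast
  have "u (\<lambda>p. poly (Polynomial.smult c P) (complex_of_real (fst p)) * b p) =
      u (\<lambda>p. c * (poly P (complex_of_real (fst p)) * b p))" by (simp add: mult.assoc)
  also have "\<dots> = c * u (\<lambda>p. poly P (complex_of_real (fst p)) * b p)"
    by (intro kernel_cmult Oc_mult Oc_poly_fst b(1))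
  finally show ?thesis by (simp only: kernel_form_admissible[where g = g, OF b])
qed

section \<open>Cauchy transforms\<close>

text \<open>For nonreal \<open>z\<^sub>0\<close> there is nothing to extend. For real \<open>z\<^sub>0\<close> the pole is moved off the real line by adding
\<open>\<i>\<beta>\<close> to the denominator, with \<open>\<beta>\<close> a bump around \<open>z\<^sub>0\<close> whose support avoids \<open>supp_y u\<close>; this stays
bounded away from zero for all \<open>z\<close> near \<open>z\<^sub>0\<close>.\<close>

lemma recip_family:
  assumes z0: "z0 \<notin> complex_of_real ` supp_y u"
  obtains d U F where "0 < d" "open U" "supp_y u \<subseteq> U" "\<And>n. tame n (ball z0 d) unit_weight F"
    "\<And>z x y. z \<in> ball z0 d \<Longrightarrow> y \<in> U \<Longrightarrow> F z (x, y) = 1 / (z - complex_of_real y) \<and> z \<noteq> complex_of_real y"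
proof (cases "Im z0 = 0")
  case False
  define d where "d = \<bar>Im z0\<bar> / 2"
  have d: "d > 0" using False by (simp add: d_def)
  have low: "d \<le> norm (z - complex_of_real y)" if "z \<in> ball z0 d" for z y
  proof -
    have "\<bar>Im z0 - Im z\<bar> < d" using that abs_Im_le_cmod[of "z0 - z"] by (simp add: dist_norm)
    then have "d \<le> \<bar>Im z\<bar>" unfolding d_def by arith
    then show ?thesis using abs_Im_le_cmod[of "z - complex_of_real y"] by simp
  qed
  have "tame n (ball z0 d) unit_weight (\<lambda>z p. inverse (z - complex_of_real (snd p)))" for n
  proof (rule tame_inverse[where G' = "\<lambda>z p v. - complex_of_real (snd v)", OF _ _ d])
    show "((\<lambda>p. z - complex_of_real (snd p)) has_derivative (\<lambda>v. - complex_of_real (snd v))) (at p)" for z p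
      by (auto intro!: derivative_eq_intros)
    show "tame n (ball z0 d) unit_weight (\<lambda>i p. - complex_of_real (snd v))" for n v
      by (rule tame_const[where C = "\<bar>snd v\<bar>"]) simp
  qed (rule low)
  moreover have "z \<noteq> complex_of_real y" if "z \<in> ball z0 d" for z y using low[OF that, of y] d by auto
  ultimately show ?thesis by (intro that[OF d open_UNIV]) (auto simp: divide_inverse)
next
  case True
  define a where "a = Re z0"
  have z0a: "z0 = complex_of_real a" using True by (simp add: a_def complex_eq_iff)
  then have "a \<in> - supp_y u" using z0 by auto
  moreover have "open (- supp_y u)" using closed_supp_y by (rule open_Compl)
  ultimately obtain e where e: "e > 0" "cball a e \<subseteq> - supp_y u" using open_contains_cball by blast
  define r where "r = e / 2"
  have r: "r > 0" using e by (simp add: r_def)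
  define \<beta> where "\<beta> p = \<i> * complex_of_real (plateau ((snd p - a) / r))" for p :: "real \<times> real"
  have \<beta>: "tame n I unit_weight (\<lambda>_. \<beta>)" for n and I :: "complex set"
  proof -
    have "(\<lambda>p :: real \<times> real. plateau ((snd p - a) / r)) = (\<lambda>p. plateau (- a / r + (0 * fst p + (1 / r) * snd p)))"
      by (simp add: diff_divide_distrib)
    then have "\<beta> = (\<lambda>p. \<i> * complex_of_real (plateau (- a / r + (0 * fst p + (1 / r) * snd p))))"
      unfolding \<beta>_def by metis
    then show ?thesis using tame_cmult[OF tame_plateau[of n I "- a / r" 0 "1 / r"], of \<i>] by simp
  qed
  define d where "d = min (1 / 2) (r / 2)"
  have d: "d > 0" using r by (simp add: d_def)
  define G where "G z p = z - complex_of_real (snd p) + \<beta> p" for z :: complex and p :: "real \<times> real"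
  have low: "d \<le> norm (G z p)" if z: "z \<in> ball z0 d" for z p
  proof -
    have "\<bar>Im z\<bar> < d" "\<bar>a - Re z\<bar> < d"
      using z abs_Im_le_cmod[of "z0 - z"] abs_Re_le_cmod[of "z0 - z"] by (auto simp: dist_norm z0a)
    \<comment> \<open>Where the bump equals 1 the imaginary part of \<open>G z p\<close> is large, elsewhere the real part is.\<close>
    then have zd: "\<bar>Im z\<bar> < 1 / 2" "\<bar>a - Re z\<bar> < r / 2" by (auto simp: d_def)
    show ?thesis
    proof (cases "\<bar>snd p - a\<bar> \<le> r")
      case True
      then have "Im (G z p) = Im z + 1" using r by (simp add: G_def \<beta>_def plateau_eq_1 abs_divide)
      then have "d \<le> \<bar>Im (G z p)\<bar>" using zd unfolding d_def by arith
      then show ?thesis using abs_Im_le_cmod order_trans by blast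
    next
      case False
      then have "r / 2 \<le> \<bar>Re z - snd p\<bar>" using zd by linarith
      moreover have "d \<le> r / 2" by (simp add: d_def)
      ultimately have "d \<le> \<bar>Re (G z p)\<bar>" by (simp add: G_def \<beta>_def)
      then show ?thesis using abs_Re_le_cmod order_trans by blast
    qed
  qed
  define U where "U = {y. \<bar>y - a\<bar> > 2 * r}"
  have U: "open U" unfolding U_def by (intro open_Collect_less continuous_intros)
  have sU: "supp_y u \<subseteq> U"
  proof
    fix y assume "y \<in> supp_y u"
    then have "y \<notin> cball a e" using e by blast
    then show "y \<in> U" by (simp add: U_def r_def dist_real_def abs_minus_commute)
  qed
  have "tame n (ball z0 d) unit_weight (\<lambda>z p. inverse (G z p))" for n
  proof (rule tame_inverse[where G' = "\<lambda>z p v. - complex_of_real (snd v) + frechet_derivative \<beta> (at p) v", OF _ _ d])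
    have D: "(\<beta> has_derivative frechet_derivative \<beta> (at p)) (at p)" for p
      using tame0_has_derivative[OF tame_imp_tame0[OF \<beta>[of 0 UNIV]], of 0] by simp
    show "(G z has_derivative (\<lambda>v. - complex_of_real (snd v) + frechet_derivative \<beta> (at p) v)) (at p)" for z p
      unfolding G_def[abs_def] by (auto intro!: derivative_eq_intros D)
    show "tame n (ball z0 d) unit_weight (\<lambda>i p. - complex_of_real (snd v) + frechet_derivative \<beta> (at p) v)"
      if "v \<in> Basis" for n v
    proof (rule tame_add)
      show "tame n (ball z0 d) unit_weight (\<lambda>i p. - complex_of_real (snd v))"
        by (rule tame_const[where C = "\<bar>snd v\<bar>"]) simp
      show "tame n (ball z0 d) unit_weight (\<lambda>i p. frechet_derivative \<beta> (at p) v)"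
        using \<beta>[of "Suc n"] that by (simp add: pdir_def)
    qed
  qed (rule low)
  moreover have "\<beta> (x, y) = 0" if "y \<in> U" for x y
    using that r plateau_eq_0[of "(y - a) / r"] by (auto simp: \<beta>_def U_def abs_divide field_simps)
  moreover have "z \<noteq> complex_of_real y" if "z \<in> ball z0 d" "y \<in> U" for z y
  proof
    assume "z = complex_of_real y"
    then have "G z (0, y) = \<beta> (0, y)" by (simp add: G_def)
    then show False using low[OF that(1), of "(0, y)"] d calculation(2)[OF that(2)] by simp
  qed
  ultimately show ?thesis by (intro that[OF d U sU]) (auto simp: divide_inverse G_def)
qed

lemma admissible_recip:
  assumes "z \<notin> complex_of_real ` supp_y u"
  shows "admissible (\<lambda>y. 1 / (z - y))"
proof -
  obtain d U F where dUF: "0 < d" "open U" "supp_y u \<subseteq> U" "\<And>n. tame n (ball z d) unit_weight F"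
    "\<And>w x y. w \<in> ball z d \<Longrightarrow> y \<in> U \<Longrightarrow> F w (x, y) = 1 / (w - complex_of_real y) \<and> w \<noteq> complex_of_real y"
    using recip_family[OF assms] by blast
  have "F z \<in> Oc_order 0"
    by (rule tame_imp_Oc_order[of "ball z d"]) (use dUF in auto)
  then show ?thesis unfolding admissible_def using dUF(1-3,5) by (auto intro!: bexI[of _ "F z"] Oc_orderI)
qed

lemma cauchy_family_bound:
  assumes z0: "z0 \<notin> complex_of_real ` supp_y u"
  obtains d where "0 < d" "ball z0 d \<inter> complex_of_real ` supp_y u = {}"
    "\<And>i k. \<exists>C. \<forall>z\<in>ball z0 d. norm (kernel_form u P (\<lambda>y. (1 / (z - y)) ^ i * (1 / (z0 - y)) ^ k)) \<le> C"
proof -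
  obtain d U F where d: "0 < d" and U: "open U" "supp_y u \<subseteq> U"
    and F: "\<And>n. tame n (ball z0 d) unit_weight F"
    and Feq: "\<And>w x y. w \<in> ball z0 d \<Longrightarrow> y \<in> U \<Longrightarrow> F w (x, y) = 1 / (w - complex_of_real y) \<and> w \<noteq> complex_of_real y"
    using recip_family[OF z0] by blast
  have z0d: "z0 \<in> ball z0 d" using d by simp
  obtain l where l: "(\<lambda>p. poly P (complex_of_real (fst p))) \<in> Oc_order l" using Oc_E[OF Oc_poly_fst] by blast
  have "\<exists>C. \<forall>z\<in>ball z0 d. norm (kernel_form u P (\<lambda>y. (1 / (z - y)) ^ i * (1 / (z0 - y)) ^ k)) \<le> C" for i k
  proof -
    have F0: "tame n (ball z0 d) unit_weight (\<lambda>_. F z0)" for n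
      by (rule tame_reindex[OF F]) (use z0d in blast)
    have T1: "tame n (ball z0 d) unit_weight (\<lambda>z p. F z p ^ i * F z0 p ^ k)" for n
      by (rule tame_mult_unit[OF tame_power[OF F] tame_power[OF F0]])
    have T2: "tame n (ball z0 d) (\<lambda>z p. 1 * (1 + norm p) ^ l)
        (\<lambda>z p. poly P (complex_of_real (fst p)) * (F z p ^ i * F z0 p ^ k))" for n
      using tame_mult_unit[OF Oc_order_imp_tame[OF l, of n "ball z0 d"] T1] by simp
    have "\<exists>C. \<forall>z\<in>ball z0 d.
        norm (u (\<lambda>p. poly P (complex_of_real (fst p)) * (F z p ^ i * F z0 p ^ k))) \<le> C * 1"
      by (rule kernel_family_bound[OF T2]) simp
    then obtain C where C: "\<And>z. z \<in> ball z0 d \<Longrightarrow>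
        norm (u (\<lambda>p. poly P (complex_of_real (fst p)) * (F z p ^ i * F z0 p ^ k))) \<le> C * 1"
      by blast
    have "kernel_form u P (\<lambda>y. (1 / (z - y)) ^ i * (1 / (z0 - y)) ^ k) =
        u (\<lambda>p. poly P (complex_of_real (fst p)) * (F z p ^ i * F z0 p ^ k))" if z: "z \<in> ball z0 d" for z
    proof (rule kernel_form_admissible[OF _ U])
      show "(\<lambda>p. F z p ^ i * F z0 p ^ k) \<in> Oc"
        using tame_imp_Oc_order[where k = 0, OF _ z, of "\<lambda>z p. F z p ^ i * F z0 p ^ k"] T1
        by (auto intro: Oc_orderI)
    qed (simp add: Feq[OF z] Feq[OF z0d])
    then show ?thesis using C by (intro exI[of _ C]) simp
  qed
  moreover have "ball z0 d \<inter> complex_of_real ` supp_y u = {}"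
    using Feq U(2) by blast
  ultimately show ?thesis using that d by blast
qed

text \<open>With \<open>s = 1/(z - y)\<close> and \<open>t = 1/(z\<^sub>0 - y)\<close> the resolvent identity \<open>s - t = - (z - z\<^sub>0) s t\<close> turns the difference
quotient of \<open>s\<^sup>n\<close> into a finite sum of products \<open>s\<^sup>i t\<^sup>k\<close>. Their brackets are bounded near \<open>z\<^sub>0\<close>, hence, by
the same identity, continuous at \<open>z\<^sub>0\<close>.\<close>

lemma kernel_form_cauchy_deriv:
  assumes z0: "z0 \<notin> complex_of_real ` supp_y u"
  shows "((\<lambda>z. kernel_form u P (\<lambda>y. (1 / (z - y)) ^ Suc j)) has_field_derivative
    - of_nat (Suc j) * kernel_form u P (\<lambda>y. (1 / (z0 - y)) ^ Suc (Suc j))) (at z0)"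
proof -
  define Q where "Q n k z = kernel_form u P (\<lambda>y. (1 / (z - y)) ^ n * (1 / (z0 - y)) ^ k)" for n k z
  obtain d where d: "0 < d" "ball z0 d \<inter> complex_of_real ` supp_y u = {}"
    and bd: "\<And>i k. \<exists>C. \<forall>z\<in>ball z0 d. norm (Q i k z) \<le> C"
    using cauchy_family_bound[OF z0, of P] unfolding Q_def by metis
  have adm: "admissible (\<lambda>y. (1 / (z - y)) ^ n * (1 / (z0 - y)) ^ k)"
    if "z \<notin> complex_of_real ` supp_y u" for z n k
    by (intro admissible_mult admissible_power admissible_recip that z0)
  \<comment> \<open>The resolvent identity, summed along the factorization of \<open>s ^ n - t ^ n\<close>.\<close>
  have diff: "Q n k z - Q n k z0 = - (z - z0) * (\<Sum>i<n. Q (Suc i) (n - i + k) z)"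
    if z: "z \<in> ball z0 d" for n k z
  proof -
    have zs: "z \<notin> complex_of_real ` supp_y u" using z d(2) by blast
    have "Q n k z - Q n k z0 =
        kernel_form u P (\<lambda>y. (1 / (z - y)) ^ n * (1 / (z0 - y)) ^ k - (1 / (z0 - y)) ^ n * (1 / (z0 - y)) ^ k)"
      unfolding Q_def by (rule kernel_form_diff_right[symmetric, OF adm[OF zs] adm[OF z0]])
    also have "\<dots> = kernel_form u P
        (\<lambda>y. - (z - z0) * (\<Sum>i<n. (1 / (z - y)) ^ Suc i * (1 / (z0 - y)) ^ (n - i + k)))"
    proof (rule admissible_cong(2)[symmetric])
      let ?U = "{y. complex_of_real y \<noteq> z} \<inter> {y. complex_of_real y \<noteq> z0}"
      show "open ?U" by (intro open_Int open_Collect_neq continuous_intros)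
      show "supp_y u \<subseteq> ?U" using z0 zs by auto
      show "admissible (\<lambda>y. - (z - z0) * (\<Sum>i<n. (1 / (z - y)) ^ Suc i * (1 / (z0 - y)) ^ (n - i + k)))"
        by (intro admissible_cmult admissible_sum adm zs) simp
      fix y assume "y \<in> ?U"
      then have nz: "z - complex_of_real y \<noteq> 0" "z0 - complex_of_real y \<noteq> 0" by auto
      define s t where "s = 1 / (z - complex_of_real y)" and "t = 1 / (z0 - complex_of_real y)"
      have st: "s - t = - (z - z0) * (s * t)" using nz unfolding s_def t_def by (simp add: field_simps)
      have "s ^ n * t ^ k - t ^ n * t ^ k = (s ^ n - t ^ n) * t ^ k" by (simp add: algebra_simps)
      also have "s ^ n - t ^ n = (s - t) * (\<Sum>i<n. t ^ (n - Suc i) * s ^ i)" by (rule power_diff_sumr2)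
      also have "\<dots> * t ^ k = - (z - z0) * (\<Sum>i<n. s * t * (t ^ (n - Suc i) * s ^ i) * t ^ k)"
        unfolding st by (simp only: sum_distrib_left sum_distrib_right mult.assoc)
      also have "(\<Sum>i<n. s * t * (t ^ (n - Suc i) * s ^ i) * t ^ k) = (\<Sum>i<n. s ^ Suc i * t ^ (n - i + k))"
      proof (rule sum.cong[OF refl])
        fix i assume "i \<in> {..<n}"
        then have e: "n - i + k = Suc (n - Suc i + k)" by auto
        then show "s * t * (t ^ (n - Suc i) * s ^ i) * t ^ k = s ^ Suc i * t ^ (n - i + k)"
          unfolding e power_Suc power_add by (simp only: mult_ac)
      qed
      finally show "- (z - z0) * (\<Sum>i<n. (1 / (z - complex_of_real y)) ^ Suc i * (1 / (z0 - complex_of_real y)) ^ (n - i + k)) =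
         (1 / (z - complex_of_real y)) ^ n * (1 / (z0 - complex_of_real y)) ^ k -
         (1 / (z0 - complex_of_real y)) ^ n * (1 / (z0 - complex_of_real y)) ^ k"
        unfolding s_def t_def by simp
    qed
    also have "\<dots> = - (z - z0) * kernel_form u P (\<lambda>y. \<Sum>i<n. (1 / (z - y)) ^ Suc i * (1 / (z0 - y)) ^ (n - i + k))"
      by (intro kernel_form_cmult_right admissible_sum adm zs) simp
    also have "kernel_form u P (\<lambda>y. \<Sum>i<n. (1 / (z - y)) ^ Suc i * (1 / (z0 - y)) ^ (n - i + k)) =
        (\<Sum>i<n. Q (Suc i) (n - i + k) z)"
      unfolding Q_def by (intro kernel_form_sum_right adm zs) simp
    finally show ?thesis .
  qed
  have near: "\<forall>\<^sub>F z in at z0. z \<in> ball z0 d \<and> z \<noteq> z0"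
    using d(1) by (auto simp: eventually_at dist_commute)
  obtain C where C: "\<And>i k z. z \<in> ball z0 d \<Longrightarrow> norm (Q i k z) \<le> C i k" using bd by metis
  have lim: "(Q n k \<longlongrightarrow> Q n k z0) (at z0)" for n k
  proof (rule LIM_zero_cancel, rule Lim_null_comparison)
    show "\<forall>\<^sub>F z in at z0. norm (Q n k z - Q n k z0) \<le> norm (z - z0) * (\<Sum>i<n. C (Suc i) (n - i + k))"
      using near
    proof eventually_elim
      case (elim z)
      have "norm (\<Sum>i<n. Q (Suc i) (n - i + k) z) \<le> (\<Sum>i<n. C (Suc i) (n - i + k))"
        using C elim by (intro sum_norm_le) blast
      then show ?case using diff[of z n k] elim by (simp add: norm_mult norm_minus_commute mult_left_mono)
    qed
    have "((\<lambda>z. norm (z - z0) * (\<Sum>i<n. C (Suc i) (n - i + k))) \<longlongrightarrow> norm (z0 - z0) * (\<Sum>i<n. C (Suc i) (n - i + k))) (at z0)"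
      by (intro tendsto_intros)
    then show "((\<lambda>z. norm (z - z0) * (\<Sum>i<n. C (Suc i) (n - i + k))) \<longlongrightarrow> 0) (at z0)" by simp
  qed
  have "((\<lambda>z. - (\<Sum>i<Suc j. Q (Suc i) (Suc j - i + 0) z)) \<longlongrightarrow> - (\<Sum>i<Suc j. Q (Suc i) (Suc j - i + 0) z0)) (at z0)"
    by (intro tendsto_intros lim)
  moreover have "\<forall>\<^sub>F z in at z0. (Q (Suc j) 0 z - Q (Suc j) 0 z0) / (z - z0) = - (\<Sum>i<Suc j. Q (Suc i) (Suc j - i + 0) z)"
    using near
  proof eventually_elim
    case (elim z)
    then have "z - z0 \<noteq> 0" "z \<in> ball z0 d" by auto
    have cancel: "- c * S / c = - S" if "c \<noteq> 0" for c S :: complex using that by simp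
    show ?case unfolding diff[OF \<open>z \<in> ball z0 d\<close>] by (rule cancel[OF \<open>z - z0 \<noteq> 0\<close>])
  qed
  ultimately have quot: "((\<lambda>z. (Q (Suc j) 0 z - Q (Suc j) 0 z0) / (z - z0)) \<longlongrightarrow>
      - (\<Sum>i<Suc j. Q (Suc i) (Suc j - i + 0) z0)) (at z0)"
    by (subst tendsto_cong)
  have Qz0: "Q (Suc i) (Suc j - i + 0) z0 = kernel_form u P (\<lambda>y. (1 / (z0 - y)) ^ Suc (Suc j))" if "i < Suc j" for i
  proof -
    have "Suc i + (Suc j - i + 0) = Suc (Suc j)" using that by simp
    then show ?thesis unfolding Q_def power_add[symmetric] by presburger
  qed
  have "(\<Sum>i<Suc j. Q (Suc i) (Suc j - i + 0) z0) =
      (\<Sum>i<Suc j. kernel_form u P (\<lambda>y. (1 / (z0 - y)) ^ Suc (Suc j)))"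
    by (rule sum.cong[OF refl], rule Qz0) simp
  then have "(\<Sum>i<Suc j. Q (Suc i) (Suc j - i + 0) z0) =
      of_nat (Suc j) * kernel_form u P (\<lambda>y. (1 / (z0 - y)) ^ Suc (Suc j))"
    by (simp only: sum_constant card_lessThan)
  moreover have "Q (Suc j) 0 z = kernel_form u P (\<lambda>y. (1 / (z - y)) ^ Suc j)" for z
    by (simp only: Q_def power_0 mult_1_right)
  ultimately show ?thesis using quot unfolding has_field_derivative_iff by (simp only: mult_minus_left)
qed

lemma higher_deriv_cauchy:
  assumes f: "\<And>z. z \<notin> complex_of_real ` supp_y u \<Longrightarrow> f z = kernel_form u P (\<lambda>y. 1 / (z - y))"
  shows "z \<notin> complex_of_real ` supp_y u \<Longrightarrow>
    (deriv ^^ l) f z = (- 1) ^ l * fact l * kernel_form u P (\<lambda>y. (1 / (z - y)) ^ Suc l)"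
proof (induction l arbitrary: z)
  case 0
  then show ?case using f by simp
next
  case (Suc l)
  let ?S = "complex_of_real ` supp_y u"
  have "?S = {z. Im z = 0} \<inter> Re -` supp_y u" by (auto simp: image_iff complex_eq_iff)
  moreover have "closed ({z. Im z = 0} \<inter> Re -` supp_y u)"
    by (intro closed_Int closed_Collect_eq closed_vimage closed_supp_y continuous_intros)
  ultimately have op: "open (- ?S)" using open_Compl by metis
  have ev: "\<forall>\<^sub>F w in nhds z. (deriv ^^ l) f w = (- 1) ^ l * fact l * kernel_form u P (\<lambda>y. (1 / (w - y)) ^ Suc l)"
  proof (rule eventually_mono[OF eventually_nhds_in_open[OF op]])
    show "z \<in> - ?S" using Suc.prems by simp
  qed (rule Suc.IH, simp)
  have "(deriv ^^ Suc l) f z = deriv (\<lambda>w. (- 1) ^ l * fact l * kernel_form u P (\<lambda>y. (1 / (w - y)) ^ Suc l)) z"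
    using deriv_cong_ev[OF ev refl] by simp
  also have "\<dots> = (- 1) ^ l * fact l * (- of_nat (Suc l) * kernel_form u P (\<lambda>y. (1 / (z - y)) ^ Suc (Suc l)))"
    by (intro DERIV_imp_deriv DERIV_cmult kernel_form_cauchy_deriv Suc.prems)
  finally show ?case by (simp only: fact_Suc power_Suc of_nat_mult mult_ac mult_minus_left mult_minus_right mult_1_left)
qed

end

section \<open>Gauss--Borel factorization\<close>

lemma sum_mult_indicator:
  fixes f c :: "'a \<Rightarrow> complex"
  assumes "finite A"
  shows "(\<Sum>k\<in>A. f k * (if k = i then c k else 0)) = (if i \<in> A then f i * c i else 0)"
    and "(\<Sum>k\<in>A. f k * (if i = k then c k else 0)) = (if i \<in> A then f i * c i else 0)"
    and "(\<Sum>k\<in>A. (if k = i then c k else 0) * f k) = (if i \<in> A then c i * f i else 0)"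
    and "(\<Sum>k\<in>A. (if i = k then c k else 0) * f k) = (if i \<in> A then c i * f i else 0)"
proof -
  have "(\<Sum>k\<in>A. f k * (if k = i then c k else 0)) = (\<Sum>k\<in>A. if k = i then f k * c k else 0)"
    by (intro sum.cong) auto
  then show *: "(\<Sum>k\<in>A. f k * (if k = i then c k else 0)) = (if i \<in> A then f i * c i else 0)"
    using assms by simp
  then show "(\<Sum>k\<in>A. f k * (if i = k then c k else 0)) = (if i \<in> A then f i * c i else 0)"
    by (simp add: eq_commute[of i])
  from * show "(\<Sum>k\<in>A. (if k = i then c k else 0) * f k) = (if i \<in> A then c i * f i else 0)"
    by (simp add: mult.commute)
  then show "(\<Sum>k\<in>A. (if i = k then c k else 0) * f k) = (if i \<in> A then c i * f i else 0)"
    by (simp add: eq_commute[of i])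
qed

text \<open>A nonvanishing leading principal minor, in a form that is symmetric under transposition and that
solves linear systems indexed by natural numbers directly.\<close>

definition invertible_upto :: "nat \<Rightarrow> (nat \<Rightarrow> nat \<Rightarrow> complex) \<Rightarrow> bool" where
  "invertible_upto n G \<longleftrightarrow> (\<exists>M. \<forall>i<n. \<forall>j<n.
     (\<Sum>k<n. G i k * M k j) = (if i = j then 1 else 0) \<and>
     (\<Sum>k<n. M i k * G k j) = (if i = j then 1 else 0))"

lemma det_nonzero_imp_invertible_upto:
  fixes G :: "nat \<Rightarrow> nat \<Rightarrow> complex"
  assumes "Determinant.det (Matrix.mat n n (\<lambda>(k, l). G k l)) \<noteq> 0"
  shows "invertible_upto n G"
proof -
  let ?A = "Matrix.mat n n (\<lambda>(k, l). G k l)"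
  have A: "?A \<in> carrier_mat n n" by simp
  obtain M where "mat_inverse ?A = Some M"
    using mat_inverse(1)[OF A, of "()"] det_non_zero_imp_unit[OF A assms, of "()"] by (cases "mat_inverse ?A") auto
  then have M: "?A * M = 1\<^sub>m n" "M * ?A = 1\<^sub>m n" "M \<in> carrier_mat n n"
    using mat_inverse(2)[OF A] by auto
  have "(\<Sum>k<n. G i k * M $$ (k, j)) = (if i = j then 1 else 0)"
    "(\<Sum>k<n. M $$ (i, k) * G k j) = (if i = j then 1 else 0)" if "i < n" "j < n" for i j
    using arg_cong[OF M(1), of "\<lambda>X. X $$ (i, j)"] arg_cong[OF M(2), of "\<lambda>X. X $$ (i, j)"] that M(3)
    by (auto simp: scalar_prod_def lessThan_atLeast0)
  then show ?thesis unfolding invertible_upto_def by (intro exI[of _ "\<lambda>k j. M $$ (k, j)"]) auto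
qed

lemma invertible_upto_transpose: "invertible_upto n G \<Longrightarrow> invertible_upto n (\<lambda>i j. G j i)"
  unfolding invertible_upto_def
proof (elim exE)
  fix M assume *: "\<forall>i<n. \<forall>j<n. (\<Sum>k<n. G i k * M k j) = (if i = j then 1 else 0) \<and>
     (\<Sum>k<n. M i k * G k j) = (if i = j then 1 else 0)"
  show "\<exists>M. \<forall>i<n. \<forall>j<n. (\<Sum>k<n. G k i * M k j) = (if i = j then 1 else 0) \<and>
     (\<Sum>k<n. M i k * G j k) = (if i = j then 1 else 0)"
    by (rule exI[of _ "\<lambda>i j. M j i"]) (use * in \<open>auto simp: mult.commute\<close>)
qed

lemma invertible_upto_left_kernel:
  assumes "invertible_upto n G" "\<And>j. j < n \<Longrightarrow> (\<Sum>i<n. d i * G i j) = 0" "i < n"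
  shows "d i = 0"
proof -
  obtain M where M: "\<And>i j. i < n \<Longrightarrow> j < n \<Longrightarrow> (\<Sum>k<n. G i k * M k j) = (if i = j then 1 else 0)"
    using assms(1) unfolding invertible_upto_def by blast
  have "(\<Sum>j<n. (\<Sum>k<n. d k * G k j) * M j i) = (\<Sum>k<n. d k * (\<Sum>j<n. G k j * M j i))"
    unfolding sum_distrib_left sum_distrib_right mult.assoc by (rule sum.swap)
  also have "\<dots> = (\<Sum>k<n. d k * (if k = i then 1 else 0))" using assms(3) by (intro sum.cong) (auto simp: M)
  also have "\<dots> = d i" using assms(3) by (simp add: sum_mult_indicator)
  finally show ?thesis using assms(2) by simp
qed

lemma lower_unitriangularD:
  assumes "lower_unitriangular S"
  shows "S k k = 1" "k < l \<Longrightarrow> S k l = 0"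
  using assms unfolding lower_unitriangular_def by auto

lemma lower_sum_extend:
  assumes "lower_unitriangular S" "k \<le> n"
  shows "(\<Sum>j\<le>k. S k j * x j) = (\<Sum>j\<le>n. S k j * x j)"
  using assms by (intro sum.mono_neutral_left) (auto simp: lower_unitriangularD)

function lower_inv :: "(nat \<Rightarrow> nat \<Rightarrow> complex) \<Rightarrow> nat \<Rightarrow> nat \<Rightarrow> complex" where
  "lower_inv S k l = (if k = l then 1 else if k < l then 0 else - (\<Sum>j<k. S k j * lower_inv S j l))"
  by pat_completeness auto
termination by (relation "Wellfounded.measure (\<lambda>(S, k, l). k)") auto

declare lower_inv.simps [simp del]

lemma lower_inv_unitriangular: "lower_unitriangular (lower_inv S)"
  unfolding lower_unitriangular_def by (auto simp: lower_inv.simps)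

lemma lower_inv_right:
  assumes S: "lower_unitriangular S"
  shows "(\<Sum>j\<le>k. S k j * lower_inv S j l) = (if k = l then 1 else 0)"
proof -
  have "(\<Sum>j\<le>k. S k j * lower_inv S j l) = (\<Sum>j<k. S k j * lower_inv S j l) + lower_inv S k l"
    using lower_unitriangularD(1)[OF S] by (simp add: lessThan_Suc_atMost[symmetric])
  moreover have "(\<Sum>j<k. S k j * lower_inv S j l) = 0" if "k \<le> l"
    using that by (intro sum.neutral) (auto simp: lower_unitriangularD(2)[OF lower_inv_unitriangular])
  ultimately show ?thesis
    using lower_unitriangularD[OF lower_inv_unitriangular[of S]]
    by (cases k l rule: linorder_cases) (auto simp: lower_inv.simps[of S k l])
qed

text \<open>The recursion gives a right inverse \<open>L\<close> of \<open>S\<close>; since \<open>L\<close> has a right inverse \<open>M\<close> too, \<open>S = S (L M) = M\<close>, and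
\<open>L\<close> is a two-sided inverse.\<close>

lemma lower_inverse_exists:
  assumes S: "lower_unitriangular S"
  shows "lower_inverse S (lower_inv S)"
proof -
  let ?L = "lower_inv S" and ?M = "lower_inv (lower_inv S)"
  note L = lower_inv_unitriangular[of S] and M = lower_inv_unitriangular[of ?L]
  have "S k l = ?M k l" for k l
  proof -
    have "S k l = (\<Sum>j\<le>k. S k j * (if j = l then 1 else 0))"
      using lower_unitriangularD(2)[OF S, of k l] by (simp add: sum_mult_indicator)
    also have "\<dots> = (\<Sum>j\<le>k. S k j * (\<Sum>i\<le>j. ?L j i * ?M i l))"
      by (simp only: lower_inv_right[OF L])
    also have "\<dots> = (\<Sum>j\<le>k. S k j * (\<Sum>i\<le>k. ?L j i * ?M i l))"
      by (intro sum.cong refl arg_cong2[where f = "(*)"] lower_sum_extend[OF L]) auto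
    also have "\<dots> = (\<Sum>i\<le>k. (\<Sum>j\<le>k. S k j * ?L j i) * ?M i l)"
      unfolding sum_distrib_left sum_distrib_right mult.assoc by (rule sum.swap)
    also have "\<dots> = (\<Sum>i\<le>k. (if k = i then 1 else 0) * ?M i l)"
      by (simp only: lower_inv_right[OF S])
    also have "\<dots> = ?M k l" by (simp add: sum_mult_indicator)
    finally show ?thesis .
  qed
  then have "S = ?M" by blast
  then show ?thesis unfolding lower_inverse_def
    using lower_inv_right[OF S] lower_inv_right[OF L] L by metis
qed

lemma lower_inverse_sym: "lower_inverse S L \<Longrightarrow> lower_unitriangular S \<Longrightarrow> lower_inverse L S"
  unfolding lower_inverse_def by blast

lemma lower_inverse_apply:
  assumes "lower_inverse S L"
  shows "(\<Sum>k\<le>n. S n k * (\<Sum>i\<le>k. L k i * x i)) = x n"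
proof -
  have L: "lower_unitriangular L" and SL: "\<And>k l. (\<Sum>j\<le>k. S k j * L j l) = (if k = l then 1 else 0)"
    using assms unfolding lower_inverse_def by auto
  have "(\<Sum>k\<le>n. S n k * (\<Sum>i\<le>k. L k i * x i)) = (\<Sum>k\<le>n. S n k * (\<Sum>i\<le>n. L k i * x i))"
    by (intro sum.cong refl arg_cong2[where f = "(*)"] lower_sum_extend[OF L]) auto
  also have "\<dots> = (\<Sum>i\<le>n. (\<Sum>k\<le>n. S n k * L k i) * x i)"
    unfolding sum_distrib_left sum_distrib_right mult.assoc by (rule sum.swap)
  also have "\<dots> = x n" by (simp add: SL sum_mult_indicator)
  finally show ?thesis .
qed

lemma gauss_borel_row:
  assumes "gauss_borel G S1 H S2"
  obtains L2 where "lower_unitriangular L2" "\<And>k l. (\<Sum>i\<le>k. S1 k i * G i l) = H k * L2 l k"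
proof -
  obtain L1 L2 where L: "lower_inverse S1 L1" "lower_inverse S2 L2"
    and G: "\<And>k l. G k l = (\<Sum>j\<le>k. L1 k j * H j * L2 l j)"
    using assms unfolding gauss_borel_def by blast
  have "(\<Sum>i\<le>k. S1 k i * G i l) = H k * L2 l k" for k l
    unfolding G using lower_inverse_apply[OF L(1), of k "\<lambda>j. H j * L2 l j"] by (simp add: mult.assoc)
  moreover have "lower_unitriangular L2" using L(2) unfolding lower_inverse_def by blast
  ultimately show ?thesis using that by blast
qed

text \<open>This reduces every statement about the right factor to one about the left factor.\<close>

lemma gauss_borel_transpose:
  assumes "gauss_borel G S1 H S2"
  shows "gauss_borel (\<lambda>k l. G l k) S2 H S1"
proof -
  obtain L1 L2 where L: "lower_inverse S1 L1" "lower_inverse S2 L2"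
    and G: "\<And>k l. G k l = (\<Sum>j\<le>k. L1 k j * H j * L2 l j)"
    using assms unfolding gauss_borel_def by blast
  have T: "lower_unitriangular L1" "lower_unitriangular L2" using L unfolding lower_inverse_def by auto
  have "G l k = (\<Sum>j\<le>k. L2 k j * H j * L1 l j)" for k l
  proof -
    have "G l k = (\<Sum>j\<le>max k l. L1 l j * (H j * L2 k j))"
      unfolding G mult.assoc by (rule lower_sum_extend[OF T(1)]) simp
    also have "\<dots> = (\<Sum>j\<le>max k l. L2 k j * (H j * L1 l j))" by (simp add: mult_ac)
    also have "\<dots> = (\<Sum>j\<le>k. L2 k j * (H j * L1 l j))"
      by (rule lower_sum_extend[OF T(2), symmetric]) simp
    finally show ?thesis by (simp add: mult.assoc)
  qed
  then show ?thesis using assms L unfolding gauss_borel_def by blast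
qed

text \<open>The rows of the left factor, multiplied by \<open>G\<close>, vanish below the diagonal; the difference of two
candidates is a vector in the left kernel of a leading principal submatrix.\<close>

lemma gauss_borel_unique_left:
  assumes inv: "\<And>n. invertible_upto n G" and "gauss_borel G S H T" "gauss_borel G S' H' T'"
  shows "S = S'" "H = H'"
proof -
  obtain L where L: "lower_unitriangular L" "\<And>k l. (\<Sum>i\<le>k. S k i * G i l) = H k * L l k"
    using gauss_borel_row[OF assms(2)] by blast
  obtain L' where L': "lower_unitriangular L'" "\<And>k l. (\<Sum>i\<le>k. S' k i * G i l) = H' k * L' l k"
    using gauss_borel_row[OF assms(3)] by blast
  have S: "lower_unitriangular S" "lower_unitriangular S'" using assms unfolding gauss_borel_def by auto
  have eq: "S k i = S' k i" for k i
  proof (cases "i < k")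
    case True
    have "(\<Sum>i<k. (S k i - S' k i) * G i l) = 0" if "l < k" for l
    proof -
      have "(\<Sum>i\<le>k. (S k i - S' k i) * G i l) = 0"
        using L(2)[of k l] L'(2)[of k l] lower_unitriangularD(2)[OF L(1) that]
          lower_unitriangularD(2)[OF L'(1) that] by (simp add: left_diff_distrib sum_subtractf)
      then show ?thesis
        using lower_unitriangularD(1)[OF S(1)] lower_unitriangularD(1)[OF S(2)]
        by (simp add: lessThan_Suc_atMost[symmetric])
    qed
    from invertible_upto_left_kernel[OF inv this True] show ?thesis by simp
  next
    case False
    then show ?thesis using lower_unitriangularD[OF S(1)] lower_unitriangularD[OF S(2)]
      by (cases "i = k") auto
  qed
  show "S = S'" using eq by blast
  show "H = H'"
  proof
    fix k
    show "H k = H' k" using L(2)[of k k] L'(2)[of k k] eq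
      by (simp add: lower_unitriangularD(1)[OF L(1)] lower_unitriangularD(1)[OF L'(1)])
  qed
qed

text \<open>Row \<open>k\<close> below the diagonal solves a linear system whose matrix is the nonsingular leading principal
submatrix of size \<open>k\<close>.\<close>

lemma orthogonal_rows_exist:
  assumes "\<And>n. invertible_upto n G"
  obtains S where "lower_unitriangular S" "\<And>k l. l < k \<Longrightarrow> (\<Sum>i\<le>k. S k i * G i l) = 0"
proof -
  have "\<exists>r. r k = 1 \<and> (\<forall>l>k. r l = 0) \<and> (\<forall>l<k. (\<Sum>i\<le>k. r i * G i l) = 0)" for k
  proof -
    obtain M where M: "\<And>i j. i < k \<Longrightarrow> j < k \<Longrightarrow> (\<Sum>l<k. M i l * G l j) = (if i = j then 1 else 0)"
      using assms[of k] unfolding invertible_upto_def by blast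
    define r where "r i = (if i < k then - (\<Sum>j<k. G k j * M j i) else if i = k then 1 else 0)" for i
    have "(\<Sum>i\<le>k. r i * G i l) = 0" if l: "l < k" for l
    proof -
      have "(\<Sum>i\<le>k. r i * G i l) = (\<Sum>i<k. r i * G i l) + G k l"
        by (simp add: lessThan_Suc_atMost[symmetric] r_def)
      also have "(\<Sum>i<k. r i * G i l) = - (\<Sum>i<k. \<Sum>j<k. G k j * (M j i * G i l))"
        by (simp add: r_def sum_negf sum_distrib_right mult.assoc)
      also have "(\<Sum>i<k. \<Sum>j<k. G k j * (M j i * G i l)) = (\<Sum>j<k. G k j * (\<Sum>i<k. M j i * G i l))"
        unfolding sum_distrib_left by (rule sum.swap)
      also have "\<dots> = (\<Sum>j<k. G k j * (if j = l then 1 else 0))"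
        using l by (intro sum.cong) (auto simp: M)
      also have "\<dots> = G k l" using l by (simp add: sum_mult_indicator)
      finally show ?thesis by simp
    qed
    then show ?thesis by (intro exI[of _ r]) (simp add: r_def)
  qed
  then obtain S where "\<And>k. S k k = 1 \<and> (\<forall>l>k. S k l = 0) \<and> (\<forall>l<k. (\<Sum>i\<le>k. S k i * G i l) = 0)"
    by metis
  then show ?thesis using that unfolding lower_unitriangular_def by blast
qed

text \<open>Rows of \<open>S1\<close> and \<open>S2\<close> that are orthogonal to all lower powers make \<open>S1 G S2\<^sup>T\<close> both upper and lower
triangular, hence diagonal.\<close>

lemma gauss_borel_exists:
  assumes inv: "\<And>n. invertible_upto n G"
  shows "\<exists>S1 H S2. gauss_borel G S1 H S2"
proof -
  obtain S1 where S1: "lower_unitriangular S1" and o1: "\<And>k l. l < k \<Longrightarrow> (\<Sum>i\<le>k. S1 k i * G i l) = 0"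
    using orthogonal_rows_exist[OF inv] by blast
  obtain S2 where S2: "lower_unitriangular S2" and o2: "\<And>k l. l < k \<Longrightarrow> (\<Sum>i\<le>k. S2 k i * G l i) = 0"
    using orthogonal_rows_exist[of "\<lambda>i j. G j i", OF invertible_upto_transpose[OF inv]] by blast
  define H where "H k = (\<Sum>i\<le>k. S1 k i * G i k)" for k
  let ?L1 = "lower_inv S1" and ?L2 = "lower_inv S2"
  have L: "lower_inverse S1 ?L1" "lower_inverse S2 ?L2" using S1 S2 by (auto intro: lower_inverse_exists)
  note L' = lower_inverse_sym[OF L(1) S1] lower_inverse_sym[OF L(2) S2]
  have D: "(\<Sum>i\<le>k. S1 k i * (\<Sum>j\<le>l. S2 l j * G i j)) = (if k = l then H k else 0)" for k l
  proof -
    have sw: "(\<Sum>i\<le>k. S1 k i * (\<Sum>j\<le>l. S2 l j * G i j)) = (\<Sum>j\<le>l. S2 l j * (\<Sum>i\<le>k. S1 k i * G i j))"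
      unfolding sum_distrib_left by (subst sum.swap) (simp only: mult.left_commute)
    show ?thesis
    proof (cases k l rule: linorder_cases)
      case less
      then show ?thesis by (auto intro!: sum.neutral simp: o2)
    next
      case equal
      have "(\<Sum>j\<le>k. S2 k j * (\<Sum>i\<le>k. S1 k i * G i j)) = (\<Sum>j<k. S2 k j * (\<Sum>i\<le>k. S1 k i * G i j)) + H k"
        by (simp add: lessThan_Suc_atMost[symmetric] lower_unitriangularD(1)[OF S2] H_def)
      also have "(\<Sum>j<k. S2 k j * (\<Sum>i\<le>k. S1 k i * G i j)) = 0" by (auto intro!: sum.neutral simp: o1)
      finally show ?thesis using equal sw by simp
    next
      case greater
      then show ?thesis unfolding sw by (auto intro!: sum.neutral simp: o1)
    qed
  qed
  have "G k l = (\<Sum>j\<le>k. ?L1 k j * H j * ?L2 l j)" for k l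
  proof -
    have "G k l = (\<Sum>a\<le>l. ?L2 l a * (\<Sum>j\<le>a. S2 a j * G k j))"
      using lower_inverse_apply[OF L'(2), of l "\<lambda>j. G k j"] by simp
    also have "\<dots> = (\<Sum>a\<le>l. ?L2 l a * (\<Sum>b\<le>k. ?L1 k b * (\<Sum>i\<le>b. S1 b i * (\<Sum>j\<le>a. S2 a j * G i j))))"
      by (simp only: lower_inverse_apply[OF L'(1)])
    also have "\<dots> = (\<Sum>a\<le>l. ?L2 l a * (\<Sum>b\<le>k. ?L1 k b * (if b = a then H b else 0)))"
      by (simp only: D)
    also have "\<dots> = (\<Sum>b\<le>k. ?L1 k b * (\<Sum>a\<le>l. ?L2 l a * (if b = a then H b else 0)))"
      unfolding sum_distrib_left by (subst sum.swap) (simp only: mult.left_commute)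
    also have "\<dots> = (\<Sum>b\<le>k. ?L1 k b * H b * ?L2 l b)"
      using lower_unitriangularD(2)[OF lower_inv_unitriangular[of S2], of l]
      by (intro sum.cong refl) (auto simp: sum_mult_indicator not_le)
    finally show ?thesis .
  qed
  then show ?thesis unfolding gauss_borel_def using S1 S2 L by blast
qed

lemma gauss_borel_ex1:
  assumes inv: "\<And>n. invertible_upto n G"
  shows "\<exists>!X. case X of (S1, H, S2) \<Rightarrow> gauss_borel G S1 H S2"
proof -
  obtain S1 H S2 where *: "gauss_borel G S1 H S2" using gauss_borel_exists[OF inv] by blast
  show ?thesis
  proof (rule ex1I[of _ "(S1, H, S2)"])
    fix X assume "case X of (S1, H, S2) \<Rightarrow> gauss_borel G S1 H S2"
    then obtain S1' H' S2' where X: "X = (S1', H', S2')" and **: "gauss_borel G S1' H' S2'"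
      by (cases X) auto
    show "X = (S1, H, S2)" unfolding X
      using gauss_borel_unique_left[OF inv ** *]
        gauss_borel_unique_left(1)[OF invertible_upto_transpose[OF inv] gauss_borel_transpose[OF **] gauss_borel_transpose[OF *]]
      by simp
  qed (simp add: *)
qed

section \<open>Biorthogonal polynomials of a quasi-definite form\<close>

locale polynomial_form =
  fixes B :: "complex poly \<Rightarrow> (complex \<Rightarrow> complex) \<Rightarrow> complex"
  assumes add_left: "B (P + Q) (poly g) = B P (poly g) + B Q (poly g)"
    and smult_left: "B (Polynomial.smult c P) (poly g) = c * B P (poly g)"
    and add_right: "B P (poly (g + h)) = B P (poly g) + B P (poly h)"
    and smult_right: "B P (poly (Polynomial.smult c g)) = c * B P (poly g)"
begin

lemma zero_left: "B 0 (poly g) = 0"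
  using smult_left[of 0 0 g] by simp

lemma zero_right: "B P (poly 0) = 0"
  using smult_right[of P 0 0] by simp

lemma sum_left: "B (\<Sum>i\<in>A. f i) (poly g) = (\<Sum>i\<in>A. B (f i) (poly g))"
  by (induction A rule: infinite_finite_induct) (auto simp: zero_left add_left)

lemma sum_right: "B P (poly (\<Sum>i\<in>A. f i)) = (\<Sum>i\<in>A. B P (poly (f i)))"
  by (induction A rule: infinite_finite_induct)
    (simp_all only: sum.infinite sum.empty sum.insert zero_right add_right not_False_eq_True)

lemma diff_left: "B (P - Q) (poly g) = B P (poly g) - B Q (poly g)"
  using add_left[of P "Polynomial.smult (- 1) Q" g] smult_left[of "- 1" Q g] by simp

lemma diff_right: "B P (poly (g - h)) = B P (poly g) - B P (poly h)"
  using add_right[of P g "Polynomial.smult (- 1) h"] smult_right[of P "- 1" h] by simp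

lemma gram_eq: "gram B k l = B (Polynomial.monom 1 k) (poly (Polynomial.monom 1 l))"
proof -
  have "poly (Polynomial.monom 1 l) = (\<lambda>y :: complex. y ^ l)" by (simp add: fun_eq_iff poly_monom)
  then show ?thesis unfolding gram_def by simp
qed

lemma monom_left: "B (Polynomial.monom a k) (poly g) = a * B (Polynomial.monom 1 k) (poly g)"
  using smult_left[of a "Polynomial.monom 1 k" g] by (simp add: smult_monom)

lemma monom_right: "B P (poly (Polynomial.monom a k)) = a * B P (poly (Polynomial.monom 1 k))"
  using smult_right[of P a "Polynomial.monom 1 k"] by (simp add: smult_monom)

end

lemma monic_basis:
  fixes p :: "nat \<Rightarrow> complex poly"
  assumes "\<And>k. degree (p k) = k" "\<And>k. coeff (p k) k = 1" "degree P \<le> n"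
  shows "\<exists>c. P = (\<Sum>k\<le>n. Polynomial.smult (c k) (p k))"
  using assms(3)
proof (induction n arbitrary: P)
  case 0
  have "p 0 = [:1:]" using assms(1,2)[of 0] by (metis degree_0_id)
  moreover have "P = [:coeff P 0:]" using 0 by (metis degree_0_id le_zero_eq)
  ultimately show ?case by (intro exI[of _ "\<lambda>_. coeff P 0"]) simp
next
  case (Suc n)
  define Q where "Q = P - Polynomial.smult (coeff P (Suc n)) (p (Suc n))"
  have "degree Q \<le> Suc n" unfolding Q_def
    using Suc.prems assms(1)[of "Suc n"] by (intro degree_diff_le) (auto intro: order_trans[OF degree_smult_le])
  moreover have "coeff Q (Suc n) = 0" unfolding Q_def by (simp add: assms(2))
  ultimately have "degree Q \<le> n"
    by (metis coeff_0_degree_minus_1 degree_0 diff_Suc_1 eq_zero_or_degree_less le_SucE less_Suc_eq_le zero_le)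
  then obtain c where c: "Q = (\<Sum>k\<le>n. Polynomial.smult (c k) (p k))" using Suc.IH by blast
  have "P = Q + Polynomial.smult (coeff P (Suc n)) (p (Suc n))" by (simp add: Q_def)
  then have "P = (\<Sum>k\<le>Suc n. Polynomial.smult ((c(Suc n := coeff P (Suc n))) k) (p k))"
    by (simp add: c)
  then show ?case by blast
qed

lemma unitriangular_monic:
  assumes "lower_unitriangular S"
  shows "degree (\<Sum>l\<le>k. Polynomial.monom (S k l) l) = k"
    and "coeff (\<Sum>l\<le>k. Polynomial.monom (S k l) l) k = 1"
proof -
  have c: "coeff (\<Sum>l\<le>k. Polynomial.monom (S k l) l) j = (if j \<le> k then S k j else 0)" for j
    by (simp add: coeff_sum)
  show 1: "coeff (\<Sum>l\<le>k. Polynomial.monom (S k l) l) k = 1"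
    unfolding c using lower_unitriangularD(1)[OF assms] by simp
  show "degree (\<Sum>l\<le>k. Polynomial.monom (S k l) l) = k"
    by (rule antisym, rule degree_le) (use 1 c in \<open>auto intro: le_degree\<close>)
qed

locale quasi_definite_form = polynomial_form +
  assumes quasi_definite: "quasi_definite B"
begin

abbreviation "P1 \<equiv> biorth1 B"
abbreviation "P2 \<equiv> biorth2 B"
abbreviation "H \<equiv> gb_norm B"
abbreviation "S1 \<equiv> fst (gb_factors B)"
abbreviation "S2 \<equiv> snd (snd (gb_factors B))"

lemma gram_invertible: "invertible_upto n (gram B)"
  using quasi_definite unfolding quasi_definite_def by (blast intro: det_nonzero_imp_invertible_upto)

lemma gauss_borel_factors: "gauss_borel (gram B) S1 H S2"
  using theI'[OF gauss_borel_ex1[OF gram_invertible]]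
  unfolding gb_factors_def[symmetric] gb_norm_def by (simp add: case_prod_beta)

lemma S_unitriangular: "lower_unitriangular S1" "lower_unitriangular S2"
  using gauss_borel_factors unfolding gauss_borel_def by auto

lemma degree_P1: "degree (P1 k) = k" and coeff_P1: "coeff (P1 k) k = 1"
  unfolding biorth1_def using unitriangular_monic[OF S_unitriangular(1)] by auto

lemma degree_P2: "degree (P2 k) = k" and coeff_P2: "coeff (P2 k) k = 1"
  unfolding biorth2_def using unitriangular_monic[OF S_unitriangular(2)] by auto

lemma P1_monom:
  shows "l < k \<Longrightarrow> B (P1 k) (poly (Polynomial.monom 1 l)) = 0"
    and "B (P1 k) (poly (Polynomial.monom 1 k)) = H k"
proof -
  obtain L where L: "lower_unitriangular L" "\<And>k l. (\<Sum>i\<le>k. S1 k i * gram B i l) = H k * L l k"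
    using gauss_borel_row[OF gauss_borel_factors] by blast
  have "B (P1 k) (poly (Polynomial.monom 1 l)) = H k * L l k" for l
    unfolding L(2)[symmetric] biorth1_def sum_left gram_eq by (rule sum.cong[OF refl monom_left])
  then show "l < k \<Longrightarrow> B (P1 k) (poly (Polynomial.monom 1 l)) = 0"
    and "B (P1 k) (poly (Polynomial.monom 1 k)) = H k"
    using lower_unitriangularD[OF L(1)] by auto
qed

lemma P2_monom: "l < k \<Longrightarrow> B (Polynomial.monom 1 l) (poly (P2 k)) = 0"
proof -
  assume l: "l < k"
  obtain L where L: "lower_unitriangular L" "\<And>k l. (\<Sum>i\<le>k. S2 k i * gram B l i) = H k * L l k"
    using gauss_borel_row[OF gauss_borel_transpose[OF gauss_borel_factors]] by blast
  have "B (Polynomial.monom 1 l) (poly (P2 k)) = H k * L l k" for l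
    unfolding L(2)[symmetric] biorth2_def sum_right gram_eq by (rule sum.cong[OF refl monom_right])
  then show ?thesis using lower_unitriangularD[OF L(1)] l by auto
qed

lemma P1_orthogonal:
  assumes "degree g < k"
  shows "B (P1 k) (poly g) = 0"
proof -
  have "B (P1 k) (poly (\<Sum>i\<le>degree g. Polynomial.monom (coeff g i) i)) =
      (\<Sum>i\<le>degree g. coeff g i * B (P1 k) (poly (Polynomial.monom 1 i)))"
    unfolding sum_right by (rule sum.cong[OF refl monom_right])
  also have "\<dots> = 0" using assms by (intro sum.neutral) (auto simp: P1_monom(1))
  finally show ?thesis by (simp only: poly_as_sum_of_monoms)
qed

lemma P2_orthogonal:
  assumes "degree g < k"
  shows "B g (poly (P2 k)) = 0"
proof -
  have "B (\<Sum>i\<le>degree g. Polynomial.monom (coeff g i) i) (poly (P2 k)) =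
      (\<Sum>i\<le>degree g. coeff g i * B (Polynomial.monom 1 i) (poly (P2 k)))"
    unfolding sum_left by (rule sum.cong[OF refl monom_left])
  also have "\<dots> = 0" using assms by (intro sum.neutral) (auto simp: P2_monom)
  finally show ?thesis by (simp only: poly_as_sum_of_monoms)
qed

lemma P1_monic:
  assumes "degree g = k" "coeff g k = 1"
  shows "B (P1 k) (poly g) = H k"
proof (cases "k = 0")
  case True
  then have "g = Polynomial.monom 1 k" using assms by (metis degree_0_id monom_0)
  then show ?thesis using P1_monom(2)[of k] by simp
next
  case False
  let ?h = "g - Polynomial.monom 1 k"
  have "degree ?h \<le> k" using assms(1) by (intro degree_diff_le) (auto simp: degree_monom_eq)
  moreover have "coeff ?h k = 0" using assms(2) by simp
  ultimately have "degree ?h < k" using False by (metis degree_0 eq_zero_or_degree_less gr0I)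
  then have "B (P1 k) (poly ?h) = 0" by (rule P1_orthogonal)
  then show ?thesis by (simp add: diff_right P1_monom(2) del: poly_diff)
qed

lemma biorthogonal: "B (P1 k) (poly (P2 l)) = (if k = l then H k else 0)"
proof (cases k l rule: linorder_cases)
  case less
  then show ?thesis by (simp add: P2_orthogonal degree_P1)
next
  case equal
  then show ?thesis using P1_monic[OF degree_P2 coeff_P2] by simp
next
  case greater
  then show ?thesis by (simp add: P1_orthogonal degree_P2)
qed

text \<open>If \<open>H k\<close> were zero, the \<open>k\<close>-th row of \<open>S1\<close> would be orthogonal to the power \<open>k\<close> too and would lie in the
left kernel of the leading principal submatrix of size \<open>k + 1\<close>.\<close>

lemma H_nonzero: "H k \<noteq> 0"
proof
  assume 0: "H k = 0"
  have "(\<Sum>i<Suc k. S1 k i * gram B i l) = 0" if "l < Suc k" for l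
  proof -
    have "(\<Sum>i\<le>k. S1 k i * gram B i l) = B (P1 k) (poly (Polynomial.monom 1 l))"
      unfolding biorth1_def sum_left gram_eq by (rule sum.cong[OF refl monom_left[symmetric]])
    also have "\<dots> = 0" using P1_monom(1)[of l k] P1_monom(2)[of k] 0 that by (cases "l = k") auto
    finally show ?thesis by (simp only: lessThan_Suc_atMost)
  qed
  from invertible_upto_left_kernel[OF gram_invertible this, of k]
  show False using lower_unitriangularD(1)[OF S_unitriangular(1)] by simp
qed

lemma expand_P1:
  assumes "degree P \<le> n"
  shows "P = (\<Sum>k\<le>n. Polynomial.smult (B P (poly (P2 k)) / H k) (P1 k))"
proof -
  obtain c where c: "P = (\<Sum>k\<le>n. Polynomial.smult (c k) (P1 k))"
    using monic_basis[OF degree_P1 coeff_P1 assms] by blast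
  have "B P (poly (P2 k)) = c k * H k" if "k \<le> n" for k
    unfolding c using that by (simp add: sum_left smult_left biorthogonal sum_mult_indicator)
  then show ?thesis using H_nonzero by (subst c) (intro sum.cong, auto)
qed

lemma expand_P2:
  assumes "degree g \<le> n"
  shows "g = (\<Sum>k\<le>n. Polynomial.smult (B (P1 k) (poly g) / H k) (P2 k))"
proof -
  obtain c where c: "g = (\<Sum>k\<le>n. Polynomial.smult (c k) (P2 k))"
    using monic_basis[OF degree_P2 coeff_P2 assms] by blast
  have "B (P1 k) (poly g) = c k * H k" if "k \<le> n" for k
  proof -
    have "B (P1 k) (poly g) = (\<Sum>l\<le>n. c l * (if k = l then H k else 0))"
      unfolding c sum_right smult_right biorthogonal ..
    then show ?thesis using that by (simp add: sum_mult_indicator)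
  qed
  then show ?thesis using H_nonzero by (subst c) (intro sum.cong, auto)
qed

lemma nondegenerate:
  assumes "degree P < n" "\<And>g. degree g < n \<Longrightarrow> B P (poly g) = 0"
  shows "P = 0"
proof -
  have "P = (\<Sum>k\<le>degree P. Polynomial.smult (B P (poly (P2 k)) / H k) (P1 k))"
    by (rule expand_P1) simp
  also have "\<dots> = 0" using assms by (intro sum.neutral) (auto simp: degree_P2)
  finally show ?thesis .
qed

lemma CD_kernel_form:
  "B (CD_kernel B n y) (poly g) = (\<Sum>k\<le>n. poly (P2 k) y * inverse (H k) * B (P1 k) (poly g))"
  unfolding CD_kernel_def by (simp add: sum_left smult_left)

lemma CD_kernel_reproducing:
  assumes "degree g \<le> n"
  shows "B (CD_kernel B n y) (poly g) = poly g y"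
proof -
  have "poly g y = poly (\<Sum>k\<le>n. Polynomial.smult (B (P1 k) (poly g) / H k) (P2 k)) y"
    using expand_P2[OF assms] by simp
  then show ?thesis unfolding CD_kernel_form by (simp add: poly_sum divide_inverse mult_ac)
qed

lemma degree_CD_kernel: "degree (CD_kernel B n y) \<le> n"
  unfolding CD_kernel_def
  by (intro degree_sum_le) (auto intro!: order_trans[OF degree_smult_le] simp: degree_P1)

lemma P1_independent:
  assumes "(\<Sum>a<N. Polynomial.smult (v a) (P1 (j + a))) = 0" "a < N"
  shows "v a = 0"
proof -
  have "0 = B (\<Sum>a<N. Polynomial.smult (v a) (P1 (j + a))) (poly (P2 (j + a)))"
    unfolding assms(1) by (simp add: zero_left)
  also have "\<dots> = (\<Sum>b<N. v b * (if b = a then H (j + b) else 0))"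
    by (simp add: sum_left smult_left biorthogonal)
  also have "\<dots> = v a * H (j + a)" using assms(2) by (simp add: sum_mult_indicator)
  finally show ?thesis using H_nonzero by simp
qed

end

section \<open>Connection formulas\<close>

lemma sum_lessThan_add: "(\<Sum>k<j + N. F k) = (\<Sum>k<j. F k) + (\<Sum>a<N. F (j + a))"
  for F :: "nat \<Rightarrow> 'a :: comm_monoid_add"
  by (induction N) (auto simp: add.assoc)

text \<open>The algebraic content of a Geronimus perturbation. The spanning assumption says that the \<open>f b\<close> span the
polynomials of degree less than \<open>N\<close>, in the form in which it is used, for a linear functional.\<close>

locale geronimus_pair = u: quasi_definite_form B + v: quasi_definite_form B'
  for B B' :: "complex poly \<Rightarrow> (complex \<Rightarrow> complex) \<Rightarrow> complex" +
  fixes W :: "complex poly" and N :: nat and f :: "nat \<Rightarrow> complex poly"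
  assumes degree_W: "degree W = N" and lead_W: "coeff W N = 1" and N_pos: "1 \<le> N"
    and times_W: "B' P (poly (W * g)) = B P (poly g)"
    and degree_f: "b < N \<Longrightarrow> degree (f b) < N"
    and spanning: "(\<And>p r. \<phi> (p + r) = \<phi> p + \<phi> r) \<Longrightarrow> (\<And>c p. \<phi> (Polynomial.smult c p) = c * \<phi> p) \<Longrightarrow>
      (\<And>b. b < N \<Longrightarrow> \<phi> (f b) = 0) \<Longrightarrow> degree g < N \<Longrightarrow> \<phi> g = (0 :: complex)"
begin

lemma W_nonzero: "W \<noteq> 0"
  using lead_W by auto

lemma degree_W_times: "degree (W * g) = (if g = 0 then 0 else N + degree g)"
  using W_nonzero degree_mult_eq[of W g] degree_W by auto

text \<open>Division by \<open>W\<close> splits \<open>g\<close> into \<open>W h\<close>, on which the perturbed form reduces to the original one, and a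
remainder in the span of the \<open>f b\<close>.\<close>

lemma perturbed_orthogonal:
  assumes n: "N \<le> n"
    and f0: "\<And>b. b < N \<Longrightarrow> B' P (poly (f b)) = 0"
    and P: "\<And>h. degree h < n - N \<Longrightarrow> B P (poly h) = 0"
    and g: "degree g < n"
  shows "B' P (poly g) = 0"
proof -
  define h r where "h = g div W" and "r = g mod W"
  have gr: "g = W * h + r" by (simp add: h_def r_def)
  have dr: "degree r < N"
    using degree_mod_less[OF W_nonzero, of g] degree_W N_pos unfolding r_def by auto
  have "B' P (poly r) = 0"
    using spanning[of "\<lambda>p. B' P (poly p)", OF v.add_right v.smult_right f0 dr] by simp
  moreover have "B P (poly h) = 0"
  proof (cases "h = 0")
    case True
    then show ?thesis using u.zero_right by simp
  next
    case False
    have "degree (W * h) < n"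
      using gr g dr n degree_diff_less[of g n r] by (metis add_diff_cancel_right' less_le_trans)
    then have "degree h < n - N" using False by (simp add: degree_W_times)
    then show ?thesis by (rule P)
  qed
  ultimately show ?thesis unfolding gr v.add_right times_W by simp
qed

text \<open>A dependency with coefficients \<open>v\<close> makes \<open>\<Sum> v\<^sub>a P\<^sub>1\<^sub>,\<^sub>n\<^sub>-\<^sub>N\<^sub>+\<^sub>a\<close>, a polynomial of degree less than \<open>n\<close>, orthogonal to all
polynomials of degree less than \<open>n\<close>. The quasi-definiteness of the perturbed form forces it to be zero.\<close>

lemma rows_independent:
  assumes n: "N \<le> n"
    and 0: "\<And>b. b < N \<Longrightarrow> (\<Sum>a<N. v a * B' (u.P1 (n - N + a)) (poly (f b))) = 0"
    and a: "a < N"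
  shows "v a = 0"
proof -
  define P where "P = (\<Sum>a<N. Polynomial.smult (v a) (u.P1 (n - N + a)))"
  have "degree P < n"
    unfolding P_def using n N_pos
    by (intro degree_sum_less) (auto intro!: le_less_trans[OF degree_smult_le] simp: u.degree_P1)
  moreover have "B' P (poly g) = 0" if "degree g < n" for g
  proof (rule perturbed_orthogonal[OF n _ _ that])
    show "B' P (poly (f b)) = 0" if "b < N" for b
      unfolding P_def using 0[OF that] by (simp add: v.sum_left v.smult_left)
    show "B P (poly h) = 0" if "degree h < n - N" for h
      unfolding P_def using that by (simp add: u.sum_left u.smult_left u.P1_orthogonal)
  qed
  ultimately have "P = 0" by (rule v.nondegenerate)
  then show ?thesis unfolding P_def using u.P1_independent a by blast
qed

text \<open>The coefficient of \<open>P\<^sub>1\<^sub>,\<^sub>k\<close> in the perturbed polynomial is its perturbed pairing with \<open>W P\<^sub>2\<^sub>,\<^sub>k\<close>, divided by \<open>H\<^sub>k\<close>;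
it vanishes for \<open>k < n - N\<close> by degree. For \<open>k = n - N\<close> the polynomial \<open>W P\<^sub>2\<^sub>,\<^sub>k\<close> is monic of degree \<open>n\<close>, which gives
the perturbed norm. The linear system is the orthogonality to the \<open>f b\<close>.\<close>

lemma perturbed_P1:
  assumes n: "N \<le> n"
  obtains t where
    "v.P1 n = u.P1 n - (\<Sum>a<N. Polynomial.smult (t a) (u.P1 (n - N + a)))"
    "v.H n = - (t 0 * u.H (n - N))"
    "\<And>b. b < N \<Longrightarrow> (\<Sum>a<N. t a * B' (u.P1 (n - N + a)) (poly (f b))) = B' (u.P1 n) (poly (f b))"
proof -
  define c where "c k = B (v.P1 n) (poly (u.P2 k)) / u.H k" for k
  \<comment> \<open>The sign is that of the subtracted term in a quasi-determinant.\<close>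
  define t where "t a = - c (n - N + a)" for a
  have low: "c k = 0" if "k < n - N" for k
  proof -
    have "degree (W * u.P2 k) < n" using that by (auto simp: degree_W_times u.degree_P2)
    then show ?thesis unfolding c_def times_W[symmetric] by (simp add: v.P1_orthogonal del: poly_mult)
  qed
  have "v.P1 n = (\<Sum>k\<le>n. Polynomial.smult (c k) (u.P1 k))"
    unfolding c_def by (rule u.expand_P1) (simp add: v.degree_P1)
  then have e: "v.P1 n = (\<Sum>k<n - N + N. Polynomial.smult (c k) (u.P1 k)) + Polynomial.smult (c n) (u.P1 n)"
    using n by (simp add: lessThan_Suc_atMost[symmetric])
  have "coeff (v.P1 n) n = c n"
    unfolding e using n by (simp add: coeff_sum u.coeff_P1 coeff_eq_0 u.degree_P1)
  then have cn: "c n = 1" by (simp add: v.coeff_P1)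
  have P: "v.P1 n = u.P1 n - (\<Sum>a<N. Polynomial.smult (t a) (u.P1 (n - N + a)))"
    unfolding e sum_lessThan_add cn using low by (simp add: t_def sum_negf)
  moreover have "v.H n = - (t 0 * u.H (n - N))"
  proof -
    have nz: "u.P2 (n - N) \<noteq> 0" using u.coeff_P2[of "n - N"] by auto
    have d: "degree (W * u.P2 (n - N)) = n" using n nz by (simp add: degree_W_times u.degree_P2)
    have "coeff (W * u.P2 (n - N)) n = 1"
      using lead_coeff_mult[of W "u.P2 (n - N)"] d degree_W lead_W
      by (simp add: u.degree_P2 u.coeff_P2)
    from v.P1_monic[OF d this] show ?thesis
      unfolding times_W t_def c_def using u.H_nonzero by simp
  qed
  moreover have "(\<Sum>a<N. t a * B' (u.P1 (n - N + a)) (poly (f b))) = B' (u.P1 n) (poly (f b))" if b: "b < N" for b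
  proof -
    have "B' (v.P1 n) (poly (f b)) = 0" using degree_f[OF b] n by (simp add: v.P1_orthogonal)
    then show ?thesis unfolding P by (simp add: v.diff_left v.sum_left v.smult_left)
  qed
  ultimately show ?thesis using that by blast
qed

text \<open>Let \<open>D\<close> be the perturbed kernel minus \<open>W(y)\<close> times the unperturbed one. Pairing it with \<open>P\<^sub>2\<^sub>,\<^sub>k\<close> compares the
values of \<open>W P\<^sub>2\<^sub>,\<^sub>k\<close> at \<open>y\<close> that the two kernels reproduce; they agree for \<open>k < n - N\<close>. For \<open>k = n - N\<close> the degree of
\<open>W P\<^sub>2\<^sub>,\<^sub>k\<close> is \<open>n\<close>, one too large for the perturbed kernel, and precisely the perturbed \<open>P\<^sub>2\<^sub>,\<^sub>n\<close> is missing.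
Pairing \<open>D\<close> with \<open>f b\<close> in the perturbed form gives the linear system.\<close>

lemma perturbed_P2:
  assumes n: "N \<le> n"
  obtains t where "poly (v.P2 n) y = t 0 * u.H (n - N)"
    "\<And>b. b < N \<Longrightarrow> (\<Sum>a<N. t a * B' (u.P1 (n - N + a)) (poly (f b))) =
       poly W y * B' (CD_kernel B (n - 1) y) (poly (f b)) - poly (f b) y"
proof -
  have n1: "1 \<le> n" using n N_pos by simp
  define D where "D = CD_kernel B' (n - 1) y - Polynomial.smult (poly W y) (CD_kernel B (n - 1) y)"
  define c where "c k = B D (poly (u.P2 k)) / u.H k" for k
  define t where "t a = - c (n - N + a)" for a
  have BD: "B D (poly g) = B' (CD_kernel B' (n - 1) y) (poly (W * g)) - poly W y * poly g y"
    if "degree g \<le> n - 1" for g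
    unfolding D_def u.diff_left u.smult_left times_W u.CD_kernel_reproducing[OF that] ..
  have low: "c k = 0" if "k < n - N" for k
  proof -
    have d: "degree (W * u.P2 k) \<le> n - 1" using that by (auto simp: degree_W_times u.degree_P2)
    have "B D (poly (u.P2 k)) = 0"
      using BD[of "u.P2 k"] v.CD_kernel_reproducing[OF d] that by (simp add: u.degree_P2)
    then show ?thesis by (simp add: c_def)
  qed
  have "degree D \<le> n - 1" unfolding D_def
    by (intro degree_diff_le v.degree_CD_kernel order_trans[OF degree_smult_le u.degree_CD_kernel])
  then have "D = (\<Sum>k\<le>n - 1. Polynomial.smult (c k) (u.P1 k))"
    unfolding c_def by (rule u.expand_P1)
  also have "{..n - 1} = {..<n - N + N}" using n n1 by auto
  finally have D: "D = (\<Sum>a<N. Polynomial.smult (- t a) (u.P1 (n - N + a)))"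
    unfolding sum_lessThan_add using low by (simp add: t_def)
  have "poly (v.P2 n) y = t 0 * u.H (n - N)"
  proof -
    let ?g = "W * u.P2 (n - N)"
    have nz: "u.P2 (n - N) \<noteq> 0" using u.coeff_P2[of "n - N"] by auto
    have d: "degree ?g = n" using n nz by (simp add: degree_W_times u.degree_P2)
    have "coeff ?g n = 1"
      using lead_coeff_mult[of W "u.P2 (n - N)"] d degree_W lead_W
      by (simp add: u.degree_P2 u.coeff_P2)
    then have c0: "coeff (?g - v.P2 n) n = 0" by (simp add: v.coeff_P2)
    have "degree (?g - v.P2 n) \<le> n" using d by (intro degree_diff_le) (auto simp: v.degree_P2)
    then have dl: "degree (?g - v.P2 n) \<le> n - 1"
      using c0 by (metis diff_le_self eq_zero_or_degree_less degree_0 le_antisym less_Suc_eq_le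
          n1 le_add_diff_inverse plus_1_eq_Suc zero_le)
    have "B' (CD_kernel B' (n - 1) y) (poly (v.P2 n)) = 0"
      using le_less_trans[OF v.degree_CD_kernel, of "n - 1" n] n1 by (intro v.P2_orthogonal) auto
    then have "B' (CD_kernel B' (n - 1) y) (poly ?g) = poly (?g - v.P2 n) y"
      using v.CD_kernel_reproducing[OF dl, of y] by (simp only: v.diff_right) simp
    then have "B D (poly (u.P2 (n - N))) = - poly (v.P2 n) y"
      using BD[of "u.P2 (n - N)"] n n1 N_pos by (simp add: u.degree_P2)
    then show ?thesis unfolding t_def c_def using u.H_nonzero by simp
  qed
  moreover have "(\<Sum>a<N. t a * B' (u.P1 (n - N + a)) (poly (f b))) =
       poly W y * B' (CD_kernel B (n - 1) y) (poly (f b)) - poly (f b) y" if b: "b < N" for b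
  proof -
    have "degree (f b) \<le> n - 1" using degree_f[OF b] n by simp
    then have "B' D (poly (f b)) = poly (f b) y - poly W y * B' (CD_kernel B (n - 1) y) (poly (f b))"
      unfolding D_def v.diff_left v.smult_left by (simp add: v.CD_kernel_reproducing)
    moreover have "B' D (poly (f b)) = - (\<Sum>a<N. t a * B' (u.P1 (n - N + a)) (poly (f b)))"
      unfolding D v.sum_left v.smult_left by (simp add: sum_negf)
    ultimately show ?thesis by (simp add: algebra_simps)
  qed
  ultimately show ?thesis using that by blast
qed

end

section \<open>Last quasi-determinants of bordered matrices\<close>

text \<open>The coefficients that express the last row through the others are its product with the inverse of the
upper left block.\<close>

lemma last_quasidet_bordered:
  assumes indep: "\<forall>v. (\<forall>b<N. (\<Sum>a<N. v a * vec_index (r a) b) = 0) \<longrightarrow> (\<forall>a<N. v a = 0)"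
    and t: "\<forall>b<N. (\<Sum>a<N. t a * vec_index (r a) b) = vec_index (r N) b"
  shows "last_quasidet_defined (bordered N r c)"
    and "last_quasidet (bordered N r c) = c N - (\<Sum>a<N. t a * c a)"
proof -
  define A where "A = Matrix.mat N N (\<lambda>(a, b). vec_index (r a) b)"
  define T where "T = Matrix.mat 1 N (\<lambda>(_ :: nat, a). t a)"
  define b where "b = Matrix.mat N 1 (\<lambda>(a, _ :: nat). c a)"
  define e where "e = Matrix.mat 1 1 (\<lambda>(_ :: nat, _ :: nat). c N)"
  define w where "w = Matrix.mat 1 N (\<lambda>(_ :: nat, b). vec_index (r N) b)"
  have A: "A \<in> carrier_mat N N" and T: "T \<in> carrier_mat 1 N" and b: "b \<in> carrier_mat N 1"
    by (auto simp: A_def T_def b_def)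
  have split: "split_block (bordered N r c) (dim_row (bordered N r c) - 1) (dim_col (bordered N r c) - 1) =
      (A, b, w, e)"
    unfolding split_block_def Let_def bordered_def A_def b_def w_def e_def
    by (auto intro!: eq_matI)
  have "Determinant.det (transpose_mat A) \<noteq> 0"
  proof
    assume "Determinant.det (transpose_mat A) = 0"
    then obtain v where v: "v \<in> carrier_vec N" "v \<noteq> 0\<^sub>v N" "mult_mat_vec (transpose_mat A) v = 0\<^sub>v N"
      using det_0_iff_vec_prod_zero[of "transpose_mat A" N] A by auto
    have "(\<Sum>a<N. vec_index v a * vec_index (r a) b) = 0" if "b < N" for b
      using arg_cong[OF v(3), of "\<lambda>x. vec_index x b"] that v(1) A
      by (simp add: A_def scalar_prod_def lessThan_atLeast0 mult.commute)
    then have "vec_index v a = 0" if "a < N" for a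
      using indep[rule_format, of "vec_index v"] that by blast
    then have "v = 0\<^sub>v N" using v(1) by (intro eq_vecI) auto
    then show False using v(2) by simp
  qed
  then have "Determinant.det A \<noteq> 0" using det_transpose[OF A] by simp
  then obtain M where "mat_inverse A = Some M"
    using mat_inverse(1)[OF A, of "()"] det_non_zero_imp_unit[OF A, of "()"] by (cases "mat_inverse A") auto
  then have M: "mat_inverse A = Some M" "A * M = 1\<^sub>m N" "M * A = 1\<^sub>m N" "M \<in> carrier_mat N N"
    using mat_inverse(2)[OF A] by auto
  have "invertible_mat A"
    unfolding invertible_mat_def inverts_mat_def using M A by auto
  then show "last_quasidet_defined (bordered N r c)"
    unfolding last_quasidet_defined_def split by simp
  have w: "w = T * A"
    using t by (intro eq_matI) (auto simp: w_def T_def A_def scalar_prod_def lessThan_atLeast0)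
  have "w * M = T" unfolding w using assoc_mult_mat[OF T A M(4)] M(2) T by simp
  then have "last_quasidet (bordered N r c) = (e - T * b) $$ (0, 0)"
    unfolding last_quasidet_def split by (simp add: M(1))
  also have "\<dots> = c N - (\<Sum>a<N. t a * c a)"
    by (simp add: e_def T_def b_def scalar_prod_def lessThan_atLeast0)
  finally show "last_quasidet (bordered N r c) = c N - (\<Sum>a<N. t a * c a)" .
qed

section \<open>Partial fractions of the perturbing polynomial\<close>

text \<open>The quotient of \<open>root_poly s q m\<close> by \<open>(y - q i) ^ Suc l\<close>, for \<open>l < m i\<close>.\<close>

definition part_frac :: "nat \<Rightarrow> (nat \<Rightarrow> complex) \<Rightarrow> (nat \<Rightarrow> nat) \<Rightarrow> nat \<Rightarrow> nat \<Rightarrow> complex poly" where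
  "part_frac s q m i l = [:- q i, 1:] ^ (m i - Suc l) * (\<Prod>j\<in>{..<s} - {i}. [:- q j, 1:] ^ m j)"

lemma part_frac_times:
  assumes "i < s" "l < m i"
  shows "[:- q i, 1:] ^ Suc l * part_frac s q m i l = root_poly s q m"
proof -
  have "[:- q i, 1:] ^ Suc l * [:- q i, 1:] ^ (m i - Suc l) = [:- q i, 1:] ^ m i"
    using assms(2) unfolding power_add[symmetric] by simp
  then show ?thesis
    unfolding part_frac_def root_poly_def using prod.remove[of "{..<s}" i "\<lambda>j. [:- q j, 1:] ^ m j"] assms(1)
    by (simp only: mult.assoc[symmetric]) simp
qed

lemma degree_root_poly: "degree (root_poly s q m) = (\<Sum>i<s. m i)"
  and lead_root_poly: "coeff (root_poly s q m) (\<Sum>i<s. m i) = 1"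
proof -
  show 1: "degree (root_poly s q m) = (\<Sum>i<s. m i)"
    unfolding root_poly_def by (subst degree_prod_eq_sum_degree) (auto simp: degree_power_eq)
  have "lead_coeff (root_poly s q m) = 1"
    unfolding root_poly_def by (simp add: lead_coeff_prod lead_coeff_power)
  then show "coeff (root_poly s q m) (\<Sum>i<s. m i) = 1" unfolding 1 .
qed

lemma root_poly_nonzero: "root_poly s q m \<noteq> 0"
  using lead_root_poly[of s q m] by auto

lemma degree_part_frac:
  assumes "i < s" "l < m i"
  shows "degree (part_frac s q m i l) + Suc l = (\<Sum>i<s. m i)"
proof -
  have "part_frac s q m i l \<noteq> 0" using part_frac_times[where i = i and m = m and q = q, OF assms] root_poly_nonzero[of s q m] by auto
  then have "degree ([:- q i, 1:] ^ Suc l * part_frac s q m i l) = Suc l + degree (part_frac s q m i l)"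
    by (simp add: degree_mult_eq degree_power_eq del: power_Suc)
  then show ?thesis using part_frac_times[where i = i and m = m and q = q, OF assms] degree_root_poly[of s q m] by simp
qed

text \<open>Existence of the partial fraction expansion, by induction on the number of roots: a multiple of
the quotient by the full power of one factor \<open>y - q i\<close> makes \<open>g\<close> vanish at \<open>q i\<close>, and that factor cancels.\<close>

lemma part_frac_spanning:
  fixes \<phi> :: "complex poly \<Rightarrow> complex"
  assumes "inj_on q {..<s}" "\<And>p r. \<phi> (p + r) = \<phi> p + \<phi> r" "\<And>c p. \<phi> (Polynomial.smult c p) = c * \<phi> p"
    and "\<And>i l. i < s \<Longrightarrow> l < m i \<Longrightarrow> \<phi> (part_frac s q m i l) = 0" "degree g < (\<Sum>i<s. m i)"
  shows "\<phi> g = 0"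
  using assms(2-)
proof (induction "\<Sum>i<s. m i" arbitrary: m \<phi> g)
  case 0
  then show ?case by simp
next
  case (Suc N)
  note add = Suc.prems(1) and smult = Suc.prems(2) and pf0 = Suc.prems(3)
  have zero: "\<phi> 0 = 0" using smult[of 0 0] by simp
  obtain i where i: "i < s" "0 < m i"
    using Suc.hyps(2) by (metis gr0I lessThan_iff nat.simps(3) sum.neutral)
  define U where "U = part_frac s q m i (m i - 1)"
  have U: "U = (\<Prod>j\<in>{..<s} - {i}. [:- q j, 1:] ^ m j)" using i(2) by (simp add: U_def part_frac_def)
  have "poly U (q i) \<noteq> 0"
    unfolding U using assms(1) i(1) by (auto simp: poly_prod poly_power inj_on_def)
  have dU: "degree U \<le> N" using degree_part_frac[OF i(1), of "m i - 1" m q] i(2) Suc.hyps(2) by (simp add: U_def)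
  define c where "c = poly g (q i) / poly U (q i)"
  have "poly (g - Polynomial.smult c U) (q i) = 0" using \<open>poly U (q i) \<noteq> 0\<close> by (simp add: c_def)
  then obtain h where h: "g - Polynomial.smult c U = [:- q i, 1:] * h"
    unfolding poly_eq_0_iff_dvd by (elim dvdE)
  have gh: "g = Polynomial.smult c U + [:- q i, 1:] * h" using h by (simp add: algebra_simps)
  have "\<phi> ([:- q i, 1:] * h) = 0"
  proof (cases "h = 0")
    case True
    then show ?thesis by (simp add: zero)
  next
    case False
    define m' where "m' = m(i := m i - 1)"
    have "(\<Sum>j<s. m j) = m i + (\<Sum>j\<in>{..<s} - {i}. m j)" "(\<Sum>j<s. m' j) = m' i + (\<Sum>j\<in>{..<s} - {i}. m' j)"
      using i(1) by (auto intro: sum.remove)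
    moreover have "(\<Sum>j\<in>{..<s} - {i}. m' j) = (\<Sum>j\<in>{..<s} - {i}. m j)" by (auto simp: m'_def intro: sum.cong)
    ultimately have N': "N = (\<Sum>j<s. m' j)" using Suc.hyps(2) i(2) by (simp add: m'_def)
    have "degree (g - Polynomial.smult c U) \<le> N"
      using Suc.prems(4) Suc.hyps(2) dU
      by (intro degree_diff_le) (auto intro: order_trans[OF degree_smult_le])
    moreover have "degree ([:- q i, 1:] * h) = Suc (degree h)" using False by (subst degree_mult_eq) auto
    ultimately have dh: "degree h < (\<Sum>j<s. m' j)" using h N' by simp
    have root: "root_poly s q m = [:- q i, 1:] * root_poly s q m'"
    proof -
      have "root_poly s q m = [:- q i, 1:] ^ m i * (\<Prod>j\<in>{..<s} - {i}. [:- q j, 1:] ^ m j)"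
        "root_poly s q m' = [:- q i, 1:] ^ m' i * (\<Prod>j\<in>{..<s} - {i}. [:- q j, 1:] ^ m' j)"
        unfolding root_poly_def using i(1) by (auto intro: prod.remove)
      moreover have "(\<Prod>j\<in>{..<s} - {i}. [:- q j, 1:] ^ m' j) = (\<Prod>j\<in>{..<s} - {i}. [:- q j, 1:] ^ m j)"
        by (auto simp: m'_def intro: prod.cong)
      moreover have "[:- q i, 1:] ^ m i = [:- q i, 1:] * [:- q i, 1:] ^ m' i"
        using i(2) by (simp add: m'_def power_Suc[symmetric] del: power_Suc)
      ultimately show ?thesis by (simp only: mult.assoc)
    qed
    show ?thesis
    proof (rule Suc.hyps(1)[OF N', of "\<lambda>p. \<phi> ([:- q i, 1:] * p)", OF _ _ _ dh])
      show "\<phi> ([:- q i, 1:] * (p + r)) = \<phi> ([:- q i, 1:] * p) + \<phi> ([:- q i, 1:] * r)" for p r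
        by (simp only: distrib_left add)
      show "\<phi> ([:- q i, 1:] * Polynomial.smult c p) = c * \<phi> ([:- q i, 1:] * p)" for c p
        by (simp only: mult_smult_right smult)
      fix j l assume jl: "j < s" "l < m' j"
      then have "l < m j" by (auto simp: m'_def split: if_splits)
      then have "[:- q j, 1:] ^ Suc l * part_frac s q m j l = [:- q j, 1:] ^ Suc l * ([:- q i, 1:] * part_frac s q m' j l)"
        unfolding part_frac_times[where m = m and i = j and l = l, OF jl(1) \<open>l < m j\<close>] root
          part_frac_times[where m = m' and i = j and l = l and q = q, OF jl, symmetric]
        by (simp only: mult.left_commute)
      then have "[:- q i, 1:] * part_frac s q m' j l = part_frac s q m j l" by (simp del: power_Suc)
      then show "\<phi> ([:- q i, 1:] * part_frac s q m' j l) = 0" using pf0[OF jl(1) \<open>l < m j\<close>] by simp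
    qed
  qed
  moreover have "\<phi> U = 0" using pf0[OF i(1), of "m i - 1"] i(2) by (simp add: U_def)
  ultimately show ?case unfolding gh add smult by simp
qed

section \<open>Taylor coefficients of polynomials\<close>

definition taylor_coeff :: "complex \<Rightarrow> nat \<Rightarrow> complex poly \<Rightarrow> complex" where
  "taylor_coeff a k p = poly ((pderiv ^^ k) p) a / fact k"

lemma higher_pderiv_linear_times:
  fixes p :: "complex poly"
  shows "(pderiv ^^ Suc k) ([:- a, 1:] * p) =
    [:- a, 1:] * (pderiv ^^ Suc k) p + Polynomial.smult (of_nat (Suc k)) ((pderiv ^^ k) p)"
proof (induction k)
  case 0
  have "pderiv ([:- a, 1:] * p) = [:- a, 1:] * pderiv p + p * pderiv [:- a, 1:]" by (rule pderiv_mult)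
  then show ?case by (simp add: pderiv_pCons del: mult_pCons_left)
next
  case (Suc k)
  have "(pderiv ^^ Suc (Suc k)) ([:- a, 1:] * p) = pderiv ((pderiv ^^ Suc k) ([:- a, 1:] * p))" by simp
  also have "\<dots> = pderiv ([:- a, 1:] * (pderiv ^^ Suc k) p + Polynomial.smult (of_nat (Suc k)) ((pderiv ^^ k) p))"
    unfolding Suc.IH ..
  also have "\<dots> = [:- a, 1:] * (pderiv ^^ Suc (Suc k)) p + (pderiv ^^ Suc k) p * pderiv [:- a, 1:]
      + Polynomial.smult (of_nat (Suc k)) ((pderiv ^^ Suc k) p)"
    unfolding pderiv_add pderiv_mult pderiv_smult by simp
  also have "pderiv [:- a, 1:] = 1" by (simp add: pderiv_pCons)
  finally show ?case by (simp only: of_nat_Suc smult_add_left smult_1_left mult_1_right add_ac)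
qed

lemma taylor_coeff_linear_times: "taylor_coeff a (Suc k) ([:- a, 1:] * p) = taylor_coeff a k p"
  unfolding taylor_coeff_def higher_pderiv_linear_times by (simp add: field_simps del: of_nat_Suc)

lemma taylor_coeff_power_times: "taylor_coeff a (k + r) ([:- a, 1:] ^ r * p) = taylor_coeff a k p"
proof (induction r)
  case (Suc r)
  have "taylor_coeff a (k + Suc r) ([:- a, 1:] ^ Suc r * p) =
      taylor_coeff a (Suc (k + r)) ([:- a, 1:] * ([:- a, 1:] ^ r * p))"
    by (simp only: power_Suc mult.assoc add_Suc_right)
  then show ?case unfolding taylor_coeff_linear_times Suc .
qed simp

lemma taylor_coeff_vanish: "[:- a, 1:] ^ k dvd p \<Longrightarrow> l < k \<Longrightarrow> taylor_coeff a l p = 0"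
  unfolding taylor_coeff_def by (simp add: higher_pderiv_root)

lemma taylor_coeff_add: "taylor_coeff a k (p + r) = taylor_coeff a k p + taylor_coeff a k r"
  unfolding taylor_coeff_def by (simp add: higher_pderiv_add add_divide_distrib)

lemma taylor_coeff_smult: "taylor_coeff a k (Polynomial.smult c p) = c * taylor_coeff a k p"
  unfolding taylor_coeff_def by (simp add: higher_pderiv_smult)

lemma root_poly_dvd: "i < s \<Longrightarrow> [:- q i, 1:] ^ m i dvd root_poly s q m"
  unfolding root_poly_def by (intro dvd_prodI) auto

text \<open>Division by \<open>(y - q i) ^ Suc l\<close> shifts the Taylor coefficients at \<open>q i\<close>; at the other roots the quotient
still vanishes to the full order.\<close>

lemma taylor_coeff_part_frac:
  assumes "i < s" "l < m i" "j < s" "k < m j"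
  shows "taylor_coeff (q j) k (part_frac s q m i l) =
    (if j = i then taylor_coeff (q i) (k + l + 1) (root_poly s q m) else 0)"
proof (cases "j = i")
  case True
  have "taylor_coeff (q i) (k + Suc l) (root_poly s q m) = taylor_coeff (q i) k (part_frac s q m i l)"
    unfolding part_frac_times[where i = i and m = m and l = l, OF assms(1,2), symmetric] by (rule taylor_coeff_power_times)
  then show ?thesis using True by simp
next
  case False
  have "[:- q j, 1:] ^ m j dvd part_frac s q m i l"
    unfolding part_frac_def using False assms(3) by (intro dvd_mult dvd_prodI) auto
  then show ?thesis using False assms(4) by (simp add: taylor_coeff_vanish)
qed

text \<open>The polynomial \<open>synthetic_div p y\<close> is the divided difference \<open>(p(x) - p(y))/(x - y)\<close>. A factor \<open>x - a\<close> of \<open>p\<close> can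
be pulled out of it up to an additive constant, and pulling out a factor lowers the index of the Taylor
coefficient by one; at index zero the constant \<open>g(y)\<close> remains. Dividing nowhere by \<open>y - a\<close> includes the
case \<open>y = a\<close>.\<close>

lemma taylor_coeff_synthetic_div:
  "taylor_coeff a l (synthetic_div ([:- a, 1:] ^ Suc l * g) y) = poly g y"
proof -
  have step: "synthetic_div ([:- a, 1:] * p) y = [:- a, 1:] * synthetic_div p y + [:poly p y:]" for p
  proof -
    have "[:- y, 1:] * synthetic_div ([:- a, 1:] * p) y + [:poly ([:- a, 1:] * p) y:] = [:- a, 1:] * p"
      by (rule synthetic_div_correct')
    also have "\<dots> = [:- a, 1:] * ([:- y, 1:] * synthetic_div p y + [:poly p y:])"
      by (simp only: synthetic_div_correct')
    also have "\<dots> = [:- y, 1:] * ([:- a, 1:] * synthetic_div p y + [:poly p y:]) + [:poly ([:- a, 1:] * p) y:]"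
      by (simp add: algebra_simps)
    finally have "[:- y, 1:] * synthetic_div ([:- a, 1:] * p) y =
        [:- y, 1:] * ([:- a, 1:] * synthetic_div p y + [:poly p y:])"
      by (simp only: add_right_cancel)
    then show ?thesis by (subst (asm) mult_left_cancel) auto
  qed
  show ?thesis
  proof (induction l)
    case 0
    show ?case by (simp only: power_Suc power_0 mult_1_right step) (simp add: taylor_coeff_def)
  next
    case (Suc l)
    have "taylor_coeff a (Suc l) [:c:] = 0" for c
      by (induction l) (auto simp: taylor_coeff_def pderiv_pCons funpow_swap1)
    moreover have "[:- a, 1:] ^ Suc (Suc l) * g = [:- a, 1:] * ([:- a, 1:] ^ Suc l * g)"
      by (simp only: power_Suc mult.assoc)
    ultimately show ?case
      by (simp only: step taylor_coeff_add taylor_coeff_linear_times Suc.IH add_0_right)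
  qed
qed

section \<open>Enumerating the roots with multiplicity\<close>

definition jet_index :: "nat \<Rightarrow> (nat \<Rightarrow> nat) \<Rightarrow> (nat \<times> nat) list" where
  "jet_index s m = concat (map (\<lambda>i. map (Pair i) [0..<m i]) [0..<s])"

lemma jet_index_Suc: "jet_index (Suc s) m = jet_index s m @ map (Pair s) [0..<m s]"
  by (simp add: jet_index_def)

lemma set_jet_index: "set (jet_index s m) = root_indices s m"
  by (auto simp: jet_index_def root_indices_def)

lemma length_jet_index: "length (jet_index s m) = (\<Sum>i<s. m i)"
  by (induction s) (auto simp: jet_index_Suc, simp add: jet_index_def)

lemma jet_index_sorted:
  "sorted_wrt (\<lambda>x y. fst x < fst y \<or> fst x = fst y \<and> snd x < snd y) (jet_index s m)"
proof (induction s)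
  case 0
  then show ?case by (simp add: jet_index_def)
next
  case (Suc s)
  then show ?case
    by (auto simp: jet_index_Suc sorted_wrt_append sorted_wrt_map set_jet_index root_indices_def)
qed

lemma distinct_jet_index: "distinct (jet_index s m)"
  using jet_index_sorted[of s m] unfolding distinct_conv_nth sorted_wrt_iff_nth_less
  by (metis less_irrefl linorder_neqE_nat)

lemma jet_index_nth:
  assumes "a < (\<Sum>i<s. m i)"
  shows "fst (jet_index s m ! a) < s" "snd (jet_index s m ! a) < m (fst (jet_index s m ! a))"
proof -
  have "jet_index s m ! a \<in> root_indices s m"
    using nth_mem[of a "jet_index s m"] assms by (simp add: length_jet_index set_jet_index)
  then show "fst (jet_index s m ! a) < s" "snd (jet_index s m ! a) < m (fst (jet_index s m ! a))"
    by (auto simp: root_indices_def)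
qed

lemma jet_eq:
  "jet s q m f = vec_of_list (map (\<lambda>x. (deriv ^^ snd x) f (q (fst x)) / fact (snd x)) (jet_index s m))"
  unfolding jet_def jet_index_def map_concat by (simp add: comp_def)

lemma dim_jet: "dim_vec (jet s q m f) = (\<Sum>i<s. m i)"
  by (simp add: jet_eq length_jet_index)

lemma jet_nth:
  assumes "b < (\<Sum>i<s. m i)"
  shows "vec_index (jet s q m f) b =
    (deriv ^^ snd (jet_index s m ! b)) f (q (fst (jet_index s m ! b))) / fact (snd (jet_index s m ! b))"
  using assms by (simp add: jet_eq vec_of_list_index length_jet_index)

text \<open>The order of the functionals is that of the jets, with the indices at each root reversed: this turns
the Hankel blocks of the connection matrix, which vanish above the antidiagonal, into upper
triangular ones.\<close>

definition xi_enum :: "nat \<Rightarrow> (nat \<Rightarrow> nat) \<Rightarrow> nat \<Rightarrow> nat \<times> nat" where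
  "xi_enum s m a = (let x = jet_index s m ! a in (fst x, m (fst x) - Suc (snd x)))"

lemma bij_xi_enum: "bij_betw (xi_enum s m) {..<\<Sum>i<s. m i} (root_indices s m)"
proof -
  have 1: "bij_betw ((!) (jet_index s m)) {..<\<Sum>i<s. m i} (root_indices s m)"
    using bij_betw_nth[OF distinct_jet_index refl refl, of s m]
    by (simp add: length_jet_index set_jet_index)
  have 2: "bij_betw (\<lambda>x. (fst x, m (fst x) - Suc (snd x))) (root_indices s m) (root_indices s m)"
    by (rule bij_betw_byWitness[of _ "\<lambda>x. (fst x, m (fst x) - Suc (snd x))"])
      (auto simp: root_indices_def)
  show ?thesis using bij_betw_trans[OF 1 2] by (simp add: comp_def xi_enum_def Let_def cong: bij_betw_cong)
qed

text \<open>The block of the root \<open>q i\<close> has the Taylor coefficients of the \<open>f\<^sub>i\<^sub>l\<close> at \<open>q i\<close> as columns.\<close>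

definition conn_matrix :: "nat \<Rightarrow> (nat \<Rightarrow> complex) \<Rightarrow> (nat \<Rightarrow> nat) \<Rightarrow> complex Matrix.mat" where
  "conn_matrix s q m = Matrix.mat (\<Sum>i<s. m i) (\<Sum>i<s. m i) (\<lambda>(a, b).
     let x = xi_enum s m a; y = jet_index s m ! b
     in if fst x = fst y then taylor_coeff (q (fst y)) (snd x + snd y + 1) (root_poly s q m) else 0)"

lemma conn_matrix_carrier: "conn_matrix s q m \<in> carrier_mat (\<Sum>i<s. m i) (\<Sum>i<s. m i)"
  by (simp add: conn_matrix_def)

lemma conn_matrix_nth:
  assumes "a < (\<Sum>i<s. m i)" "b < (\<Sum>i<s. m i)"
  shows "conn_matrix s q m $$ (a, b) =
    (if fst (xi_enum s m a) = fst (jet_index s m ! b)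
     then taylor_coeff (q (fst (jet_index s m ! b))) (snd (xi_enum s m a) + snd (jet_index s m ! b) + 1) (root_poly s q m)
     else 0)"
  using assms by (simp add: conn_matrix_def Let_def)

lemma conn_matrix_upper_triangular: "upper_triangular (conn_matrix s q m)"
proof (rule upper_triangularI)
  let ?x = "\<lambda>a. jet_index s m ! a"
  fix a b assume ba: "b < a" and a: "a < dim_row (conn_matrix s q m)"
  then have a: "a < (\<Sum>i<s. m i)" by (simp add: conn_matrix_def)
  then have b: "b < (\<Sum>i<s. m i)" using ba by simp
  show "conn_matrix s q m $$ (a, b) = 0"
  proof (cases "fst (?x a) = fst (?x b)")
    case True
    then have "snd (?x b) < snd (?x a)"
      using jet_index_sorted[of s m] ba a unfolding sorted_wrt_iff_nth_less length_jet_index by fastforce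
    moreover have "snd (?x a) < m (fst (?x a))" by (rule jet_index_nth(2)[OF a])
    ultimately have "m (fst (?x b)) - Suc (snd (?x a)) + snd (?x b) + 1 < m (fst (?x b))"
      using True by simp
    then have "taylor_coeff (q (fst (?x b))) (m (fst (?x b)) - Suc (snd (?x a)) + snd (?x b) + 1) (root_poly s q m) = 0"
      by (rule taylor_coeff_vanish[OF root_poly_dvd[OF jet_index_nth(1)[OF b]]])
    then show ?thesis using True by (simp add: conn_matrix_nth[OF a b] xi_enum_def Let_def)
  next
    case False
    then show ?thesis by (simp add: conn_matrix_nth[OF a b] xi_enum_def Let_def)
  qed
qed

lemma dim_xi_row: "dim_vec (xi_row e \<xi> (conn_matrix s q m) P) = (\<Sum>i<s. m i)"
  by (simp add: xi_row_def conn_matrix_def)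

lemma xi_row_nth:
  assumes b: "b < (\<Sum>i<s. m i)" and x: "jet_index s m ! b = (i, l)"
  shows "vec_index (xi_row (xi_enum s m) \<xi> (conn_matrix s q m) P) b =
    (\<Sum>k<m i. taylor_coeff (q i) (k + l + 1) (root_poly s q m) * \<xi> i k P)"
proof -
  let ?N = "\<Sum>i<s. m i" and ?W = "root_poly s q m"
  define F where "F z = (if fst z = i then taylor_coeff (q i) (snd z + l + 1) ?W * \<xi> (fst z) (snd z) P else 0)"
    for z :: "nat \<times> nat"
  have i: "i < s" using jet_index_nth(1)[OF b] x by simp
  have "vec_index (xi_row (xi_enum s m) \<xi> (conn_matrix s q m) P) b =
      (\<Sum>a<?N. conn_matrix s q m $$ (a, b) * \<xi> (fst (xi_enum s m a)) (snd (xi_enum s m a)) P)"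
    using b conn_matrix_carrier[of s q m]
    by (simp add: xi_row_def scalar_prod_def lessThan_atLeast0)
  also have "\<dots> = (\<Sum>a<?N. F (xi_enum s m a))"
    using b x by (intro sum.cong) (auto simp: conn_matrix_nth F_def)
  also have "\<dots> = (\<Sum>z\<in>root_indices s m. F z)"
    by (rule sum.reindex_bij_betw[OF bij_xi_enum])
  also have "\<dots> = (\<Sum>j<s. \<Sum>k<m j. F (j, k))"
    unfolding root_indices_def by (simp add: sum.Sigma)
  also have "\<dots> = (\<Sum>j<s. if j = i then \<Sum>k<m i. taylor_coeff (q i) (k + l + 1) ?W * \<xi> i k P else 0)"
    by (intro sum.cong) (auto simp: F_def)
  also have "\<dots> = (\<Sum>k<m i. taylor_coeff (q i) (k + l + 1) ?W * \<xi> i k P)" using i by simp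
  finally show ?thesis .
qed

section \<open>The rows of the quasi-determinants\<close>

text \<open>Each \<open>complete_sym (k - 1)\<close> is the divided difference of the power \<open>x ^ k\<close>.\<close>

lemma divided_difference:
  assumes "degree W \<le> N"
  shows "(\<Sum>k=1..N. coeff W k * complete_sym (k - 1) x y) = poly (synthetic_div W y) x"
proof -
  define S where "S = (\<Sum>k=1..N. Polynomial.smult (coeff W k) (\<Sum>j\<le>k - 1. Polynomial.monom (y ^ (k - 1 - j)) j))"
  have S: "poly S z = (\<Sum>k=1..N. coeff W k * complete_sym (k - 1) z y)" for z
    by (simp add: S_def complete_sym_def poly_sum poly_monom mult.commute)
  have W: "poly W z = coeff W 0 + (\<Sum>k=1..N. coeff W k * z ^ k)" for z
  proof -
    have "poly W z = (\<Sum>k\<le>N. coeff W k * z ^ k)"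
      unfolding poly_altdef using assms by (intro sum.mono_neutral_left) (auto simp: coeff_eq_0)
    also have "{..N} = insert 0 {1..N}" by auto
    finally show ?thesis by simp
  qed
  have sym: "(z - y) * complete_sym (k - 1) z y = z ^ k - y ^ k" if k1: "1 \<le> k" for z k
  proof -
    obtain k' where k: "k = Suc k'" using k1 by (cases k) auto
    show ?thesis unfolding k complete_sym_def diff_power_eq_sum by (simp add: lessThan_Suc_atMost)
  qed
  have "poly ([:- y, 1:] * S + [:poly W y:]) z = poly W z" for z
  proof -
    have "(z - y) * poly S z = (\<Sum>k=1..N. coeff W k * ((z - y) * complete_sym (k - 1) z y))"
      unfolding S sum_distrib_left by (simp only: mult.left_commute)
    also have "\<dots> = (\<Sum>k=1..N. coeff W k * (z ^ k - y ^ k))" by (intro sum.cong refl) (simp only: sym atLeastAtMost_iff)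
    also have "\<dots> = poly W z - poly W y" unfolding W by (simp add: right_diff_distrib sum_subtractf)
    finally show ?thesis by (simp add: algebra_simps)
  qed
  then have "[:- y, 1:] * S + [:poly W y:] = W" by (simp add: poly_eq_poly_eq_iff[symmetric] fun_eq_iff del: mult_pCons_left)
  then have "[:- y, 1:] * S = [:- y, 1:] * synthetic_div W y"
    using synthetic_div_correct'[of y W] by (metis add_right_cancel)
  then have "S = synthetic_div W y" by (subst (asm) mult_left_cancel) auto
  then show ?thesis using S by simp
qed

lemma poly_add_fun: "poly (g + h) = (\<lambda>y. poly g y + poly h y)"
  and poly_smult_fun: "poly (Polynomial.smult c g) = (\<lambda>y. c * poly g y)" for g h :: "complex poly"
  by (auto simp: fun_eq_iff)

lemma kernel_polynomial_form:
  assumes gk: "generalized_kernel u"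
  shows "polynomial_form (kernel_form u)"
  by unfold_locales (simp_all only: poly_add_fun poly_smult_fun kernel_form_add_left[OF gk admissible_poly[OF gk]]
      kernel_form_smult_left[OF gk admissible_poly[OF gk]] kernel_form_add_right[OF gk admissible_poly[OF gk] admissible_poly[OF gk]]
      kernel_form_cmult_right[OF gk admissible_poly[OF gk]])

lemma CD_mixed_cauchy:
  assumes gk: "generalized_kernel u" and z: "z \<notin> complex_of_real ` supp_y u"
  shows "CD_mixed (kernel_form u) n z y = kernel_form u (CD_kernel (kernel_form u) n y) (\<lambda>y. 1 / (z - y))"
  unfolding CD_mixed_def CD_kernel_def second_kind1_def
  by (induction n) (simp_all add: kernel_form_add_left[OF gk admissible_recip[OF gk z]]
      kernel_form_smult_left[OF gk admissible_recip[OF gk z]])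

context
  fixes u :: "(real \<times> real \<Rightarrow> complex) \<Rightarrow> complex" and s :: nat and q :: "nat \<Rightarrow> complex"
    and m :: "nat \<Rightarrow> nat" and \<xi> :: "nat \<Rightarrow> nat \<Rightarrow> complex poly \<Rightarrow> complex"
  assumes gk: "generalized_kernel u"
    and q: "\<And>i. i < s \<Longrightarrow> q i \<notin> complex_of_real ` supp_y u"
    and \<xi>: "\<And>i l. i < s \<Longrightarrow> l < m i \<Longrightarrow> Vector_Spaces.linear Polynomial.smult (*) (\<xi> i l)"
begin

lemma xi_add: "i < s \<Longrightarrow> l < m i \<Longrightarrow> \<xi> i l (P + Q) = \<xi> i l P + \<xi> i l Q"
  and xi_smult: "i < s \<Longrightarrow> l < m i \<Longrightarrow> \<xi> i l (Polynomial.smult c P) = c * \<xi> i l P"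
  using \<xi>[of i l] unfolding Vector_Spaces.linear_def module_hom_def module_hom_axioms_def by blast+

lemma admissible_poly_quotient: "admissible u (\<lambda>y. poly g y / poly (root_poly s q m) y)"
proof -
  have "admissible u (\<lambda>y. poly g y * (\<Prod>j<s. (- 1 * (1 / (q j - y))) ^ m j))"
    by (intro admissible_mult admissible_poly admissible_prod admissible_power admissible_cmult admissible_recip gk q) auto
  also have "(\<lambda>y. poly g y * (\<Prod>j<s. (- 1 * (1 / (q j - y))) ^ m j)) = (\<lambda>y. poly g y / poly (root_poly s q m) y)"
  proof
    fix y
    have "(\<Prod>j<s. (- 1 * (1 / (q j - y))) ^ m j) = (\<Prod>j<s. 1 / (y - q j) ^ m j)"
      by (intro prod.cong refl) (simp add: power_one_over[symmetric] minus_divide_right)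
    also have "\<dots> = 1 / poly (root_poly s q m) y"
      by (simp add: root_poly_def poly_prod poly_power prod_dividef)
    finally show "poly g y * (\<Prod>j<s. (- 1 * (1 / (q j - y))) ^ m j) = poly g y / poly (root_poly s q m) y" by simp
  qed
  finally show ?thesis .
qed

lemma geronimus_form_poly:
  "geronimus_form u s q m \<xi> P (poly g) = kernel_form u P (\<lambda>y. poly g y / poly (root_poly s q m) y) +
     (\<Sum>i<s. \<Sum>l<m i. \<xi> i l P * taylor_coeff (q i) l g)"
  unfolding geronimus_form_def higher_deriv_poly taylor_coeff_def ..

lemma geronimus_polynomial_form: "polynomial_form (geronimus_form u s q m \<xi>)"
proof
  note adm = admissible_poly_quotient
  fix P Q g h :: "complex poly" and c :: complex
  show "geronimus_form u s q m \<xi> (P + Q) (poly g) = geronimus_form u s q m \<xi> P (poly g) + geronimus_form u s q m \<xi> Q (poly g)"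
    unfolding geronimus_form_poly kernel_form_add_left[OF gk adm]
    by (simp add: xi_add distrib_right sum.distrib)
  show "geronimus_form u s q m \<xi> (Polynomial.smult c P) (poly g) = c * geronimus_form u s q m \<xi> P (poly g)"
    unfolding geronimus_form_poly kernel_form_smult_left[OF gk adm]
    by (simp add: xi_smult distrib_left sum_distrib_left mult.assoc)
  show "geronimus_form u s q m \<xi> P (poly (g + h)) = geronimus_form u s q m \<xi> P (poly g) + geronimus_form u s q m \<xi> P (poly h)"
    unfolding geronimus_form_poly poly_add add_divide_distrib kernel_form_add_right[OF gk adm adm] taylor_coeff_add
    by (simp add: distrib_left sum.distrib)
  have "(\<lambda>y. poly (Polynomial.smult c g) y / poly (root_poly s q m) y) = (\<lambda>y. c * (poly g y / poly (root_poly s q m) y))"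
    by simp
  then show "geronimus_form u s q m \<xi> P (poly (Polynomial.smult c g)) = c * geronimus_form u s q m \<xi> P (poly g)"
    unfolding geronimus_form_poly taylor_coeff_smult
    by (simp only: kernel_form_cmult_right[OF gk adm]) (simp add: distrib_left sum_distrib_left mult.left_commute)
qed

text \<open>The entry of the jet is the bracket of \<open>P\<close> with \<open>- 1/(y - q i) ^ Suc l\<close>, which is minus the quotient of the
partial fraction by \<open>W\<close> near the support; the entry of the second row consists of the Taylor
coefficients of the partial fraction paired with the free functionals. Both parts together make up the
perturbed form.\<close>

lemma row_entry:
  assumes b: "b < (\<Sum>i<s. m i)" and x: "jet_index s m ! b = (i, l)"
    and f: "\<And>z. z \<notin> complex_of_real ` supp_y u \<Longrightarrow> f z = kernel_form u P (\<lambda>y. 1 / (z - y))"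
  shows "vec_index (jet s q m f - xi_row (xi_enum s m) \<xi> (conn_matrix s q m) P) b =
    - geronimus_form u s q m \<xi> P (poly (part_frac s q m i l))"
proof -
  let ?W = "root_poly s q m" and ?g = "part_frac s q m i l"
  have il: "i < s" "l < m i" using jet_index_nth[OF b] x by auto
  let ?U = "{y. \<forall>j\<in>{..<s}. complex_of_real y \<noteq> q j}"
  have U: "open ?U" "supp_y u \<subseteq> ?U"
  proof -
    have "?U = (\<Inter>j\<in>{..<s}. {y. complex_of_real y \<noteq> q j})" by auto
    moreover have "open (\<Inter>j\<in>{..<s}. {y. complex_of_real y \<noteq> q j})"
      by (intro open_INT finite_lessThan ballI open_Collect_neq continuous_intros)
    ultimately show "open ?U" by simp
    show "supp_y u \<subseteq> ?U" using q by force
  qed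
  have adm: "admissible u (\<lambda>y. (1 / (q i - y)) ^ Suc l)"
    by (intro admissible_power[OF gk] admissible_recip[OF gk] q il)
  have "kernel_form u P (\<lambda>y. poly ?g y / poly ?W y) = kernel_form u P (\<lambda>y. (- 1) ^ Suc l * (1 / (q i - y)) ^ Suc l)"
  proof (rule admissible_cong(2)[OF gk admissible_poly_quotient U])
    fix y assume y: "y \<in> ?U"
    let ?y = "complex_of_real y"
    have W: "poly ?W ?y = (?y - q i) ^ Suc l * poly ?g ?y"
      using arg_cong[OF part_frac_times[where i = i and m = m and q = q, OF il], of "\<lambda>p. poly p ?y"]
      by (simp add: poly_power del: power_Suc)
    have "poly ?W ?y \<noteq> 0" using y by (auto simp: root_poly_def poly_prod poly_power)
    then have "poly ?g ?y / poly ?W ?y = (1 / (?y - q i)) ^ Suc l"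
      unfolding W power_one_over by simp
    also have "1 / (?y - q i) = - 1 * (1 / (q i - ?y))" by (simp add: minus_divide_right)
    finally show "poly ?g ?y / poly ?W ?y = (- 1) ^ Suc l * (1 / (q i - ?y)) ^ Suc l"
      by (simp only: power_mult_distrib)
  qed
  also have "\<dots> = (- 1) ^ Suc l * kernel_form u P (\<lambda>y. (1 / (q i - y)) ^ Suc l)"
    by (rule kernel_form_cmult_right[OF gk adm])
  finally have K: "kernel_form u P (\<lambda>y. poly ?g y / poly ?W y) =
      - ((- 1) ^ l * kernel_form u P (\<lambda>y. (1 / (q i - y)) ^ Suc l))" by simp
  have J: "vec_index (jet s q m f) b = (- 1) ^ l * kernel_form u P (\<lambda>y. (1 / (q i - y)) ^ Suc l)"
    using higher_deriv_cauchy[OF gk f q[OF il(1)], where l = l] by (simp add: jet_nth[OF b] x)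
  have "(\<Sum>j<s. \<Sum>k<m j. \<xi> j k P * taylor_coeff (q j) k ?g) =
      (\<Sum>j<s. if j = i then \<Sum>k<m i. taylor_coeff (q i) (k + l + 1) ?W * \<xi> i k P else 0)"
    by (intro sum.cong refl) (auto simp: taylor_coeff_part_frac[where i = i and m = m and l = l, OF il] mult.commute intro!: sum.cong)
  also have "\<dots> = (\<Sum>k<m i. taylor_coeff (q i) (k + l + 1) ?W * \<xi> i k P)" using il by simp
  finally have X: "(\<Sum>j<s. \<Sum>k<m j. \<xi> j k P * taylor_coeff (q j) k ?g) =
      (\<Sum>k<m i. taylor_coeff (q i) (k + l + 1) ?W * \<xi> i k P)" .
  show ?thesis using b unfolding geronimus_form_poly K X
    by (simp add: dim_xi_row J xi_row_nth[OF b x])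
qed

end

theorem proposition46:
  fixes s N :: nat and q :: "nat \<Rightarrow> complex" and m :: "nat \<Rightarrow> nat" and W :: "complex poly"
  assumes W: "W = root_poly s q m"
    and distinct: "inj_on q {..<s}"
    and N: "N = (\<Sum>i<s. m i)" "N \<ge> 1"
  shows "\<exists>(\<W> :: complex Matrix.mat) (\<V> :: complex \<Rightarrow> complex \<Rightarrow> complex) (e :: nat \<Rightarrow> nat \<times> nat).
    \<W> \<in> carrier_mat N N \<and> upper_triangular \<W> \<and>
    (\<forall>a<N. \<forall>b<N. \<W> $$ (a, b) = 0 \<or>
       (\<exists>i<s. \<exists>r. \<W> $$ (a, b) = poly ((pderiv ^^ r) W) (q i) / fact r)) \<and>
    (\<forall>x y. \<V> x y = (\<Sum>k=1..N. Polynomial.coeff W k * complete_sym (k - 1) x y)) \<and>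
    bij_betw e {..<N} (root_indices s m) \<and>
    (\<forall>u \<xi> n.
       generalized_kernel u \<and> quasi_definite (kernel_form u) \<and>
       (\<forall>i<s. q i \<notin> complex_of_real ` supp_y u) \<and>
       (\<forall>i<s. \<forall>l<m i. Vector_Spaces.linear Polynomial.smult (*) (\<xi> i l)) \<and>
       quasi_definite (geronimus_form u s q m \<xi>) \<and> N \<le> n \<longrightarrow>
       (let B = kernel_form u;
            B' = geronimus_form u s q m \<xi>;
            R = (\<lambda>k. jet s q m (second_kind1 B k) - xi_row e \<xi> \<W> (biorth1 B k));
            M1 = (\<lambda>x. bordered N (\<lambda>a. R (n - N + a)) (\<lambda>a. poly (biorth1 B (n - N + a)) x));
            M2 = bordered N (\<lambda>a. R (n - N + a)) (\<lambda>a. if a = 0 then gb_norm B (n - N) else 0);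
            M3 = (\<lambda>y. bordered N
              (\<lambda>a. if a < N then R (n - N + a)
                   else smult_vec (poly W y)
                          (jet s q m (\<lambda>z. CD_mixed B (n - 1) z y)
                             - xi_row e \<xi> \<W> (CD_kernel B (n - 1) y))
                        + jet s q m (\<lambda>z. \<V> z y))
              (\<lambda>a. if a = 0 then gb_norm B (n - N) else 0))
        in (\<forall>x. last_quasidet_defined (M1 x) \<and> poly (biorth1 B' n) x = last_quasidet (M1 x)) \<and>
           last_quasidet_defined M2 \<and> gb_norm B' n = last_quasidet M2 \<and>
           (\<forall>y. last_quasidet_defined (M3 y) \<and>
                poly (biorth2 B' n) y = - last_quasidet (M3 y))))"
proof -
  let ?M = "conn_matrix s q m" and ?e = "xi_enum s m"
  define V where "V = (\<lambda>x y :: complex. \<Sum>k=1..N. Polynomial.coeff W k * complete_sym (k - 1) x y)"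
  have V: "V x y = poly (synthetic_div W y) x" for x y
    unfolding V_def by (rule divided_difference) (simp add: W N(1) degree_root_poly)
  have entries: "?M $$ (a, b) = 0 \<or> (\<exists>i<s. \<exists>r. ?M $$ (a, b) = poly ((pderiv ^^ r) W) (q i) / fact r)"
    if "a < N" "b < N" for a b
    using conn_matrix_nth[OF that[unfolded N(1)], of q] jet_index_nth(1)[OF that(2)[unfolded N(1)]]
    unfolding W taylor_coeff_def by (metis (lifting))
  show ?thesis
  proof (rule exI[of _ ?M], rule exI[of _ V], rule exI[of _ ?e], intro conjI allI impI)
    show "?M \<in> carrier_mat N N" unfolding N(1) by (rule conn_matrix_carrier)
    show "upper_triangular ?M" by (rule conn_matrix_upper_triangular)
    show "?M $$ (a, b) = 0 \<or> (\<exists>i<s. \<exists>r. ?M $$ (a, b) = poly ((pderiv ^^ r) W) (q i) / fact r)"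
      if "a < N" "b < N" for a b using entries that .
    show "V x y = (\<Sum>k=1..N. Polynomial.coeff W k * complete_sym (k - 1) x y)" for x y
      by (simp add: V_def)
    show "bij_betw ?e {..<N} (root_indices s m)" unfolding N(1) by (rule bij_xi_enum)
    fix u :: "(real \<times> real \<Rightarrow> complex) \<Rightarrow> complex" and \<xi> :: "nat \<Rightarrow> nat \<Rightarrow> complex poly \<Rightarrow> complex"
      and n :: nat
    assume A: "generalized_kernel u \<and> quasi_definite (kernel_form u) \<and>
       (\<forall>i<s. q i \<notin> complex_of_real ` supp_y u) \<and>
       (\<forall>i<s. \<forall>l<m i. Vector_Spaces.linear Polynomial.smult (*) (\<xi> i l)) \<and>
       quasi_definite (geronimus_form u s q m \<xi>) \<and> N \<le> n"
    then have gk: "generalized_kernel u" and q: "\<And>i. i < s \<Longrightarrow> q i \<notin> complex_of_real ` supp_y u"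
      and \<xi>: "\<And>i l. i < s \<Longrightarrow> l < m i \<Longrightarrow> Vector_Spaces.linear Polynomial.smult (*) (\<xi> i l)"
      and n: "N \<le> n" by auto
    let ?B = "kernel_form u" and ?B' = "geronimus_form u s q m \<xi>"
    define f where "f b = part_frac s q m (fst (jet_index s m ! b)) (snd (jet_index s m ! b))" for b
    interpret geronimus_pair ?B ?B' W N f
    proof (intro geronimus_pair.intro quasi_definite_form.intro quasi_definite_form_axioms.intro geronimus_pair_axioms.intro)
      show "polynomial_form ?B" by (rule kernel_polynomial_form[OF gk])
      show "polynomial_form ?B'" by (rule geronimus_polynomial_form[OF gk q \<xi>])
      show "quasi_definite ?B" "quasi_definite ?B'" using A by auto
      show "degree W = N" "coeff W N = 1" unfolding W N(1) by (rule degree_root_poly, rule lead_root_poly)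
      show "1 \<le> N" by (rule N(2))
      show "?B' P (poly (W * g)) = ?B P (poly g)" for P g
        unfolding W by (rule geronimus_form_times_root_poly[OF q])
      show "degree (f b) < N" if "b < N" for b
        using degree_part_frac[where m = m and q = q, OF jet_index_nth[of b m s]] that unfolding f_def N(1) by simp
      fix \<phi> :: "complex poly \<Rightarrow> complex" and g :: "complex poly"
      assume \<phi>: "\<And>p r. \<phi> (p + r) = \<phi> p + \<phi> r" "\<And>c p. \<phi> (Polynomial.smult c p) = c * \<phi> p"
        "\<And>b. b < N \<Longrightarrow> \<phi> (f b) = 0" and g: "degree g < N"
      show "\<phi> g = 0"
      proof (rule part_frac_spanning[OF distinct \<phi>(1,2)])
        show "degree g < (\<Sum>i<s. m i)" using g unfolding N(1) .
        fix i l assume "i < s" "l < m i"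
        then have "(i, l) \<in> set (jet_index s m)" by (simp add: set_jet_index root_indices_def)
        then obtain b where "b < N" "jet_index s m ! b = (i, l)"
          unfolding N(1) in_set_conv_nth length_jet_index by blast
        then show "\<phi> (part_frac s q m i l) = 0" using \<phi>(3)[of b] by (simp add: f_def)
      qed
    qed
    define R where "R = (\<lambda>k. jet s q m (second_kind1 ?B k) - xi_row ?e \<xi> ?M (biorth1 ?B k))"
    have R: "vec_index (R k) b = - ?B' (biorth1 ?B k) (poly (f b))" if "b < N" for k b
      unfolding R_def f_def using that unfolding N(1)
      by (intro row_entry[OF gk q \<xi>]) (simp_all add: second_kind1_def)
    define c2 where "c2 = (\<lambda>a :: nat. if a = 0 then gb_norm ?B (n - N) else 0)"
    define R3 where "R3 y a = (if a < N then R (n - N + a)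
                   else smult_vec (poly W y)
                          (jet s q m (\<lambda>z. CD_mixed ?B (n - 1) z y)
                             - xi_row ?e \<xi> ?M (CD_kernel ?B (n - 1) y))
                        + jet s q m (\<lambda>z. V z y))" for y a
    have R3: "vec_index (R3 y N) b = poly (f b) y - poly W y * ?B' (CD_kernel ?B (n - 1) y) (poly (f b))"
      if "b < N" for y b
    proof -
      obtain i l where x: "jet_index s m ! b = (i, l)" by (cases "jet_index s m ! b")
      have b: "b < (\<Sum>i<s. m i)" using that unfolding N(1) .
      have il: "i < s" "l < m i" using jet_index_nth[OF b] x by auto
      have 1: "vec_index (jet s q m (\<lambda>z. CD_mixed ?B (n - 1) z y) - xi_row ?e \<xi> ?M (CD_kernel ?B (n - 1) y)) b =
          - ?B' (CD_kernel ?B (n - 1) y) (poly (f b))"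
        unfolding f_def x fst_conv snd_conv
        by (rule row_entry[OF gk q \<xi> b x]) (auto intro: CD_mixed_cauchy[OF gk])
      have "vec_index (jet s q m (\<lambda>z. V z y)) b = taylor_coeff (q i) l (synthetic_div W y)"
        unfolding V jet_nth[OF b] x fst_conv snd_conv higher_deriv_poly taylor_coeff_def ..
      also have "\<dots> = poly (f b) y"
        unfolding W part_frac_times[where i = i and m = m and q = q, OF il, symmetric]
        by (simp only: taylor_coeff_synthetic_div f_def x fst_conv snd_conv)
      finally have 2: "vec_index (jet s q m (\<lambda>z. V z y)) b = poly (f b) y" .
      show ?thesis unfolding R3_def using 1 2 b by (simp add: dim_jet dim_xi_row del: index_minus_vec(1))
    qed
    have indep: "\<forall>v. (\<forall>b<N. (\<Sum>a<N. v a * vec_index (R (n - N + a)) b) = 0) \<longrightarrow> (\<forall>a<N. v a = 0)"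
    proof (intro allI impI)
      fix v :: "nat \<Rightarrow> complex" and a
      assume v: "\<forall>b<N. (\<Sum>a<N. v a * vec_index (R (n - N + a)) b) = 0" and a: "a < N"
      show "v a = 0"
        by (rule rows_independent[OF n _ a]) (use v in \<open>simp add: R sum_negf\<close>)
    qed
    obtain t where t: "biorth1 ?B' n = biorth1 ?B n - (\<Sum>a<N. Polynomial.smult (t a) (biorth1 ?B (n - N + a)))"
      "gb_norm ?B' n = - (t 0 * gb_norm ?B (n - N))"
      "\<And>b. b < N \<Longrightarrow> (\<Sum>a<N. t a * ?B' (biorth1 ?B (n - N + a)) (poly (f b))) = ?B' (biorth1 ?B n) (poly (f b))"
      using perturbed_P1[OF n] by blast
    have tR: "\<forall>b<N. (\<Sum>a<N. t a * vec_index (R (n - N + a)) b) = vec_index (R (n - N + N)) b"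
      using t(3) n by (simp add: R sum_negf)
    note Q = last_quasidet_bordered[where r = "\<lambda>a. R (n - N + a)" and N = N and t = t, OF indep tR]
    have c2: "(\<Sum>a<N. t a * c2 a) = t 0 * gb_norm ?B (n - N)" "c2 N = 0" for t :: "nat \<Rightarrow> complex"
    proof -
      have "(\<Sum>a<N. t a * c2 a) = (\<Sum>a<N. if a = 0 then t 0 * gb_norm ?B (n - N) else 0)"
        by (intro sum.cong) (auto simp: c2_def)
      then show "(\<Sum>a<N. t a * c2 a) = t 0 * gb_norm ?B (n - N)" using N(2) by simp
      show "c2 N = 0" using N(2) by (simp add: c2_def)
    qed
    have M1: "last_quasidet_defined (bordered N (\<lambda>a. R (n - N + a)) (\<lambda>a. poly (biorth1 ?B (n - N + a)) x))"
      "poly (biorth1 ?B' n) x = last_quasidet (bordered N (\<lambda>a. R (n - N + a)) (\<lambda>a. poly (biorth1 ?B (n - N + a)) x))" for x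
    proof -
      show "last_quasidet_defined (bordered N (\<lambda>a. R (n - N + a)) (\<lambda>a. poly (biorth1 ?B (n - N + a)) x))"
        by (rule Q(1))
      show "poly (biorth1 ?B' n) x = last_quasidet (bordered N (\<lambda>a. R (n - N + a)) (\<lambda>a. poly (biorth1 ?B (n - N + a)) x))"
        unfolding Q(2) t(1) using n by (simp add: poly_sum)
    qed
    have M2: "last_quasidet_defined (bordered N (\<lambda>a. R (n - N + a)) c2)"
      "gb_norm ?B' n = last_quasidet (bordered N (\<lambda>a. R (n - N + a)) c2)"
    proof -
      show "last_quasidet_defined (bordered N (\<lambda>a. R (n - N + a)) c2)" by (rule Q(1))
      show "gb_norm ?B' n = last_quasidet (bordered N (\<lambda>a. R (n - N + a)) c2)"
        unfolding Q(2) t(2) by (simp add: c2)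
    qed
    have M3: "last_quasidet_defined (bordered N (R3 y) c2)"
      "poly (biorth2 ?B' n) y = - last_quasidet (bordered N (R3 y) c2)" for y
    proof -
      obtain d where d: "poly (biorth2 ?B' n) y = d 0 * gb_norm ?B (n - N)"
        "\<And>b. b < N \<Longrightarrow> (\<Sum>a<N. d a * ?B' (biorth1 ?B (n - N + a)) (poly (f b))) =
           poly W y * ?B' (CD_kernel ?B (n - 1) y) (poly (f b)) - poly (f b) y"
        using perturbed_P2[OF n] by blast
      have R3R: "R3 y a = R (n - N + a)" if "a < N" for a using that by (simp add: R3_def)
      have indep3: "\<forall>v. (\<forall>b<N. (\<Sum>a<N. v a * vec_index (R3 y a) b) = 0) \<longrightarrow> (\<forall>a<N. v a = 0)"
        using indep by (simp add: R3R)
      have dR: "\<forall>b<N. (\<Sum>a<N. d a * vec_index (R3 y a) b) = vec_index (R3 y N) b"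
        using d(2) by (simp add: R3R R3 R sum_negf)
      note Q3 = last_quasidet_bordered[where r = "R3 y" and N = N and t = d, OF indep3 dR]
      show "last_quasidet_defined (bordered N (R3 y) c2)" by (rule Q3(1))
      show "poly (biorth2 ?B' n) y = - last_quasidet (bordered N (R3 y) c2)"
        unfolding Q3(2) d(1) by (simp add: c2)
    qed
    show "let B = kernel_form u;
            B' = geronimus_form u s q m \<xi>;
            R = (\<lambda>k. jet s q m (second_kind1 B k) - xi_row ?e \<xi> ?M (biorth1 B k));
            M1 = (\<lambda>x. bordered N (\<lambda>a. R (n - N + a)) (\<lambda>a. poly (biorth1 B (n - N + a)) x));
            M2 = bordered N (\<lambda>a. R (n - N + a)) (\<lambda>a. if a = 0 then gb_norm B (n - N) else 0);
            M3 = (\<lambda>y. bordered N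
              (\<lambda>a. if a < N then R (n - N + a)
                   else smult_vec (poly W y)
                          (jet s q m (\<lambda>z. CD_mixed B (n - 1) z y)
                             - xi_row ?e \<xi> ?M (CD_kernel B (n - 1) y))
                        + jet s q m (\<lambda>z. V z y))
              (\<lambda>a. if a = 0 then gb_norm B (n - N) else 0))
        in (\<forall>x. last_quasidet_defined (M1 x) \<and> poly (biorth1 B' n) x = last_quasidet (M1 x)) \<and>
           last_quasidet_defined M2 \<and> gb_norm B' n = last_quasidet M2 \<and>
           (\<forall>y. last_quasidet_defined (M3 y) \<and>
                poly (biorth2 B' n) y = - last_quasidet (M3 y))"
      unfolding Let_def
      using M1 M2 M3 unfolding R3_def[abs_def] c2_def R_def by blast
  qed
qed

end
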